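(* Let $u\in\mathcal{W}(I)$ be the solution of the unsteady heat equation $\partial_tu(t)+(-\Delta)u(t)=f(t)$ in $V^*$ for a.e. $t\in I$, $u(0)=u_0$ in $H$, with $f\in L^2(I;V^* )$ and $u_0\in H$, and let $z\coloneqq\nabla u$. Then, for every $(y,\lambda)\in L^2(I;Y^* )\times\mathcal{W}(I)$ with $\operatorname{div}y=\partial_t\lambda-f$ in $L^2(I;V^* )$, $$\tfrac12\|y-z\|_Q^2+\tfrac12\|\nabla(\lambda-u)\|_Q^2+\tfrac12\|(\lambda-u)(T)\|_H^2=\tfrac12\|y-\nabla\lambda\|_Q^2+\tfrac12\|\lambda(0)-u_0\|_H^2 .$$
   Context: $\Omega\subseteq\mathbb{R}^d$ is a bounded Lipschitz domain with boundary split into disjoint relatively open sets $\Gamma_D\ne\emptyset$ and $\Gamma_N$, $\overline\Gamma_D\cup\overline\Gamma_N=\partial\Omega$; $I=(0,T)$, $0<T<\infty$; $Q=I\times\Omega$. $V=W^{1,2}_D(\Omega)$ (zero trace on $\Gamma_D$) with norm $\|v\|_V=\|\nabla v\|_{L^2(\Omega)}$, $H=L^2(\Omega)$, $Y=Y^*=L^2(\Omega;\mathbb{R}^d)$. $V\hookrightarrow H\cong H^*\hookrightarrow V^*$ is the usual evolution triple and $\mathcal{W}(I)=\{v\in L^2(I;V)\mid\partial_tv\in L^2(I;V^* )\}\hookrightarrow C^0(\overline I;H)$. $L=\nabla\colon V\to Y$, and $L^*\colon Y^*\to V^*$ is its adjoint, $\langle L^*y,v\rangle_V=\int_\Omega y\cdot\nabla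 v\,dx$; $-\Delta=L^*\circ\nabla\colon V\to V^*$. In $V^*$, $\operatorname{div}y$ means $-L^*y$. Operators act pointwise in time. $\|\cdot\|_Q$ is the $L^2(Q)$-norm. *)

theory Defs
  imports "HOL-Analysis.Analysis"
begin

text \<open>
  Elements of a function space on \<open>\<Omega>\<close> are represented by functions on the whole ambient type;
  only their behaviour almost everywhere in \<open>\<Omega>\<close> matters. A space is given by a carrier set of
  such functions together with its norm, which is a seminorm on representatives. Differences of
  functions are the pointwise ones.
\<close>

section \<open>Domains and surface measure\<close>

text \<open>
  Locally, after a rigid motion, \<open>\<Omega>\<close> is the part of a cylinder above the graph of a Lipschitz
  function. The unit vector \<open>e\<close> is the vertical direction; horizontal coordinates are the
  component orthogonal to \<open>e\<close>.
\<close>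

definition horizontal :: "'a::real_inner \<Rightarrow> 'a \<Rightarrow> 'a" where
  "horizontal e x = x - (x \<bullet> e) *\<^sub>R e"

definition lipschitz_domain :: "'a::euclidean_space set \<Rightarrow> bool" where
  "lipschitz_domain \<Omega> \<longleftrightarrow> open \<Omega> \<and> connected \<Omega> \<and> \<Omega> \<noteq> {} \<and>
     (\<forall>p\<in>frontier \<Omega>. \<exists>e r h L. \<exists>g :: 'a \<Rightarrow> real.
        norm e = 1 \<and> 0 < r \<and> 0 < h \<and> L-lipschitz_on {y. y \<bullet> e = 0} g \<and>
        (\<forall>y. y \<bullet> e = 0 \<longrightarrow> norm y < r \<longrightarrow> \<bar>g y\<bar> < h) \<and>
        (\<forall>x. norm (horizontal e (x - p)) < r \<and> \<bar>(x - p) \<bullet> e\<bar> < h \<longrightarrow>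
             (x \<in> \<Omega> \<longleftrightarrow> g (horizontal e (x - p)) < (x - p) \<bullet> e)))"

text \<open>
  Integer-dimensional Hausdorff measure, normalised to agree with Lebesgue measure. Nonempty sets
  of diameter \<open>0\<close> have weight \<open>1\<close> for \<open>k = 0\<close> (counting measure), since \<open>0 ^ 0 = 1\<close>.
  Boundedness is required of covering sets because \<^const>\<open>diameter\<close> is meaningless otherwise.
\<close>

definition hausdorff_weight :: "nat \<Rightarrow> 'a::metric_space set \<Rightarrow> ennreal" where
  "hausdorff_weight k C =
     (if C = {} then 0 else ennreal (unit_ball_vol (real k) * (diameter C / 2) ^ k))"

definition hausdorff_outer :: "nat \<Rightarrow> 'a::metric_space set \<Rightarrow> ennreal" where
  "hausdorff_outer k A =
     (SUP \<delta>\<in>{0::real<..}.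
        INF C\<in>{C :: nat \<Rightarrow> 'a set. A \<subseteq> (\<Union>n. C n) \<and> (\<forall>n. bounded (C n) \<and> diameter (C n) \<le> \<delta>)}.
          \<Sum>n. hausdorff_weight k (C n))"

definition hausdorff_measure :: "nat \<Rightarrow> 'a::metric_space measure" where
  "hausdorff_measure k = measure_of UNIV (sets borel) (hausdorff_outer k)"

definition surface_measure :: "'a::euclidean_space set \<Rightarrow> 'a measure" where
  "surface_measure \<Omega> = restrict_space (hausdorff_measure (DIM('a) - 1)) (frontier \<Omega>)"

section \<open>Lebesgue and Sobolev spaces\<close>

definition L2 :: "'a::euclidean_space set \<Rightarrow> ('a \<Rightarrow> 'b::euclidean_space) set" where
  "L2 \<Omega> = {v. v \<in> borel_measurable (lebesgue_on \<Omega>) \<and>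
              integrable (lebesgue_on \<Omega>) (\<lambda>x. (norm (v x))\<^sup>2)}"

definition L2_norm :: "'a::euclidean_space set \<Rightarrow> ('a \<Rightarrow> 'b::euclidean_space) \<Rightarrow> real" where
  "L2_norm \<Omega> v = sqrt (LINT x|lebesgue_on \<Omega>. (norm (v x))\<^sup>2)"

definition L2_inner ::
  "'a::euclidean_space set \<Rightarrow> ('a \<Rightarrow> 'b::euclidean_space) \<Rightarrow> ('a \<Rightarrow> 'b) \<Rightarrow> real" where
  "L2_inner \<Omega> v w = (LINT x|lebesgue_on \<Omega>. v x \<bullet> w x)"

primrec Ck :: "nat \<Rightarrow> ('a::euclidean_space \<Rightarrow> real) \<Rightarrow> bool" where
  "Ck 0 \<phi> \<longleftrightarrow> continuous_on UNIV \<phi>"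
| "Ck (Suc k) \<phi> \<longleftrightarrow> (\<forall>x. \<phi> differentiable (at x)) \<and>
     (\<forall>b\<in>Basis. Ck k (\<lambda>x. frechet_derivative \<phi> (at x) b))"

definition smooth :: "('a::euclidean_space \<Rightarrow> real) \<Rightarrow> bool" where
  "smooth \<phi> \<longleftrightarrow> (\<forall>k. Ck k \<phi>)"

definition test_functions :: "'a::euclidean_space set \<Rightarrow> ('a \<Rightarrow> real) set" where
  "test_functions S =
     {\<phi>. smooth \<phi> \<and> compact (closure {x. \<phi> x \<noteq> 0}) \<and> closure {x. \<phi> x \<noteq> 0} \<subseteq> S}"

definition classical_grad :: "('a::euclidean_space \<Rightarrow> real) \<Rightarrow> 'a \<Rightarrow> 'a" where
  "classical_grad \<phi> x = (\<Sum>b\<in>Basis. frechet_derivative \<phi> (at x) b *\<^sub>R b)"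

definition is_weak_grad ::
  "'a::euclidean_space set \<Rightarrow> ('a \<Rightarrow> real) \<Rightarrow> ('a \<Rightarrow> 'a) \<Rightarrow> bool" where
  "is_weak_grad \<Omega> v G \<longleftrightarrow> (\<forall>\<phi>\<in>test_functions \<Omega>. \<forall>b\<in>Basis.
     (LINT x|lebesgue_on \<Omega>. v x * frechet_derivative \<phi> (at x) b) =
     - (LINT x|lebesgue_on \<Omega>. (G x \<bullet> b) * \<phi> x))"

definition W12 :: "'a::euclidean_space set \<Rightarrow> ('a \<Rightarrow> real) set" where
  "W12 \<Omega> = {v \<in> L2 \<Omega>. \<exists>G\<in>L2 \<Omega>. is_weak_grad \<Omega> v G}"

definition grad :: "'a::euclidean_space set \<Rightarrow> ('a \<Rightarrow> real) \<Rightarrow> 'a \<Rightarrow> 'a" where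
  "grad \<Omega> v = (SOME G. G \<in> L2 \<Omega> \<and> is_weak_grad \<Omega> v G)"

text \<open>
  The trace operator is the continuous extension to \<^term>\<open>W12 \<Omega>\<close> of the restriction to the
  boundary of functions smooth up to the boundary, with values in \<open>L\<^sup>2(\<partial>\<Omega>)\<close>.
\<close>

definition has_trace ::
  "'a::euclidean_space set \<Rightarrow> ('a \<Rightarrow> real) \<Rightarrow> ('a \<Rightarrow> real) \<Rightarrow> bool" where
  "has_trace \<Omega> v \<tau> \<longleftrightarrow>
     \<tau> \<in> borel_measurable (surface_measure \<Omega>) \<and>
     (\<integral>\<^sup>+x. ennreal ((\<tau> x)\<^sup>2) \<partial>surface_measure \<Omega>) < \<infinity> \<and>
     (\<exists>\<phi>. (\<forall>n. smooth (\<phi> n)) \<and>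
        (\<lambda>n. L2_norm \<Omega> (\<phi> n - v)) \<longlonglongrightarrow> 0 \<and>
        (\<lambda>n. L2_norm \<Omega> (classical_grad (\<phi> n) - grad \<Omega> v)) \<longlonglongrightarrow> 0 \<and>
        (\<lambda>n. \<integral>\<^sup>+x. ennreal ((\<phi> n x - \<tau> x)\<^sup>2) \<partial>surface_measure \<Omega>) \<longlonglongrightarrow> 0)"

definition V_space ::
  "'a::euclidean_space set \<Rightarrow> 'a set \<Rightarrow> ('a \<Rightarrow> real) set" where
  "V_space \<Omega> \<Gamma> = {v \<in> W12 \<Omega>. \<exists>\<tau>. has_trace \<Omega> v \<tau> \<and>
     (AE x in surface_measure \<Omega>. x \<in> \<Gamma> \<longrightarrow> \<tau> x = 0)}"

definition V_norm :: "'a::euclidean_space set \<Rightarrow> ('a \<Rightarrow> real) \<Rightarrow> real" where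
  "V_norm \<Omega> v = L2_norm \<Omega> (grad \<Omega> v)"

text \<open>Two functionals are equal in the dual of \<open>V\<close> if they agree on \<^term>\<open>V_space \<Omega> \<Gamma>\<close>.\<close>

definition V_dual ::
  "'a::euclidean_space set \<Rightarrow> 'a set \<Rightarrow> (('a \<Rightarrow> real) \<Rightarrow> real) set" where
  "V_dual \<Omega> \<Gamma> = {F.
     (\<forall>v\<in>V_space \<Omega> \<Gamma>. \<forall>w\<in>V_space \<Omega> \<Gamma>. \<forall>a b. F (\<lambda>x. a * v x + b * w x) = a * F v + b * F w) \<and>
     (\<exists>C. \<forall>v\<in>V_space \<Omega> \<Gamma>. \<bar>F v\<bar> \<le> C * V_norm \<Omega> v)}"

definition V_dual_norm ::
  "'a::euclidean_space set \<Rightarrow> 'a set \<Rightarrow> (('a \<Rightarrow> real) \<Rightarrow> real) \<Rightarrow> real" where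
  "V_dual_norm \<Omega> \<Gamma> F = (SUP v\<in>{v \<in> V_space \<Omega> \<Gamma>. V_norm \<Omega> v \<le> 1}. \<bar>F v\<bar>)"

definition L_adj :: "'a::euclidean_space set \<Rightarrow> ('a \<Rightarrow> 'a) \<Rightarrow> ('a \<Rightarrow> real) \<Rightarrow> real" where
  "L_adj \<Omega> y v = L2_inner \<Omega> y (grad \<Omega> v)"

definition div_dual :: "'a::euclidean_space set \<Rightarrow> ('a \<Rightarrow> 'a) \<Rightarrow> ('a \<Rightarrow> real) \<Rightarrow> real" where
  "div_dual \<Omega> y v = - L_adj \<Omega> y v"

definition neg_laplace ::
  "'a::euclidean_space set \<Rightarrow> ('a \<Rightarrow> real) \<Rightarrow> ('a \<Rightarrow> real) \<Rightarrow> real" where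
  "neg_laplace \<Omega> v = L_adj \<Omega> (grad \<Omega> v)"

section \<open>Bochner spaces and the evolution space\<close>

text \<open>
  Strong measurability and square integrability of a function with values in a space with carrier
  \<open>X\<close> and norm \<open>N\<close>. The Bochner integral of the library needs a Banach space that is a type,
  whereas the spaces here depend on the domain.
\<close>

definition strongly_measurable ::
  "'t measure \<Rightarrow> 'x::minus set \<Rightarrow> ('x \<Rightarrow> real) \<Rightarrow> ('t \<Rightarrow> 'x) \<Rightarrow> bool" where
  "strongly_measurable M X N u \<longleftrightarrow> (\<exists>s.
     (\<forall>n::nat. simple_function M (s n) \<and> s n ` space M \<subseteq> X) \<and>
     (AE t in M. (\<lambda>n. N (s n t - u t)) \<longlonglongrightarrow> 0))"

definition L2_Bochner ::
  "real \<Rightarrow> 'x::minus set \<Rightarrow> ('x \<Rightarrow> real) \<Rightarrow> (real \<Rightarrow> 'x) set" where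
  "L2_Bochner T X N = {u.
     (AE t in lebesgue_on {0<..<T}. u t \<in> X) \<and>
     strongly_measurable (lebesgue_on {0<..<T}) X N u \<and>
     integrable (lebesgue_on {0<..<T}) (\<lambda>t. (N (u t))\<^sup>2)}"

abbreviation L2_V ::
  "real \<Rightarrow> 'a::euclidean_space set \<Rightarrow> 'a set \<Rightarrow> (real \<Rightarrow> 'a \<Rightarrow> real) set" where
  "L2_V T \<Omega> \<Gamma> \<equiv> L2_Bochner T (V_space \<Omega> \<Gamma>) (V_norm \<Omega>)"

abbreviation L2_V_dual ::
  "real \<Rightarrow> 'a::euclidean_space set \<Rightarrow> 'a set \<Rightarrow> (real \<Rightarrow> ('a \<Rightarrow> real) \<Rightarrow> real) set" where
  "L2_V_dual T \<Omega> \<Gamma> \<equiv> L2_Bochner T (V_dual \<Omega> \<Gamma>) (V_dual_norm \<Omega> \<Gamma>)"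

abbreviation L2_Y ::
  "real \<Rightarrow> 'a::euclidean_space set \<Rightarrow> (real \<Rightarrow> 'a \<Rightarrow> 'a) set" where
  "L2_Y T \<Omega> \<equiv> L2_Bochner T (L2 \<Omega>) (L2_norm \<Omega>)"

text \<open>
  Distributional time derivative with respect to the evolution triple: a function \<open>v\<close> with values
  in \<open>V\<close> is regarded as a function with values in the dual of \<open>V\<close> through the inner product
  of \<open>H = L\<^sup>2(\<Omega>)\<close>, and the defining identity in the dual is evaluated at each \<open>w\<close> in \<open>V\<close>.
\<close>

definition has_time_deriv ::
  "real \<Rightarrow> 'a::euclidean_space set \<Rightarrow> 'a set \<Rightarrow> (real \<Rightarrow> 'a \<Rightarrow> real) \<Rightarrow>
   (real \<Rightarrow> ('a \<Rightarrow> real) \<Rightarrow> real) \<Rightarrow> bool" where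
  "has_time_deriv T \<Omega> \<Gamma> v F \<longleftrightarrow>
     (\<forall>\<phi>\<in>test_functions {0<..<T}. \<forall>w\<in>V_space \<Omega> \<Gamma>.
        has_bochner_integral (lebesgue_on {0<..<T}) (\<lambda>t. deriv \<phi> t * L2_inner \<Omega> (v t) w)
          (- (LINT t|lebesgue_on {0<..<T}. \<phi> t * F t w)))"

definition W_evol ::
  "real \<Rightarrow> 'a::euclidean_space set \<Rightarrow> 'a set \<Rightarrow> (real \<Rightarrow> 'a \<Rightarrow> real) set" where
  "W_evol T \<Omega> \<Gamma> = {v \<in> L2_V T \<Omega> \<Gamma>. \<exists>F\<in>L2_V_dual T \<Omega> \<Gamma>. has_time_deriv T \<Omega> \<Gamma> v F}"

definition time_deriv ::
  "real \<Rightarrow> 'a::euclidean_space set \<Rightarrow> 'a set \<Rightarrow> (real \<Rightarrow> 'a \<Rightarrow> real) \<Rightarrow>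
   real \<Rightarrow> ('a \<Rightarrow> real) \<Rightarrow> real" where
  "time_deriv T \<Omega> \<Gamma> v = (SOME F. F \<in> L2_V_dual T \<Omega> \<Gamma> \<and> has_time_deriv T \<Omega> \<Gamma> v F)"

text \<open>
  The continuous representative, with values in \<open>H\<close>, on the closed time interval; it gives meaning
  to point values in time of members of \<^const>\<open>W_evol\<close>.
\<close>

definition is_cont_rep ::
  "real \<Rightarrow> 'a::euclidean_space set \<Rightarrow> (real \<Rightarrow> 'a \<Rightarrow> real) \<Rightarrow> (real \<Rightarrow> 'a \<Rightarrow> real) \<Rightarrow> bool" where
  "is_cont_rep T \<Omega> v c \<longleftrightarrow>
     (\<forall>t\<in>{0..T}. c t \<in> L2 \<Omega>) \<and>
     (\<forall>t\<in>{0..T}. ((\<lambda>s. L2_norm \<Omega> (c s - c t)) \<longlongrightarrow> 0) (at t within {0..T})) \<and>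
     (AE t in lebesgue_on {0<..<T}. AE x in lebesgue_on \<Omega>. c t x = v t x)"

definition cont_rep ::
  "real \<Rightarrow> 'a::euclidean_space set \<Rightarrow> (real \<Rightarrow> 'a \<Rightarrow> real) \<Rightarrow> real \<Rightarrow> 'a \<Rightarrow> real" where
  "cont_rep T \<Omega> v = (SOME c. is_cont_rep T \<Omega> v c)"

text \<open>
  Norm of \<open>L\<^sup>2(Q)\<close>, \<open>Q = (0,T) \<times> \<Omega>\<close>, written as an iterated integral because members of
  \<open>L\<^sup>2(I; L\<^sup>2(\<Omega>))\<close> are determined only up to a null set of \<open>\<Omega>\<close> at each time, so that a
  representative need not be jointly measurable. If it is, this is the integral over \<open>Q\<close>.
\<close>

definition Q_norm ::
  "real \<Rightarrow> 'a::euclidean_space set \<Rightarrow> (real \<Rightarrow> 'a \<Rightarrow> 'b::euclidean_space) \<Rightarrow> real" where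
  "Q_norm T \<Omega> y = sqrt (LINT t|lebesgue_on {0<..<T}. LINT x|lebesgue_on \<Omega>. (norm (y t x))\<^sup>2)"

lemma lebesgue_on_lborel:
  fixes f :: "'a::euclidean_space \<Rightarrow> real"
  assumes "S \<in> sets borel" "f \<in> borel_measurable borel"
  shows "(LINT x|lebesgue_on S. f x) = (LINT x|lborel. indicator S x * f x)"
proof -
  have "(LINT x|lebesgue_on S. f x) = (LINT x|lebesgue. indicator S x * f x)"
    using assms(1) by (subst integral_restrict_space) auto
  also have "\<dots> = (LINT x|lborel. indicator S x * f x)"
    using assms by (intro integral_completion) auto
  finally show ?thesis .
qed

lemma Q_norm_eq_L2_norm:
  fixes y :: "real \<Rightarrow> 'a::euclidean_space \<Rightarrow> 'b::euclidean_space"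
  assumes [measurable]: "open \<Omega>" "case_prod y \<in> borel_measurable borel"
    and int: "integrable lborel (\<lambda>p. indicator ({0<..<T} \<times> \<Omega>) p * (norm (case_prod y p))\<^sup>2)"
  shows "Q_norm T \<Omega> y = L2_norm ({0<..<T} \<times> \<Omega>) (case_prod y)"
proof -
  have [measurable]: "\<Omega> \<in> sets borel" using assms by simp
  have ym: "case_prod y \<in> borel_measurable (borel \<Otimes>\<^sub>M borel)"
    using assms(2) by (simp only: borel_prod)
  then have [measurable]: "(\<lambda>x. y t x) \<in> borel_measurable borel" for t
    by measurable
  have [measurable]: "(\<lambda>t. LINT x|lborel. indicator \<Omega> x * (norm (y t x))\<^sup>2) \<in> borel_measurable borel"
    using ym by measurable
  have "(LINT t|lebesgue_on {0<..<T}. LINT x|lebesgue_on \<Omega>. (norm (y t x))\<^sup>2) =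
        (LINT t|lborel. indicator {0<..<T} t * (LINT x|lborel. indicator \<Omega> x * (norm (y t x))\<^sup>2))"
    by (simp add: lebesgue_on_lborel)
  also have "\<dots> = (LINT t|lborel. LINT x|lborel.
      indicator ({0<..<T} \<times> \<Omega>) (t, x) * (norm (case_prod y (t, x)))\<^sup>2)"
    by (simp add: indicator_times mult.assoc)
  also have "\<dots> = (LINT p|lborel. indicator ({0<..<T} \<times> \<Omega>) p * (norm (case_prod y p))\<^sup>2)"
    using lborel_pair.integral_fst'[of "\<lambda>p. indicator ({0<..<T} \<times> \<Omega>) p * (norm (case_prod y p))\<^sup>2"] int
    by (simp add: lborel_prod)
  also have "\<dots> = (LINT p|lebesgue_on ({0<..<T} \<times> \<Omega>). (norm (case_prod y p))\<^sup>2)"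
    using assms by (subst lebesgue_on_lborel) (auto intro!: borel_open open_Times)
  finally show ?thesis by (simp add: Q_norm_def L2_norm_def)
qed

end

theory Submission
  imports Defs "HOL-Library.Function_Algebras"
begin

text \<open>
  Put \<open>e = \<lambda> - u\<close>. Subtracting the two equations, \<open>\<partial>\<^sub>t e = - L\<^sup>*(y - z)\<close>, so the energy identity
  \<open>\<parallel>e(T)\<parallel>\<^sup>2 - \<parallel>e(0)\<parallel>\<^sup>2 = 2 \<integral> \<langle>\<partial>\<^sub>t e, e\<rangle>\<close> turns the cross term of
  \<open>\<parallel>(y - z) - grad e\<parallel>\<^sup>2\<close> into boundary terms. The energy identity is proved without mollification: on a set
  \<open>G\<close> of times of full measure \<open>(e(t) - e(s), w) = \<integral>\<^sub>s\<^sup>t \<langle>\<partial>\<^sub>t e, w\<rangle>\<close> holds for all \<open>w \<in> V\<close>. Testing with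
  \<open>w = e(s) + e(t)\<close> and using continuity of translations in \<open>L\<^sup>2(0,T;V)\<close>, the function
  \<open>\<parallel>e(t)\<parallel>\<^sup>2 - 2 \<integral>\<^sub>0\<^sup>t \<langle>\<partial>\<^sub>t e, e\<rangle>\<close> has increments of order \<open>o(h)\<close> on average, hence is constant. Testing with
  \<open>w = e(s)\<close>, where \<open>\<parallel>e(s)\<parallel>\<^sub>V\<close> is at most its mean over a short interval, bounds the oscillation of \<open>e\<close> in \<open>H\<close>
  and yields its continuous representative.
\<close>

section \<open>The spaces \<open>L\<^sup>2\<close>\<close>

text \<open>The spaces are sets of representatives with seminorms, so no integral with values in
  \<open>V\<close> or its dual is formed and every identity is tested with a fixed \<open>w\<close>.
  The weak derivative then gives, for each \<open>w\<close>, a scalar identity off a null set that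
  depends on \<open>w\<close>, while the energy argument inserts a \<open>w\<close> that depends on
  time. Separability of \<open>V\<close>, in the gradient norm and in L2 at once, yields one set
  \<open>G\<close> of good times for all \<open>w\<close>. A second obstacle is measurability:
  translations and Fubini act on functions of two times, for which Lebesgue measurability is too
  weak, so \<open>G\<close> and the approximations of \<open>e\<close> are made Borel. Finally
  \<open>grad\<close>, \<open>time_deriv\<close> and \<open>cont_rep\<close> are choices. Rules for
  \<open>grad\<close> are recovered almost everywhere from uniqueness of weak gradients; the energy
  identity is proved for an arbitrary weak derivative \<open>F\<close>, so that the difference of
  the two chosen derivatives serves for \<open>e\<close>; and \<open>cont_rep\<close> has its
  defining properties only once a continuous representative is known to exist, which is applied to
  \<open>lam\<close>, \<open>u\<close> and \<open>e\<close> in turn.\<close>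

lemma L2_D:
  assumes "f \<in> L2 \<Omega>"
  shows L2_measurable: "f \<in> borel_measurable (lebesgue_on \<Omega>)"
    and L2_integrable_sq: "integrable (lebesgue_on \<Omega>) (\<lambda>x. (norm (f x))\<^sup>2)"
  using assms by (auto simp: L2_def)

lemma norm_sq_lincomb_le:
  fixes u v :: "'b::real_inner"
  shows "(norm (a *\<^sub>R u + b *\<^sub>R v))\<^sup>2 \<le> 2 * a\<^sup>2 * (norm u)\<^sup>2 + 2 * b\<^sup>2 * (norm v)\<^sup>2"
proof -
  have "norm (a *\<^sub>R u + b *\<^sub>R v) \<le> \<bar>a\<bar> * norm u + \<bar>b\<bar> * norm v"
    by (metis norm_scaleR norm_triangle_ineq)
  then have "(norm (a *\<^sub>R u + b *\<^sub>R v))\<^sup>2 \<le> (\<bar>a\<bar> * norm u + \<bar>b\<bar> * norm v)\<^sup>2"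
    by (simp add: power_mono)
  also have "\<dots> \<le> 2 * (\<bar>a\<bar> * norm u)\<^sup>2 + 2 * (\<bar>b\<bar> * norm v)\<^sup>2"
    using sum_squares_bound[of "\<bar>a\<bar> * norm u" "\<bar>b\<bar> * norm v"] by (simp add: power2_sum)
  finally show ?thesis by (simp add: power_mult_distrib)
qed

lemma L2_lincomb:
  assumes f: "f \<in> L2 \<Omega>" and g: "g \<in> L2 \<Omega>"
  shows "(\<lambda>x. a *\<^sub>R f x + b *\<^sub>R g x) \<in> L2 \<Omega>"
proof -
  note [measurable] = L2_measurable[OF f] L2_measurable[OF g]
  have "integrable (lebesgue_on \<Omega>) (\<lambda>x. 2 * a\<^sup>2 * (norm (f x))\<^sup>2 + 2 * b\<^sup>2 * (norm (g x))\<^sup>2)"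
    using L2_integrable_sq[OF f] L2_integrable_sq[OF g] by simp
  then have "integrable (lebesgue_on \<Omega>) (\<lambda>x. (norm (a *\<^sub>R f x + b *\<^sub>R g x))\<^sup>2)"
    by (rule Bochner_Integration.integrable_bound)
       (auto intro!: AE_I2 order_trans[OF norm_sq_lincomb_le])
  then show ?thesis by (simp add: L2_def)
qed

lemma L2_zero [simp]: "0 \<in> L2 \<Omega>"
  by (simp add: L2_def zero_fun_def)

lemma L2_minus: "f \<in> L2 \<Omega> \<Longrightarrow> g \<in> L2 \<Omega> \<Longrightarrow> f - g \<in> L2 \<Omega>"
  using L2_lincomb[of f \<Omega> g 1 "-1"] by (simp add: fun_diff_def)

lemma L2_plus: "f \<in> L2 \<Omega> \<Longrightarrow> g \<in> L2 \<Omega> \<Longrightarrow> f + g \<in> L2 \<Omega>"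
  using L2_lincomb[of f \<Omega> g 1 1] by (simp add: plus_fun_def)

lemma L2_integrable_inner:
  assumes f: "f \<in> L2 \<Omega>" and g: "g \<in> L2 \<Omega>"
  shows "integrable (lebesgue_on \<Omega>) (\<lambda>x. f x \<bullet> g x)"
proof -
  note [measurable] = L2_measurable[OF f] L2_measurable[OF g]
  have "integrable (lebesgue_on \<Omega>) (\<lambda>x. (norm (f x))\<^sup>2 + (norm (g x))\<^sup>2)"
    using L2_integrable_sq[OF f] L2_integrable_sq[OF g] by simp
  moreover have ineq: "\<bar>u \<bullet> v\<bar> \<le> (norm u)\<^sup>2 + (norm v)\<^sup>2" for u v :: 'b
  proof -
    have "\<bar>u \<bullet> v\<bar> \<le> norm u * norm v" by (rule Cauchy_Schwarz_ineq2)
    also have "\<dots> \<le> (norm u)\<^sup>2 + (norm v)\<^sup>2"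
      using sum_squares_bound[of "norm u" "norm v"] mult_nonneg_nonneg[OF norm_ge_zero[of u] norm_ge_zero[of v]]
      by linarith
    finally show ?thesis .
  qed
  ultimately show ?thesis
    by (elim Bochner_Integration.integrable_bound) (auto intro!: AE_I2 ineq)
qed

lemma L2_inner_lincomb_left:
  assumes "f \<in> L2 \<Omega>" "g \<in> L2 \<Omega>" "h \<in> L2 \<Omega>"
  shows "L2_inner \<Omega> (\<lambda>x. a *\<^sub>R f x + b *\<^sub>R g x) h = a * L2_inner \<Omega> f h + b * L2_inner \<Omega> g h"
  using L2_integrable_inner[OF assms(1,3)] L2_integrable_inner[OF assms(2,3)]
  by (simp add: L2_inner_def inner_add_left)

lemma L2_inner_commute: "L2_inner \<Omega> f g = L2_inner \<Omega> g f"
  by (simp add: L2_inner_def inner_commute)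

lemma L2_inner_lincomb_right:
  assumes "f \<in> L2 \<Omega>" "g \<in> L2 \<Omega>" "h \<in> L2 \<Omega>"
  shows "L2_inner \<Omega> h (\<lambda>x. a *\<^sub>R f x + b *\<^sub>R g x) = a * L2_inner \<Omega> h f + b * L2_inner \<Omega> h g"
  using L2_inner_lincomb_left[OF assms] by (simp add: L2_inner_commute)

lemma L2_inner_diff_left:
  assumes "f \<in> L2 \<Omega>" "g \<in> L2 \<Omega>" "h \<in> L2 \<Omega>"
  shows "L2_inner \<Omega> (f - g) h = L2_inner \<Omega> f h - L2_inner \<Omega> g h"
  using L2_inner_lincomb_left[OF assms, of 1 "-1"] by (simp add: fun_diff_def)

lemma L2_inner_diff_right:
  assumes "f \<in> L2 \<Omega>" "g \<in> L2 \<Omega>" "h \<in> L2 \<Omega>"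
  shows "L2_inner \<Omega> h (f - g) = L2_inner \<Omega> h f - L2_inner \<Omega> h g"
  using L2_inner_diff_left[OF assms] by (simp add: L2_inner_commute)

lemma L2_norm_nonneg [simp]: "0 \<le> L2_norm \<Omega> f"
  by (simp add: L2_norm_def)

lemma L2_norm_zero [simp]: "L2_norm \<Omega> 0 = 0"
  by (simp add: L2_norm_def)

lemma L2_norm_sq: "(L2_norm \<Omega> f)\<^sup>2 = L2_inner \<Omega> f f"
  by (simp add: L2_norm_def L2_inner_def power2_norm_eq_inner)

lemma L2_norm_cong:
  assumes "AE x in lebesgue_on \<Omega>. f x = g x" "f \<in> L2 \<Omega>" "g \<in> L2 \<Omega>"
  shows "L2_norm \<Omega> f = L2_norm \<Omega> g"
  unfolding L2_norm_def
  by (rule arg_cong[where f=sqrt], rule integral_cong_AE)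
     (use assms in \<open>auto simp: L2_def\<close>)

lemma L2_norm_eq_0_iff:
  assumes "f \<in> L2 \<Omega>"
  shows "L2_norm \<Omega> f = 0 \<longleftrightarrow> (AE x in lebesgue_on \<Omega>. f x = 0)"
  using integral_nonneg_eq_0_iff_AE[OF L2_integrable_sq[OF assms]]
  by (simp add: L2_norm_def)

text \<open>The form is only positive semidefinite on representatives, so the discriminant argument
  treats a vanishing norm of \<open>g\<close> separately.\<close>

lemma L2_Cauchy_Schwarz:
  assumes f: "f \<in> L2 \<Omega>" and g: "g \<in> L2 \<Omega>"
  shows "\<bar>L2_inner \<Omega> f g\<bar> \<le> L2_norm \<Omega> f * L2_norm \<Omega> g"
proof -
  define A where "A = L2_inner \<Omega> f f"
  define B where "B = L2_inner \<Omega> g g"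
  define C where "C = L2_inner \<Omega> f g"
  have nn: "0 \<le> L2_inner \<Omega> h h" for h :: "'a \<Rightarrow> 'b"
    by (simp add: L2_norm_sq[symmetric])
  have q: "0 \<le> a * a * A + 2 * a * b * C + b * b * B" for a b
  proof -
    have "0 \<le> L2_inner \<Omega> (\<lambda>x. a *\<^sub>R f x + b *\<^sub>R g x) (\<lambda>x. a *\<^sub>R f x + b *\<^sub>R g x)" by (rule nn)
    also have "\<dots> = a * a * A + 2 * a * b * C + b * b * B"
      using f g by (simp add: L2_inner_lincomb_left L2_inner_lincomb_right L2_lincomb
          A_def B_def C_def L2_inner_commute[of \<Omega> g f] algebra_simps)
    finally show ?thesis .
  qed
  have "C\<^sup>2 \<le> A * B"
  proof (cases "B = 0")
    case True
    \<comment> \<open>An affine function of \<open>b\<close> that is bounded below is constant: the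
      value of \<open>b\<close> in the next line would make the expression equal to -1.\<close>
    have "0 \<le> A + 2 * b * C" for b using q[of 1 b] True by simp
    from this[of "- (A + 1) / (2 * C)"] have "C = 0" by (cases "C = 0") (auto simp: field_simps)
    then show ?thesis using True by simp
  next
    case False
    then have "B > 0" using nn[of g] by (simp add: B_def)
    \<comment> \<open>The form is evaluated at \<open>B\<close> times the minimising combination,
      which avoids a division.\<close>
    have "0 \<le> B * (A * B - C\<^sup>2)"
      using q[of B "-C"] by (simp add: algebra_simps power2_eq_square)
    then show ?thesis using \<open>B > 0\<close> by (simp add: zero_le_mult_iff)
  qed
  then have "C\<^sup>2 \<le> (L2_norm \<Omega> f * L2_norm \<Omega> g)\<^sup>2"
    by (simp add: A_def B_def power_mult_distrib L2_norm_sq)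
  then show ?thesis
    by (simp add: C_def abs_le_square_iff[symmetric] abs_mult)
qed

lemma L2_norm_diff_sq:
  assumes f: "f \<in> L2 \<Omega>" and g: "g \<in> L2 \<Omega>"
  shows "(L2_norm \<Omega> (f - g))\<^sup>2 = (L2_norm \<Omega> f)\<^sup>2 - 2 * L2_inner \<Omega> f g + (L2_norm \<Omega> g)\<^sup>2"
  using f g by (simp add: L2_norm_sq L2_inner_diff_left L2_inner_diff_right L2_minus
      L2_inner_commute[of \<Omega> g f])

lemma L2_norm_triangle_minus:
  assumes f: "f \<in> L2 \<Omega>" and g: "g \<in> L2 \<Omega>"
  shows "L2_norm \<Omega> (f - g) \<le> L2_norm \<Omega> f + L2_norm \<Omega> g"
proof (rule power2_le_imp_le)
  show "(L2_norm \<Omega> (f - g))\<^sup>2 \<le> (L2_norm \<Omega> f + L2_norm \<Omega> g)\<^sup>2"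
    using L2_Cauchy_Schwarz[OF f g] by (simp add: L2_norm_diff_sq[OF f g] power2_sum)
qed simp

lemma L2_norm_scale: "L2_norm \<Omega> (\<lambda>x. a *\<^sub>R f x) = \<bar>a\<bar> * L2_norm \<Omega> f"
  by (simp add: L2_norm_def power_mult_distrib real_sqrt_mult)

text \<open>The spaces are carrier sets of representatives, so the type classes for normed spaces do
  not apply. This locale provides the seminorm calculus for L2 and for \<open>V\<close> alike;
  closure under differences is the group structure on which the Bochner spaces below rest.\<close>

locale seminormed_carrier =
  fixes X :: "'x::ab_group_add set" and N :: "'x \<Rightarrow> real"
  assumes zero_mem: "0 \<in> X"
    and minus_mem: "x \<in> X \<Longrightarrow> y \<in> X \<Longrightarrow> x - y \<in> X"
    and norm_zero: "N 0 = 0"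
    and norm_minus_le: "x \<in> X \<Longrightarrow> y \<in> X \<Longrightarrow> N (x - y) \<le> N x + N y"
begin

lemma uminus_mem: "x \<in> X \<Longrightarrow> - x \<in> X"
  using minus_mem[OF zero_mem] by force

lemma norm_uminus: "x \<in> X \<Longrightarrow> N (- x) = N x"
  using norm_minus_le[OF zero_mem, of x] norm_minus_le[OF zero_mem, of "-x"] uminus_mem[of x]
  by (simp add: norm_zero)

lemma norm_minus_commute: "x \<in> X \<Longrightarrow> y \<in> X \<Longrightarrow> N (x - y) = N (y - x)"
  using norm_uminus[of "x - y"] minus_mem[of x y] by simp

lemma norm_nonneg: "x \<in> X \<Longrightarrow> 0 \<le> N x"
  using norm_minus_le[of x x] by (simp add: norm_zero)

lemma norm_plus_le: "x \<in> X \<Longrightarrow> y \<in> X \<Longrightarrow> N (x + y) \<le> N x + N y"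
  using norm_minus_le[of x "-y"] uminus_mem[of y] norm_uminus[of y] by simp

lemma norm_triangle: "x \<in> X \<Longrightarrow> y \<in> X \<Longrightarrow> z \<in> X \<Longrightarrow> N (x - z) \<le> N (x - y) + N (y - z)"
  using norm_plus_le[of "x - y" "y - z"] minus_mem by simp

lemma norm_le_minus: "x \<in> X \<Longrightarrow> y \<in> X \<Longrightarrow> N x \<le> N (x - y) + N y"
  using norm_plus_le[of "x - y" y] minus_mem by simp

lemma abs_norm_diff_le: "x \<in> X \<Longrightarrow> y \<in> X \<Longrightarrow> \<bar>N x - N y\<bar> \<le> N (x - y)"
  using norm_le_minus[of x y] norm_le_minus[of y x] norm_minus_commute[of x y] by linarith

lemma norm_minus_minus:
  "a \<in> X \<Longrightarrow> b \<in> X \<Longrightarrow> c \<in> X \<Longrightarrow> d \<in> X \<Longrightarrow> N ((a - b) - (c - d)) \<le> N (a - c) + N (b - d)"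
  using norm_minus_le[of "a - c" "b - d"] minus_mem by (simp add: algebra_simps)

end

interpretation L2: seminormed_carrier "L2 \<Omega>" "L2_norm \<Omega>"
  by unfold_locales (auto intro: L2_minus L2_norm_triangle_minus)

text \<open>Cauchy-Schwarz against the constant 1, which is in L2 because the measure is
  finite.\<close>

lemma L2_has_integrable_norm:
  assumes f: "f \<in> L2 \<Omega>" and \<Omega>: "\<Omega> \<in> lmeasurable"
  shows "integrable (lebesgue_on \<Omega>) (\<lambda>x. norm (f x))"
    and "(LINT x|lebesgue_on \<Omega>. norm (f x)) \<le> sqrt (measure lebesgue \<Omega>) * L2_norm \<Omega> f"
proof -
  note [measurable] = L2_measurable[OF f]
  have fin: "finite_measure (lebesgue_on \<Omega>)" using \<Omega> by (rule finite_measure_lebesgue_on)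
  then have one: "(\<lambda>x. 1::real) \<in> L2 \<Omega>"
    by (simp add: L2_def finite_measure.integrable_const)
  have nf: "(\<lambda>x. norm (f x)) \<in> L2 \<Omega>"
    using L2_integrable_sq[OF f] by (simp add: L2_def)
  have "integrable (lebesgue_on \<Omega>) (\<lambda>x. 1 \<bullet> norm (f x))"
    by (rule L2_integrable_inner[OF one nf])
  then show "integrable (lebesgue_on \<Omega>) (\<lambda>x. norm (f x))" by simp
  have "(LINT x|lebesgue_on \<Omega>. norm (f x)) = L2_inner \<Omega> (\<lambda>x. 1) (\<lambda>x. norm (f x))"
    by (simp add: L2_inner_def)
  also have "\<dots> \<le> L2_norm \<Omega> (\<lambda>x. 1::real) * L2_norm \<Omega> (\<lambda>x. norm (f x))"
    using L2_Cauchy_Schwarz[OF one nf] by simp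
  also have "\<dots> = sqrt (measure lebesgue \<Omega>) * L2_norm \<Omega> f"
    using \<Omega> by (simp add: L2_norm_def measure_restrict_space fmeasurableD)
  finally show "(LINT x|lebesgue_on \<Omega>. norm (f x)) \<le> sqrt (measure lebesgue \<Omega>) * L2_norm \<Omega> f" .
qed

text \<open>On a set of finite measure an L2-Cauchy sequence is Cauchy in L1, so a subsequence
  converges almost everywhere; Fatou's lemma turns the Cauchy estimates into estimates against the
  pointwise limit.\<close>

lemma L2_complete:
  assumes \<Omega>: "\<Omega> \<in> lmeasurable" and s: "\<And>n. s n \<in> L2 \<Omega>"
    and cauchy: "\<And>e. e > 0 \<Longrightarrow> \<exists>n0::nat. \<forall>i\<ge>n0. \<forall>j\<ge>n0. L2_norm \<Omega> (s i - s j) < e"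
  obtains f :: "'a::euclidean_space \<Rightarrow> 'b::euclidean_space"
  where "f \<in> L2 \<Omega>" "(\<lambda>n. L2_norm \<Omega> (s n - f)) \<longlonglongrightarrow> 0"
proof -
  note [measurable] = L2_measurable[OF s]
  have int: "integrable (lebesgue_on \<Omega>) (s n)" for n
    using L2_has_integrable_norm(1)[OF s \<Omega>, of n] L2_measurable[OF s, of n] by (simp add: integrable_norm_iff)
  have L1: "\<exists>n0. \<forall>i\<ge>n0. \<forall>j\<ge>n0. (LINT x|lebesgue_on \<Omega>. norm (s i x - s j x)) < e" if "e > 0" for e
  proof -
    \<comment> \<open>The summand 1 keeps the constant positive when \<Omega> is a null set.\<close>
    let ?c = "sqrt (measure lebesgue \<Omega>) + 1"
    have c: "?c > 0" by (simp add: add_nonneg_pos)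
    obtain n0 where n0: "\<And>i j. i \<ge> n0 \<Longrightarrow> j \<ge> n0 \<Longrightarrow> L2_norm \<Omega> (s i - s j) < e / ?c"
      using cauchy[of "e / ?c"] \<open>e > 0\<close> c by (metis divide_pos_pos)
    have "(LINT x|lebesgue_on \<Omega>. norm (s i x - s j x)) < e" if "i \<ge> n0" "j \<ge> n0" for i j
    proof -
      have "(LINT x|lebesgue_on \<Omega>. norm ((s i - s j) x)) \<le> sqrt (measure lebesgue \<Omega>) * L2_norm \<Omega> (s i - s j)"
        by (rule L2_has_integrable_norm(2)[OF L2_minus[OF s s] \<Omega>])
      also have "\<dots> \<le> ?c * L2_norm \<Omega> (s i - s j)" by (intro mult_right_mono) auto
      also have "\<dots> < ?c * (e / ?c)" using n0[OF that] c by (intro mult_strict_left_mono)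
      also have "\<dots> = e" using c by (metis less_irrefl nonzero_mult_div_cancel_left times_divide_eq_right)
      finally show ?thesis by simp
    qed
    then show ?thesis by blast
  qed
  obtain r where r: "strict_mono r" and ae: "AE x in lebesgue_on \<Omega>. Cauchy (\<lambda>i. s (r i) x)"
    by (rule cauchy_L1_AE_cauchy_subseq[OF int L1])
  define f where "f x = lim (\<lambda>i. s (r i) x)" for x
  have [measurable]: "f \<in> borel_measurable (lebesgue_on \<Omega>)"
    unfolding f_def by measurable
  have lim: "AE x in lebesgue_on \<Omega>. (\<lambda>i. s (r i) x) \<longlonglongrightarrow> f x"
    using ae by eventually_elim (simp add: f_def Cauchy_convergent_iff convergent_LIMSEQ_iff)
  \<comment> \<open>Fatou along \<open>r\<close> with \<open>n\<close> fixed gives membership of the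
    difference and the rate together; membership of \<open>f\<close> follows by adding
    \<open>s n0\<close> back.\<close>
  have key: "f - s n \<in> L2 \<Omega> \<and> (L2_norm \<Omega> (f - s n))\<^sup>2 \<le> e\<^sup>2"
    if "n \<ge> n0" and n0: "\<And>i j. i \<ge> n0 \<Longrightarrow> j \<ge> n0 \<Longrightarrow> L2_norm \<Omega> (s i - s j) < e" for n n0 e
  proof -
    have e: "e > 0" using n0[of n0 n0] by simp
    have "(\<integral>\<^sup>+x. ennreal ((norm (f x - s n x))\<^sup>2) \<partial>lebesgue_on \<Omega>)
      = (\<integral>\<^sup>+x. liminf (\<lambda>i. ennreal ((norm (s (r i) x - s n x))\<^sup>2)) \<partial>lebesgue_on \<Omega>)"
    proof (rule nn_integral_cong_AE)
      show "AE x in lebesgue_on \<Omega>. ennreal ((norm (f x - s n x))\<^sup>2) =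
           liminf (\<lambda>i. ennreal ((norm (s (r i) x - s n x))\<^sup>2))"
        using lim
      proof eventually_elim
        case (elim x)
        have "(\<lambda>i. ennreal ((norm (s (r i) x - s n x))\<^sup>2)) \<longlonglongrightarrow> ennreal ((norm (f x - s n x))\<^sup>2)"
          by (intro tendsto_ennrealI tendsto_intros elim)
        then show ?case by (rule lim_imp_Liminf[OF trivial_limit_sequentially, symmetric])
      qed
    qed
    also have "\<dots> \<le> liminf (\<lambda>i. \<integral>\<^sup>+x. ennreal ((norm (s (r i) x - s n x))\<^sup>2) \<partial>lebesgue_on \<Omega>)"
      by (rule nn_integral_liminf) measurable
    also have "\<dots> \<le> liminf (\<lambda>i. ennreal (e\<^sup>2))"
    proof (rule Liminf_mono)
      show "\<forall>\<^sub>F i in sequentially. (\<integral>\<^sup>+x. ennreal ((norm (s (r i) x - s n x))\<^sup>2) \<partial>lebesgue_on \<Omega>) \<le> ennreal (e\<^sup>2)"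
        using eventually_ge_at_top[of n0]
      proof eventually_elim
        case (elim i)
        then have "r i \<ge> n0" using seq_suble[OF r, of i] by linarith
        then have "L2_norm \<Omega> (s (r i) - s n) < e" using n0 \<open>n \<ge> n0\<close> by blast
        then have "(L2_norm \<Omega> (s (r i) - s n))\<^sup>2 \<le> e\<^sup>2" by (intro power_mono) auto
        moreover have "(\<integral>\<^sup>+x. ennreal ((norm (s (r i) x - s n x))\<^sup>2) \<partial>lebesgue_on \<Omega>) = ennreal ((L2_norm \<Omega> (s (r i) - s n))\<^sup>2)"
          using L2_integrable_sq[OF L2_minus[OF s s, of "r i" n]]
          by (subst nn_integral_eq_integral) (auto simp: L2_norm_def)
        ultimately show ?case by (simp add: ennreal_leI)
      qed
    qed
    also have "\<dots> = ennreal (e\<^sup>2)" by (simp add: Liminf_const)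
    finally have le: "(\<integral>\<^sup>+x. ennreal ((norm (f x - s n x))\<^sup>2) \<partial>lebesgue_on \<Omega>) \<le> ennreal (e\<^sup>2)" .
    then have i: "integrable (lebesgue_on \<Omega>) (\<lambda>x. (norm (f x - s n x))\<^sup>2)"
      by (intro integrableI_bounded) (auto simp: le_less_trans ennreal_less_top)
    with le have "(LINT x|lebesgue_on \<Omega>. (norm (f x - s n x))\<^sup>2) \<le> e\<^sup>2"
      by (subst (asm) nn_integral_eq_integral) (auto simp: ennreal_le_iff)
    with i show ?thesis by (auto simp: L2_def L2_norm_def fun_diff_def)
  qed
  obtain n0 where "\<And>i j. i \<ge> n0 \<Longrightarrow> j \<ge> n0 \<Longrightarrow> L2_norm \<Omega> (s i - s j) < 1"
    using cauchy[of 1] by auto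
  then have "f - s n0 \<in> L2 \<Omega>" using key by blast
  then have "f - s n0 + s n0 \<in> L2 \<Omega>" using s by (rule L2_plus)
  then have f: "f \<in> L2 \<Omega>" by simp
  have "(\<lambda>n. L2_norm \<Omega> (s n - f)) \<longlonglongrightarrow> 0"
  proof (rule LIMSEQ_I)
    fix e :: real assume "0 < e"
    then obtain n0 where n0: "\<And>i j. i \<ge> n0 \<Longrightarrow> j \<ge> n0 \<Longrightarrow> L2_norm \<Omega> (s i - s j) < e / 2"
      using cauchy[of "e / 2"] by auto
    have "norm (L2_norm \<Omega> (s n - f) - 0) < e" if "n \<ge> n0" for n
    proof -
      have "(L2_norm \<Omega> (f - s n))\<^sup>2 \<le> (e/2)\<^sup>2" using key[OF that n0] by blast
      then have "L2_norm \<Omega> (f - s n) \<le> e / 2" using \<open>0 < e\<close> by (simp add: power2_le_iff_abs_le)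
      then show ?thesis using L2.norm_minus_commute[OF s f] \<open>0 < e\<close> by simp
    qed
    then show "\<exists>no. \<forall>n\<ge>no. norm (L2_norm \<Omega> (s n - f) - 0) < e" by blast
  qed
  with f show thesis by (rule that)
qed

section \<open>Bump functions and the fundamental lemma\<close>

text \<open>The powers of 1/s make the family closed under differentiation up to linear
  combinations.\<close>

definition flat_exp :: "nat \<Rightarrow> real \<Rightarrow> real" where
  "flat_exp n s = (if s > 0 then (1 / s) ^ n * exp (- 1 / s) else 0)"

text \<open>With x = 1/s this is the decay of x^n exp(-x) at infinity.\<close>

lemma flat_exp_tendsto_0: "(flat_exp n \<longlongrightarrow> 0) (at 0)"
proof -
  have "((\<lambda>s::real. (1 / s) ^ n / exp (1 / s)) \<longlongrightarrow> 0) (at_right 0)"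
    by (rule filterlim_compose[OF tendsto_power_div_exp_0]) (auto simp: filterlim_inverse_at_top_right divide_inverse)
  then have "(flat_exp n \<longlongrightarrow> 0) (at_right 0)"
    by (rule tendsto_cong[THEN iffD2, rotated])
       (auto simp: eventually_at_filter flat_exp_def exp_minus divide_inverse)
  moreover have "(flat_exp n \<longlongrightarrow> 0) (at_left 0)"
    by (rule tendsto_eventually) (auto simp: eventually_at_filter flat_exp_def)
  ultimately show ?thesis by (simp add: filterlim_split_at)
qed

lemma flat_exp_deriv:
  "(flat_exp n has_real_derivative (flat_exp (n + 2) s - n * flat_exp (n + 1) s)) (at s)"
proof -
  consider "s > 0" | "s < 0" | "s = 0" by linarith
  then show ?thesis
  proof cases
    case 1
    have "((\<lambda>s. (1 / s) ^ n * exp (- 1 / s)) has_real_derivative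
        (flat_exp (n + 2) s - n * flat_exp (n + 1) s)) (at s)"
      using 1
      apply (auto intro!: derivative_eq_intros simp: flat_exp_def)
      apply (cases n)
       apply (auto simp: field_simps power2_eq_square)
      done
    then show ?thesis
      by (rule has_field_derivative_transform_within_open[where S="{0<..}"])
         (use 1 in \<open>auto simp: flat_exp_def\<close>)
  next
    case 2
    have "((\<lambda>s. 0) has_real_derivative (flat_exp (n + 2) s - n * flat_exp (n + 1) s)) (at s)"
      using 2 by (simp add: flat_exp_def)
    then show ?thesis
      by (rule has_field_derivative_transform_within_open[where S="{..<0}"])
         (use 2 in \<open>auto simp: flat_exp_def\<close>)
  next
    case 3
    have "((\<lambda>h. flat_exp (n + 1) h) \<longlongrightarrow> 0) (at 0)" by (rule flat_exp_tendsto_0)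
    \<comment> \<open>Dividing by \<open>h\<close> raises the index by one, so the difference
      quotient at the origin is again a member of the family.\<close>
    then have "((\<lambda>h. flat_exp n h / h) \<longlongrightarrow> 0) (at 0)"
      by (rule tendsto_cong[THEN iffD1, rotated]) (auto simp: flat_exp_def eventually_at_filter)
    then show ?thesis using 3 by (simp add: DERIV_def flat_exp_def)
  qed
qed

section \<open>Closure properties of smooth functions\<close>

lemma Ck_imp_continuous: "Ck k \<phi> \<Longrightarrow> continuous_on UNIV \<phi>"
  by (cases k) (auto intro!: differentiable_imp_continuous_on simp: differentiable_on_def differentiable_at_withinI)

lemma Ck_SucD: "Ck (Suc k) \<phi> \<Longrightarrow> Ck k \<phi>"
proof (induction k arbitrary: \<phi>)
  case 0
  show ?case using Ck_imp_continuous[OF 0] by simp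
next
  case (Suc k)
  have "\<forall>x. \<phi> differentiable at x" using Suc.prems by simp
  moreover have "Ck k (\<lambda>x. frechet_derivative \<phi> (at x) b)" if "b \<in> Basis" for b
    using Suc.prems that by (intro Suc.IH) simp
  ultimately show ?case by simp
qed

lemma CkI:
  assumes "\<And>x. (\<phi> has_derivative D x) (at x)" "\<And>b. b \<in> Basis \<Longrightarrow> Ck k (\<lambda>x. D x b)"
  shows "Ck (Suc k) \<phi>"
proof -
  have "frechet_derivative \<phi> (at x) = D x" for x
    using frechet_derivative_at[OF assms(1)] by simp
  then show ?thesis using assms by (auto simp: differentiable_def)
qed

lemma Ck_has_derivative: "Ck (Suc k) \<phi> \<Longrightarrow> (\<phi> has_derivative frechet_derivative \<phi> (at x)) (at x)"
  by (simp add: frechet_derivative_works[symmetric])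

lemma Ck_const: "Ck k (\<lambda>x. c)"
proof (induction k arbitrary: c)
  case (Suc k)
  show ?case by (rule CkI[where D="\<lambda>x h. 0"]) (auto intro: Suc)
qed simp

lemma Ck_add: "Ck k f \<Longrightarrow> Ck k g \<Longrightarrow> Ck k (\<lambda>x. f x + g x)"
proof (induction k arbitrary: f g)
  case (Suc k)
  note f = Suc.prems(1) and g = Suc.prems(2)
  show ?case
  proof (rule CkI)
    show "((\<lambda>x. f x + g x) has_derivative
        (\<lambda>h. frechet_derivative f (at x) h + frechet_derivative g (at x) h)) (at x)" for x
      by (intro has_derivative_add Ck_has_derivative[OF f] Ck_has_derivative[OF g])
    show "Ck k (\<lambda>x. frechet_derivative f (at x) b + frechet_derivative g (at x) b)"
      if "b \<in> Basis" for b
      using f g that by (intro Suc.IH) auto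
  qed
qed (auto intro: continuous_intros)

lemma Ck_mult: "Ck k f \<Longrightarrow> Ck k g \<Longrightarrow> Ck k (\<lambda>x. f x * g x)"
proof (induction k arbitrary: f g)
  case (Suc k)
  note f = Suc.prems(1) and g = Suc.prems(2)
  show ?case
  proof (rule CkI)
    show "((\<lambda>x. f x * g x) has_derivative
        (\<lambda>h. f x * frechet_derivative g (at x) h + frechet_derivative f (at x) h * g x)) (at x)" for x
      by (intro has_derivative_mult Ck_has_derivative[OF f] Ck_has_derivative[OF g])
    show "Ck k (\<lambda>x. f x * frechet_derivative g (at x) b + frechet_derivative f (at x) b * g x)"
      if "b \<in> Basis" for b
      using f g that Ck_SucD[OF f] Ck_SucD[OF g] by (intro Ck_add Suc.IH) auto
  qed
qed (auto intro: continuous_intros)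

lemma Ck_prod: "finite I \<Longrightarrow> (\<And>i. i \<in> I \<Longrightarrow> Ck k (f i)) \<Longrightarrow> Ck k (\<lambda>x. \<Prod>i\<in>I. f i x)"
  by (induction I rule: finite_induct) (auto intro: Ck_const Ck_mult)

lemma smooth_add: "smooth f \<Longrightarrow> smooth g \<Longrightarrow> smooth (\<lambda>x. f x + g x)"
  and smooth_mult: "smooth f \<Longrightarrow> smooth g \<Longrightarrow> smooth (\<lambda>x. f x * g x)"
  and smooth_const: "smooth (\<lambda>x. c)"
  and smooth_prod: "finite I \<Longrightarrow> (\<And>i. i \<in> I \<Longrightarrow> smooth (h i)) \<Longrightarrow> smooth (\<lambda>x. \<Prod>i\<in>I. h i x)"
  by (auto simp: smooth_def intro: Ck_add Ck_mult Ck_const Ck_prod)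

lemma smooth_lincomb: "smooth f \<Longrightarrow> smooth g \<Longrightarrow> smooth (\<lambda>x. a * f x + b * g x)"
  by (intro smooth_add smooth_mult smooth_const)

lemma smooth_continuous: "smooth \<phi> \<Longrightarrow> continuous_on S \<phi>"
  using Ck_imp_continuous continuous_on_subset unfolding smooth_def by blast

lemma smooth_has_derivative: "smooth \<phi> \<Longrightarrow> (\<phi> has_derivative frechet_derivative \<phi> (at x)) (at x)"
  using Ck_has_derivative[of 0 \<phi> x] unfolding smooth_def by blast

lemma smooth_frechet_derivative:
  assumes "smooth \<phi>" "b \<in> Basis"
  shows "smooth (\<lambda>x. frechet_derivative \<phi> (at x) b)"
  unfolding smooth_def
proof
  fix k show "Ck k (\<lambda>x. frechet_derivative \<phi> (at x) b)"
    using assms(1)[unfolded smooth_def, rule_format, of "Suc k"] assms(2) by simp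
qed

text \<open>Induction on \<open>k\<close> with \<open>n\<close> arbitrary, because each derivative
  raises the index of \<open>flat_exp\<close>. Affine functions of one coordinate cover both kinds
  of factor in \<open>bump\<close>.\<close>

lemma Ck_flat_exp_affine: "Ck k (\<lambda>x. flat_exp n (c * (x \<bullet> i) + d))"
proof (induction k arbitrary: n)
  case 0
  have "continuous_on UNIV (flat_exp n)"
    using flat_exp_deriv by (intro DERIV_continuous_on) (auto intro: has_field_derivative_at_within)
  then have "continuous_on UNIV (\<lambda>x. flat_exp n (c * (x \<bullet> i) + d))"
    by (rule continuous_on_compose2) (auto intro!: continuous_intros)
  then show ?case by simp
next
  case (Suc k)
  let ?D = "\<lambda>x. flat_exp (n + 2) (c * (x \<bullet> i) + d) - n * flat_exp (n + 1) (c * (x \<bullet> i) + d)"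
  show ?case
  proof (rule CkI)
    fix x
    have "((\<lambda>x. c * (x \<bullet> i) + d) has_derivative (\<lambda>h. c * (h \<bullet> i))) (at x)"
      by (auto intro!: derivative_eq_intros)
    from diff_chain_at[OF this flat_exp_deriv[unfolded has_field_derivative_def]]
    show "((\<lambda>x. flat_exp n (c * (x \<bullet> i) + d)) has_derivative (\<lambda>h. ?D x * (c * (h \<bullet> i)))) (at x)"
      by (simp add: o_def)
    fix b :: 'a
    have "Ck k (\<lambda>x. flat_exp (n + 2) (c * (x \<bullet> i) + d) * (c * (b \<bullet> i)) +
        flat_exp (n + 1) (c * (x \<bullet> i) + d) * (- n * (c * (b \<bullet> i))))"
      by (intro Ck_add Ck_mult Suc Ck_const)
    then show "Ck k (\<lambda>x. ?D x * (c * (b \<bullet> i)))"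
      by (simp add: algebra_simps)
  qed
qed

text \<open>The parameter \<open>c\<close> is a steepness: exp(-1/(c s)) tends to 1 for s > 0 as
  \<open>c\<close> grows. One family thus serves as a positive cut-off on an open box and as an
  approximation of its indicator.\<close>

definition bump :: "'a::euclidean_space \<Rightarrow> 'a \<Rightarrow> real \<Rightarrow> 'a \<Rightarrow> real" where
  "bump a b c x = (\<Prod>i\<in>Basis. flat_exp 0 (c * (x \<bullet> i - a \<bullet> i)) * flat_exp 0 (c * (b \<bullet> i - x \<bullet> i)))"

lemma smooth_bump: "smooth (bump a b c)"
proof -
  have "Ck k (\<lambda>x. flat_exp 0 (c * (x \<bullet> i) + (- c * (a \<bullet> i))) * flat_exp 0 ((- c) * (x \<bullet> i) + (c * (b \<bullet> i))))" for k i
    by (intro Ck_mult Ck_flat_exp_affine)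
  then have "smooth (\<lambda>x. \<Prod>i\<in>Basis. flat_exp 0 (c * (x \<bullet> i) + (- c * (a \<bullet> i))) * flat_exp 0 ((- c) * (x \<bullet> i) + (c * (b \<bullet> i))))"
    by (intro smooth_prod) (auto simp: smooth_def)
  then show ?thesis by (simp add: bump_def[abs_def] algebra_simps)
qed

lemma flat_exp_eq_0_iff: "flat_exp n s = 0 \<longleftrightarrow> s \<le> 0"
  by (auto simp: flat_exp_def)

lemma flat_exp_0_bounds: "0 \<le> flat_exp 0 s" "flat_exp 0 s \<le> 1"
  by (auto simp: flat_exp_def)

lemma bump_bounds: "0 \<le> bump a b c x" "bump a b c x \<le> 1"
  unfolding bump_def by (auto intro!: prod_nonneg prod_le_1 mult_nonneg_nonneg mult_le_one flat_exp_0_bounds)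

lemma bump_pos_iff:
  assumes "c > 0"
  shows "0 < bump a b c x \<longleftrightarrow> x \<in> box a b"
proof
  assume "x \<in> box a b"
  then show "0 < bump a b c x"
    using assms unfolding bump_def
    by (auto intro!: prod_pos mult_pos_pos simp: flat_exp_def mem_box)
next
  assume "0 < bump a b c x"
  then have "bump a b c x \<noteq> 0" by simp
  then have "flat_exp 0 (c * (x \<bullet> i - a \<bullet> i)) * flat_exp 0 (c * (b \<bullet> i - x \<bullet> i)) \<noteq> 0" if "i \<in> Basis" for i
    unfolding bump_def using that by (auto simp: prod_zero_iff)
  then show "x \<in> box a b"
    using assms by (auto simp: flat_exp_eq_0_iff mem_box mult_le_0_iff not_le)
qed

lemma bump_eq_0: "c > 0 \<Longrightarrow> x \<notin> box a b \<Longrightarrow> bump a b c x = 0"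
  using bump_pos_iff[of c a b x] bump_bounds(1)[of a b c x] by linarith

lemma bump_tendsto_indicator:
  "(\<lambda>n. bump a b (real (Suc n)) x) \<longlonglongrightarrow> indicator (box a b) x"
proof (cases "x \<in> box a b")
  case True
  have "(\<lambda>n. flat_exp 0 (real (Suc n) * s)) \<longlonglongrightarrow> 1" if "s > 0" for s
  proof -
    have "(\<lambda>n. exp (- (1 / s) * (1 / real (Suc n)))) \<longlonglongrightarrow> exp (- (1 / s) * 0)"
      by (intro tendsto_exp tendsto_mult tendsto_const LIMSEQ_Suc[OF lim_1_over_n])
    moreover have "flat_exp 0 (real (Suc n) * s) = exp (- (1 / s) * (1 / real (Suc n)))" for n
      using that by (simp add: flat_exp_def mult.commute)
    ultimately show ?thesis by simp
  qed
  then have "(\<lambda>n. bump a b (real (Suc n)) x) \<longlonglongrightarrow> (\<Prod>i\<in>(Basis::'a set). 1 * 1)"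
    unfolding bump_def using True by (intro tendsto_prod tendsto_mult) (auto simp: mem_box)
  then show ?thesis using True by simp
next
  case False
  then show ?thesis by (simp add: bump_eq_0)
qed

lemma test_functions_subset_support:
  assumes "smooth \<phi>" "{x. \<phi> x \<noteq> 0} \<subseteq> K" "compact K" "K \<subseteq> S"
  shows "\<phi> \<in> test_functions S"
proof -
  have "closure {x. \<phi> x \<noteq> 0} \<subseteq> K"
    using assms by (simp add: closure_minimal compact_imp_closed)
  moreover from this have "compact (closure {x. \<phi> x \<noteq> 0})"
    using compact_Int_closed[OF assms(3) closed_closure, of "{x. \<phi> x \<noteq> 0}"] by (simp add: Int_absorb1)
  ultimately show ?thesis
    using assms by (auto simp: test_functions_def)
qed

lemma test_functions_bump:
  assumes "c > 0" "cbox a b \<subseteq> S" "smooth \<psi>"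
  shows "(\<lambda>x. bump a b c x * \<psi> x) \<in> test_functions S"
  using assms box_subset_cbox[of a b] bump_eq_0[of c _ a b]
  by (intro test_functions_subset_support[where K="cbox a b"] smooth_mult smooth_bump) (auto simp: subset_eq)

text \<open>Boxes are an intersection-stable generator of the Borel sets, so vanishing integrals
  spread by the pi-lambda argument to Borel sets and then to Lebesgue sets, where densities are
  unique.\<close>

lemma AE_eq_0_if_box_integrals_0:
  fixes h :: "'a::euclidean_space \<Rightarrow> real"
  assumes h: "integrable lebesgue h"
    and box: "\<And>a b. (LINT x|lebesgue. h x * indicator (box a b) x) = 0"
  shows "AE x in lebesgue. h x = 0"
proof -
  note [measurable] = borel_measurable_integrable[OF h]
  have [measurable]: "box a b \<in> sets lebesgue" for a b :: 'a by simp
  have si: "set_integrable lebesgue A h" if "A \<in> sets borel" for A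
    using h that unfolding set_integrable_def by (intro integrable_mult_indicator) auto
  have box': "(LINT x:box a b|lebesgue. h x) = 0" for a b
    using box[of a b] by (simp add: set_lebesgue_integral_def mult.commute)
  \<comment> \<open>Complements in the induction require the integral over the whole space, which
    growing boxes exhaust.\<close>
  have tot: "(LINT x|lebesgue. h x) = 0"
  proof (rule LIMSEQ_unique)
    let ?B = "\<lambda>n::nat. box (- real n *\<^sub>R One) (real n *\<^sub>R One) :: 'a set"
    show "(\<lambda>n. LINT x:?B n|lebesgue. h x) \<longlonglongrightarrow> (LINT x|lebesgue. h x)"
      unfolding set_lebesgue_integral_def
    proof (rule integral_dominated_convergence[where w="\<lambda>x. norm (h x)"])
      show "AE x in lebesgue. (\<lambda>n. indicat_real (?B n) x *\<^sub>R h x) \<longlonglongrightarrow> h x"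
      proof (rule AE_I2)
        fix x :: 'a
        obtain n :: nat where n: "norm x < n" using reals_Archimedean2 by blast
        have "\<forall>\<^sub>F k in sequentially. indicat_real (?B k) x *\<^sub>R h x = h x"
          using eventually_ge_at_top[of n]
        proof eventually_elim
          case (elim k)
          have "\<bar>x \<bullet> i\<bar> < real k" if "i \<in> Basis" for i
            using Basis_le_norm[OF that, of x] n elim by linarith
          then have "x \<in> ?B k" by (force simp: mem_box abs_less_iff)
          then show ?case by simp
        qed
        then show "(\<lambda>n. indicat_real (?B n) x *\<^sub>R h x) \<longlonglongrightarrow> h x" by (rule tendsto_eventually)
      qed
    qed (use h in \<open>auto simp: indicator_def\<close>)
    show "(\<lambda>n. LINT x:?B n|lebesgue. h x) \<longlonglongrightarrow> 0" by (simp add: box')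
  qed
  have borel: "(LINT x:A|lebesgue. h x) = 0" if A: "A \<in> sets borel" for A
  proof -
    have "Int_stable (range (\<lambda>(a, b). box a b :: 'a set))"
      by (auto simp: Int_stable_def box_Int_box)
    moreover have "(range (\<lambda>(a, b). box a b :: 'a set)) \<subseteq> Pow UNIV" by auto
    moreover have "A \<in> sigma_sets UNIV (range (\<lambda>(a, b). box a b))"
      using A unfolding borel_eq_box by simp
    ultimately show ?thesis
    proof (induction rule: sigma_sets_induct_disjoint)
      case (basic A) then show ?case by (auto simp: box')
    next
      case empty then show ?case by (simp add: set_lebesgue_integral_def)
    next
      case (compl A)
      then have A: "A \<in> sets borel" by (simp add: borel_eq_box)
      have "(LINT x:A \<union> (UNIV - A)|lebesgue. h x) = (LINT x:A|lebesgue. h x) + (LINT x:(UNIV - A)|lebesgue. h x)"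
        by (rule set_integral_Un) (use A in \<open>auto intro!: si\<close>)
      then show ?case using compl tot by (simp add: set_lebesgue_integral_def)
    next
      case (union F)
      then have F: "F i \<in> sets borel" for i by (auto simp: borel_eq_box)
      have "(LINT x:(\<Union>i. F i)|lebesgue. h x) = (\<Sum>i. (LINT x:F i|lebesgue. h x))"
        by (rule lebesgue_integral_countable_add)
           (use F union in \<open>auto simp: disjoint_family_on_def intro!: si\<close>)
      then show ?case using union by simp
    qed
  qed
  have "AE x in lebesgue. h x = (\<lambda>x. 0) x"
  proof (rule density_unique_real)
    fix A :: "'a set" assume [measurable]: "A \<in> sets lebesgue"
    \<comment> \<open>A Lebesgue set is a Borel set up to a null set and so has the same
      integral.\<close>
    obtain A' where A': "A' \<in> sets borel" and "AE x in lebesgue. x \<in> A \<longleftrightarrow> x \<in> A'"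
    proof -
      obtain S N N' where "A = S \<union> N" "N \<subseteq> N'" "N' \<in> null_sets lborel" "S \<in> sets lborel"
        using sets_completionE[OF \<open>A \<in> sets lebesgue\<close>] by metis
      then have "AE x in lebesgue. x \<notin> N'" by (intro AE_completion AE_not_in)
      then have "AE x in lebesgue. x \<in> A \<longleftrightarrow> x \<in> S"
        by eventually_elim (use \<open>A = S \<union> N\<close> \<open>N \<subseteq> N'\<close> in auto)
      then show thesis using that[of S] \<open>S \<in> sets lborel\<close> by simp
    qed
    moreover from A' have [measurable]: "A' \<in> sets lebesgue" by simp
    ultimately have "(LINT x:A|lebesgue. h x) = (LINT x:A'|lebesgue. h x)"
      using A' \<open>A \<in> _\<close>  unfolding set_lebesgue_integral_def
      by (intro integral_cong_AE) (auto simp: indicator_def elim: eventually_mono)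
    then show "(LINT x:A|lebesgue. h x) = (LINT x:A|lebesgue. (\<lambda>x. 0) x)" using borel[OF A'] by simp
  qed (use h in auto)
  then show ?thesis by simp
qed

text \<open>Multiplication by a fixed bump makes \<open>g\<close> integrable; a further factor of
  increasing steepness leaves a test function on \<Omega> and approximates the indicator of any box.
  Countably many closed boxes cover \<Omega>. Local integrability of \<open>g\<close> is stated
  through \<open>int\<close>, the form in which the applications supply it.\<close>

lemma fundamental_lemma:
  fixes g :: "'a::euclidean_space \<Rightarrow> real"
  assumes \<Omega>: "open \<Omega>"
    and int: "\<And>\<phi>. \<phi> \<in> test_functions \<Omega> \<Longrightarrow> integrable (lebesgue_on \<Omega>) (\<lambda>x. g x * \<phi> x)"
    and zero: "\<And>\<phi>. \<phi> \<in> test_functions \<Omega> \<Longrightarrow> (LINT x|lebesgue_on \<Omega>. g x * \<phi> x) = 0"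
  shows "AE x in lebesgue_on \<Omega>. g x = 0"
proof -
  have \<Omega>': "\<Omega> \<inter> space lebesgue \<in> sets lebesgue" using \<Omega> by simp
  have local: "AE x in lebesgue. x \<in> cbox a b \<longrightarrow> g x = 0" if ab: "cbox a b \<subseteq> \<Omega>" for a b
  proof -
    define h where "h x = indicator \<Omega> x * (g x * bump a b 1 x)" for x
    have t: "(\<lambda>x. bump a b 1 x * \<psi> x) \<in> test_functions \<Omega>" if "smooth \<psi>" for \<psi>
      using ab that by (intro test_functions_bump) auto
    have "integrable (lebesgue_on \<Omega>) (\<lambda>x. g x * (bump a b 1 x * 1))"
      by (rule int[OF t[OF smooth_const]])
    then have h: "integrable lebesgue h"
      using integrable_restrict_space[OF \<Omega>', of "\<lambda>x. g x * bump a b 1 x"] by (simp add: h_def[abs_def])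
    have hb: "(LINT x|lebesgue. h x * bump c d (real (Suc n)) x) = 0" for c d n
    proof -
      have "(LINT x|lebesgue_on \<Omega>. g x * (bump a b 1 x * bump c d (real (Suc n)) x)) = 0"
        by (rule zero[OF t[OF smooth_bump]])
      then show ?thesis
        by (subst (asm) integral_restrict_space[OF \<Omega>']) (simp add: h_def mult.assoc)
    qed
    have "AE x in lebesgue. h x = 0"
    proof (rule AE_eq_0_if_box_integrals_0[OF h])
      fix c d :: 'a
      note [measurable] = borel_measurable_integrable[OF h]
      have [measurable]: "box c d \<in> sets lebesgue" by simp
      have "(\<lambda>n. LINT x|lebesgue. h x * bump c d (real (Suc n)) x) \<longlonglongrightarrow> (LINT x|lebesgue. h x * indicator (box c d) x)"
      proof (rule integral_dominated_convergence[where w="\<lambda>x. norm (h x)"])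
        show "(\<lambda>x. h x * bump c d (real (Suc n)) x) \<in> borel_measurable lebesgue" for n
        proof -
          have "bump c d (real (Suc n)) \<in> borel_measurable borel"
            by (rule borel_measurable_continuous_onI[OF smooth_continuous[OF smooth_bump]])
          then have "bump c d (real (Suc n)) \<in> borel_measurable lebesgue"
            by (simp add: measurable_completion)
          then show ?thesis using h by auto
        qed
        show "AE x in lebesgue. (\<lambda>n. h x * bump c d (real (Suc n)) x) \<longlonglongrightarrow> h x * indicat_real (box c d) x"
          by (intro AE_I2 tendsto_intros bump_tendsto_indicator)
        show "AE x in lebesgue. norm (h x * bump c d (real (Suc n)) x) \<le> norm (h x)" for n
          using bump_bounds[of c d "real (Suc n)"] by (intro AE_I2) (simp add: abs_mult mult_left_le)
      qed (use h in auto)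
      then show "(LINT x|lebesgue. h x * indicator (box c d) x) = 0"
        unfolding hb by (simp add: LIMSEQ_const_iff)
    qed
    \<comment> \<open>The bump vanishes on the boundary of the box and says nothing about
      \<open>g\<close> there; that boundary is a null set.\<close>
    moreover have "AE x in lebesgue. x \<notin> cbox a b - box a b"
      by (rule AE_not_in) (metis negligible_frontier_interval negligible_iff_null_sets)
    ultimately show ?thesis
    proof eventually_elim
      case (elim x)
      show ?case
      proof
        assume "x \<in> cbox a b"
        with elim have "x \<in> box a b" by auto
        then have "bump a b 1 x > 0" by (simp add: bump_pos_iff)
        then show "g x = 0" using elim \<open>x \<in> cbox a b\<close> ab by (auto simp: h_def)
      qed
    qed
  qed
  obtain \<D> where \<D>: "countable \<D>" "\<D> \<subseteq> Pow \<Omega>" "\<And>X. X \<in> \<D> \<Longrightarrow> \<exists>a b. X = cbox a b" "\<Union>\<D> = \<Omega>"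
    using open_countable_Union_open_cbox[OF \<Omega>] by metis
  have "AE x in lebesgue. \<forall>X\<in>\<D>. x \<in> X \<longrightarrow> g x = 0"
  proof (subst AE_ball_countable[OF \<D>(1)], intro ballI)
    fix X assume "X \<in> \<D>"
    moreover from this obtain a b where "X = cbox a b" using \<D>(3) by blast
    ultimately show "AE x in lebesgue. x \<in> X \<longrightarrow> g x = 0" using \<D>(2) local by blast
  qed
  then have "AE x in lebesgue. x \<in> \<Omega> \<longrightarrow> g x = 0"
    by eventually_elim (use \<D> in auto)
  then show ?thesis using \<Omega> by (simp add: AE_restrict_space_iff)
qed

section \<open>The energy space and its dual\<close>

lemma L2_norm_lincomb_le:
  assumes "f \<in> L2 \<Omega>" "g \<in> L2 \<Omega>"
  shows "L2_norm \<Omega> (\<lambda>x. a *\<^sub>R f x + b *\<^sub>R g x) \<le> \<bar>a\<bar> * L2_norm \<Omega> f + \<bar>b\<bar> * L2_norm \<Omega> g"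
proof -
  have "(\<lambda>x. a *\<^sub>R f x) \<in> L2 \<Omega>" "(\<lambda>x. b *\<^sub>R g x) \<in> L2 \<Omega>"
    using L2_lincomb[OF assms, of a 0] L2_lincomb[OF assms, of 0 b] by simp_all
  from L2.norm_plus_le[OF this] show ?thesis by (simp add: plus_fun_def L2_norm_scale)
qed

text \<open>Collects the properties common to the spatial domain and the time interval
  \<open>{0<..<T}\<close>; the locale is interpreted for both.\<close>

locale bounded_open_set =
  fixes \<Omega> :: "'a::euclidean_space set"
  assumes open_domain: "open \<Omega>" and bounded_domain: "bounded \<Omega>"
begin

lemma lmeasurable_domain: "\<Omega> \<in> lmeasurable"
  using open_domain bounded_domain by (simp add: lmeasurable_open)

lemma continuous_imp_L2:
  fixes \<phi> :: "'a \<Rightarrow> 'b::euclidean_space"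
  assumes "continuous_on UNIV \<phi>"
  shows "\<phi> \<in> L2 \<Omega>"
proof -
  have "\<phi> \<in> borel_measurable borel" using assms by (rule borel_measurable_continuous_onI)
  then have [measurable]: "\<phi> \<in> borel_measurable (lebesgue_on \<Omega>)"
    by (intro measurable_restrict_space1) (simp add: measurable_completion)
  have "compact (\<phi> ` closure \<Omega>)"
    using assms bounded_domain
    by (intro compact_continuous_image) (auto intro: continuous_on_subset)
  then obtain B where B: "\<And>x. x \<in> closure \<Omega> \<Longrightarrow> norm (\<phi> x) \<le> B"
    by (metis compact_imp_bounded bounded_iff image_eqI)
  have "integrable (lebesgue_on \<Omega>) (\<lambda>x. (norm (\<phi> x))\<^sup>2)"
  proof (rule finite_measure.integrable_const_bound[where B="B\<^sup>2"])
    show "finite_measure (lebesgue_on \<Omega>)"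
      using lmeasurable_domain by (rule finite_measure_lebesgue_on)
    show "AE x in lebesgue_on \<Omega>. norm ((norm (\<phi> x))\<^sup>2) \<le> B\<^sup>2"
      using B closure_subset[of \<Omega>] by (intro AE_I2) (auto intro!: power_mono)
  qed measurable
  then show ?thesis by (simp add: L2_def)
qed

lemma smooth_imp_L2: "smooth \<phi> \<Longrightarrow> \<phi> \<in> L2 \<Omega>"
  by (intro continuous_imp_L2 smooth_continuous)

lemma test_functions_smooth: "\<phi> \<in> test_functions S \<Longrightarrow> smooth \<phi>"
  by (simp add: test_functions_def)

section \<open>Weak gradients and traces\<close>

lemma grad_L2: "v \<in> W12 \<Omega> \<Longrightarrow> grad \<Omega> v \<in> L2 \<Omega>"
  and grad_is_weak_grad: "v \<in> W12 \<Omega> \<Longrightarrow> is_weak_grad \<Omega> v (grad \<Omega> v)"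
  unfolding W12_def grad_def
  using someI_ex[of "\<lambda>G. G \<in> L2 \<Omega> \<and> is_weak_grad \<Omega> v G"] by auto

lemma is_weak_grad_lincomb:
  assumes "v \<in> L2 \<Omega>" "w \<in> L2 \<Omega>" "G \<in> L2 \<Omega>" "K \<in> L2 \<Omega>"
    and "is_weak_grad \<Omega> v G" "is_weak_grad \<Omega> w K"
  shows "is_weak_grad \<Omega> (\<lambda>x. a * v x + b * w x) (\<lambda>x. a *\<^sub>R G x + b *\<^sub>R K x)"
  unfolding is_weak_grad_def
proof (intro ballI)
  fix \<phi> and i :: 'a assume \<phi>: "\<phi> \<in> test_functions \<Omega>" and i: "i \<in> Basis"
  have d: "(\<lambda>x. frechet_derivative \<phi> (at x) i) \<in> L2 \<Omega>"
    using \<phi> i by (intro smooth_imp_L2 smooth_frechet_derivative test_functions_smooth)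
  \<comment> \<open>With this vector field the component of the gradient along \<open>i\<close>
    enters through an L2 inner product, so bilinearity applies.\<close>
  have p: "(\<lambda>x. \<phi> x *\<^sub>R i) \<in> L2 \<Omega>"
    using \<phi> by (intro continuous_imp_L2 continuous_intros smooth_continuous test_functions_smooth)
  have vd: "L2_inner \<Omega> u (\<lambda>x. frechet_derivative \<phi> (at x) i) = - L2_inner \<Omega> M (\<lambda>x. \<phi> x *\<^sub>R i)"
    if "is_weak_grad \<Omega> u M" for u M
    using that \<phi> i unfolding is_weak_grad_def L2_inner_def
    by (simp add: mult.commute)
  have "L2_inner \<Omega> (\<lambda>x. a *\<^sub>R v x + b *\<^sub>R w x) (\<lambda>x. frechet_derivative \<phi> (at x) i) =
      - L2_inner \<Omega> (\<lambda>x. a *\<^sub>R G x + b *\<^sub>R K x) (\<lambda>x. \<phi> x *\<^sub>R i)"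
    using assms d p by (simp add: L2_inner_lincomb_left vd del: real_scaleR_def)
  then show "(LINT x|lebesgue_on \<Omega>. (a * v x + b * w x) * frechet_derivative \<phi> (at x) i) =
      - (LINT x|lebesgue_on \<Omega>. ((a *\<^sub>R G x + b *\<^sub>R K x) \<bullet> i) * \<phi> x)"
    by (simp add: L2_inner_def mult.commute)
qed

text \<open>All test functions annihilate the components of the difference. Since
  \<open>grad\<close> is a choice, this is the source of its algebraic rules, which hold almost
  everywhere.\<close>

lemma is_weak_grad_unique:
  assumes G: "G \<in> L2 \<Omega>" "is_weak_grad \<Omega> v G" and K: "K \<in> L2 \<Omega>" "is_weak_grad \<Omega> v K"
  shows "AE x in lebesgue_on \<Omega>. G x = K x"
proof -
  have "AE x in lebesgue_on \<Omega>. (G x - K x) \<bullet> i = 0" if i: "i \<in> Basis" for i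
  proof (rule fundamental_lemma[OF open_domain])
    fix \<phi> assume \<phi>: "\<phi> \<in> test_functions \<Omega>"
    have p: "(\<lambda>x. \<phi> x *\<^sub>R i) \<in> L2 \<Omega>"
      using \<phi> by (intro continuous_imp_L2 continuous_intros smooth_continuous test_functions_smooth)
    have e: "((G x - K x) \<bullet> i) * \<phi> x = (G - K) x \<bullet> (\<phi> x *\<^sub>R i)" for x by simp
    show "integrable (lebesgue_on \<Omega>) (\<lambda>x. ((G x - K x) \<bullet> i) * \<phi> x)"
      unfolding e by (intro L2_integrable_inner L2_minus G K p)
    have "(LINT x|lebesgue_on \<Omega>. ((G x - K x) \<bullet> i) * \<phi> x) = L2_inner \<Omega> (G - K) (\<lambda>x. \<phi> x *\<^sub>R i)"
      unfolding e L2_inner_def ..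
    also have "\<dots> = L2_inner \<Omega> G (\<lambda>x. \<phi> x *\<^sub>R i) - L2_inner \<Omega> K (\<lambda>x. \<phi> x *\<^sub>R i)"
      by (rule L2_inner_diff_left[OF G(1) K(1) p])
    also have "L2_inner \<Omega> G (\<lambda>x. \<phi> x *\<^sub>R i) = L2_inner \<Omega> K (\<lambda>x. \<phi> x *\<^sub>R i)"
    proof -
      have "(LINT x|lebesgue_on \<Omega>. (G x \<bullet> i) * \<phi> x) = (LINT x|lebesgue_on \<Omega>. (K x \<bullet> i) * \<phi> x)"
        using G(2)[unfolded is_weak_grad_def, rule_format, OF \<phi> i]
          K(2)[unfolded is_weak_grad_def, rule_format, OF \<phi> i] by linarith
      then show ?thesis by (simp add: L2_inner_def mult.commute)
    qed
    finally show "(LINT x|lebesgue_on \<Omega>. ((G x - K x) \<bullet> i) * \<phi> x) = 0" by simp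
  qed
  then have "AE x in lebesgue_on \<Omega>. \<forall>i\<in>Basis. (G x - K x) \<bullet> i = 0"
    by (intro AE_finite_allI) auto
  then show ?thesis
    by eventually_elim (metis euclidean_all_zero_iff right_minus_eq)
qed

lemma W12_lincomb:
  assumes v: "v \<in> W12 \<Omega>" and w: "w \<in> W12 \<Omega>"
  shows "(\<lambda>x. a * v x + b * w x) \<in> W12 \<Omega>"
    and "AE x in lebesgue_on \<Omega>. grad \<Omega> (\<lambda>x. a * v x + b * w x) x = a *\<^sub>R grad \<Omega> v x + b *\<^sub>R grad \<Omega> w x"
proof -
  have L: "v \<in> L2 \<Omega>" "w \<in> L2 \<Omega>" using v w by (auto simp: W12_def)
  have wg: "is_weak_grad \<Omega> (\<lambda>x. a * v x + b * w x) (\<lambda>x. a *\<^sub>R grad \<Omega> v x + b *\<^sub>R grad \<Omega> w x)"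
    by (intro is_weak_grad_lincomb L grad_L2 grad_is_weak_grad v w)
  have gl: "(\<lambda>x. a *\<^sub>R grad \<Omega> v x + b *\<^sub>R grad \<Omega> w x) \<in> L2 \<Omega>"
    by (intro L2_lincomb grad_L2 v w)
  show W: "(\<lambda>x. a * v x + b * w x) \<in> W12 \<Omega>"
    using wg gl L2_lincomb[OF L, of a b] by (auto simp: W12_def)
  show "AE x in lebesgue_on \<Omega>. grad \<Omega> (\<lambda>x. a * v x + b * w x) x = a *\<^sub>R grad \<Omega> v x + b *\<^sub>R grad \<Omega> w x"
    by (rule is_weak_grad_unique[OF grad_L2[OF W] grad_is_weak_grad[OF W] gl wg])
qed

lemma W12_zero: "0 \<in> W12 \<Omega>" and grad_zero: "AE x in lebesgue_on \<Omega>. grad \<Omega> 0 x = 0"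
proof -
  have z: "is_weak_grad \<Omega> 0 0" by (simp add: is_weak_grad_def zero_fun_def)
  show W: "0 \<in> W12 \<Omega>" using z L2_zero by (auto simp: W12_def)
  show "AE x in lebesgue_on \<Omega>. grad \<Omega> 0 x = 0"
    using is_weak_grad_unique[OF grad_L2[OF W] grad_is_weak_grad[OF W] L2_zero z] by simp
qed

lemma classical_grad_continuous: "smooth \<phi> \<Longrightarrow> continuous_on UNIV (classical_grad \<phi>)"
  unfolding classical_grad_def
  by (rule continuous_on_sum, rule continuous_on_scaleR)
     (auto intro: smooth_continuous smooth_frechet_derivative continuous_on_const)

lemma classical_grad_lincomb:
  assumes "smooth \<phi>" "smooth \<psi>"
  shows "classical_grad (\<lambda>x. a * \<phi> x + b * \<psi> x) = (\<lambda>x. a *\<^sub>R classical_grad \<phi> x + b *\<^sub>R classical_grad \<psi> x)"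
proof
  fix x
  have "((\<lambda>x. a * \<phi> x + b * \<psi> x) has_derivative
      (\<lambda>h. a * frechet_derivative \<phi> (at x) h + b * frechet_derivative \<psi> (at x) h)) (at x)"
    by (intro has_derivative_add has_derivative_mult_right smooth_has_derivative assms)
  from frechet_derivative_at[OF this, symmetric]
  show "classical_grad (\<lambda>x. a * \<phi> x + b * \<psi> x) x = a *\<^sub>R classical_grad \<phi> x + b *\<^sub>R classical_grad \<psi> x"
    by (simp add: classical_grad_def scaleR_sum_right scaleR_add_left sum.distrib)
qed

text \<open>Only the sigma-algebra matters, and \<open>measure_of\<close> takes it from the Borel
  sets whatever the set function.\<close>

lemma smooth_measurable_surface_measure:
  assumes "smooth \<phi>"
  shows "\<phi> \<in> borel_measurable (surface_measure \<Omega>)"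
proof -
  have "sets (hausdorff_measure (DIM('a) - 1) :: 'a measure) = sets borel"
    unfolding hausdorff_measure_def using sets.sigma_sets_eq[of "borel :: 'a measure"]
    by (subst sets_measure_of) auto
  then have "\<phi> \<in> borel_measurable (hausdorff_measure (DIM('a) - 1))"
    using borel_measurable_continuous_onI[OF smooth_continuous[OF assms]]
    by (simp cong: measurable_cong_sets)
  then show ?thesis unfolding surface_measure_def by (rule measurable_restrict_space1)
qed

text \<open>Combinations of the two approximating sequences approximate the combination. The surface
  integrals stay in \<open>ennreal\<close>, where no integrability has to be tracked.\<close>

lemma has_trace_lincomb:
  assumes v: "v \<in> W12 \<Omega>" and w: "w \<in> W12 \<Omega>"
    and tv: "has_trace \<Omega> v \<tau>" and tw: "has_trace \<Omega> w \<sigma>"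
  shows "has_trace \<Omega> (\<lambda>x. a * v x + b * w x) (\<lambda>x. a * \<tau> x + b * \<sigma> x)"
proof -
  let ?S = "surface_measure \<Omega>"
  have [measurable]: "\<tau> \<in> borel_measurable ?S" "\<sigma> \<in> borel_measurable ?S"
    using tv tw by (auto simp: has_trace_def)
  have L: "v \<in> L2 \<Omega>" "w \<in> L2 \<Omega>" using v w by (auto simp: W12_def)
  obtain \<phi> where \<phi>: "\<And>n. smooth (\<phi> n)" "(\<lambda>n. L2_norm \<Omega> (\<phi> n - v)) \<longlonglongrightarrow> 0"
    "(\<lambda>n. L2_norm \<Omega> (classical_grad (\<phi> n) - grad \<Omega> v)) \<longlonglongrightarrow> 0"
    "(\<lambda>n. \<integral>\<^sup>+x. ennreal ((\<phi> n x - \<tau> x)\<^sup>2) \<partial>?S) \<longlonglongrightarrow> 0"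
    using tv unfolding has_trace_def by blast
  obtain \<psi> where \<psi>: "\<And>n. smooth (\<psi> n)" "(\<lambda>n. L2_norm \<Omega> (\<psi> n - w)) \<longlonglongrightarrow> 0"
    "(\<lambda>n. L2_norm \<Omega> (classical_grad (\<psi> n) - grad \<Omega> w)) \<longlonglongrightarrow> 0"
    "(\<lambda>n. \<integral>\<^sup>+x. ennreal ((\<psi> n x - \<sigma> x)\<^sup>2) \<partial>?S) \<longlonglongrightarrow> 0"
    using tw unfolding has_trace_def by blast
  note s = \<phi>(1) \<psi>(1) and l = \<phi>(2) \<psi>(2) and g = \<phi>(3) \<psi>(3) and t = \<phi>(4) \<psi>(4)
  have [measurable]: "\<phi> n \<in> borel_measurable ?S" "\<psi> n \<in> borel_measurable ?S" for n
    by (intro smooth_measurable_surface_measure s)+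
  have quad: "(\<integral>\<^sup>+x. ennreal ((a * p x + b * q x)\<^sup>2) \<partial>?S) \<le>
      ennreal (2 * a\<^sup>2) * (\<integral>\<^sup>+x. ennreal ((p x)\<^sup>2) \<partial>?S) + ennreal (2 * b\<^sup>2) * (\<integral>\<^sup>+x. ennreal ((q x)\<^sup>2) \<partial>?S)"
    if [measurable]: "p \<in> borel_measurable ?S" "q \<in> borel_measurable ?S" for p q
  proof -
    have "(\<integral>\<^sup>+x. ennreal ((a * p x + b * q x)\<^sup>2) \<partial>?S) \<le>
      (\<integral>\<^sup>+x. ennreal (2 * a\<^sup>2) * ennreal ((p x)\<^sup>2) + ennreal (2 * b\<^sup>2) * ennreal ((q x)\<^sup>2) \<partial>?S)"
      using norm_sq_lincomb_le[of a "p _" b "q _"]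
      by (intro nn_integral_mono) (simp add: ennreal_mult[symmetric] ennreal_plus[symmetric] del: ennreal_plus)
    also have "\<dots> = ennreal (2 * a\<^sup>2) * (\<integral>\<^sup>+x. ennreal ((p x)\<^sup>2) \<partial>?S) + ennreal (2 * b\<^sup>2) * (\<integral>\<^sup>+x. ennreal ((q x)\<^sup>2) \<partial>?S)"
      by (simp add: nn_integral_add nn_integral_cmult)
    finally show ?thesis .
  qed
  show ?thesis
    unfolding has_trace_def
  proof (intro conjI exI[of _ "\<lambda>n x. a * \<phi> n x + b * \<psi> n x"] allI)
    show "(\<lambda>x. a * \<tau> x + b * \<sigma> x) \<in> borel_measurable ?S" by measurable
    have "(\<integral>\<^sup>+x. ennreal ((\<tau> x)\<^sup>2) \<partial>?S) < top" "(\<integral>\<^sup>+x. ennreal ((\<sigma> x)\<^sup>2) \<partial>?S) < top"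
      using tv tw by (auto simp: has_trace_def)
    then have "ennreal (2 * a\<^sup>2) * (\<integral>\<^sup>+x. ennreal ((\<tau> x)\<^sup>2) \<partial>?S) + ennreal (2 * b\<^sup>2) * (\<integral>\<^sup>+x. ennreal ((\<sigma> x)\<^sup>2) \<partial>?S) < top"
      by (simp add: ennreal_mult_less_top)
    with quad[of \<tau> \<sigma>] show "(\<integral>\<^sup>+x. ennreal ((a * \<tau> x + b * \<sigma> x)\<^sup>2) \<partial>?S) < \<infinity>"
      by (simp add: le_less_trans)
    show "smooth (\<lambda>x. a * \<phi> n x + b * \<psi> n x)" for n by (intro smooth_lincomb s)
    have e: "(\<lambda>x. a * \<phi> n x + b * \<psi> n x) - (\<lambda>x. a * v x + b * w x) =
        (\<lambda>x. a *\<^sub>R (\<phi> n - v) x + b *\<^sub>R (\<psi> n - w) x)" for n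
      by (auto simp: algebra_simps)
    show "(\<lambda>n. L2_norm \<Omega> ((\<lambda>x. a * \<phi> n x + b * \<psi> n x) - (\<lambda>x. a * v x + b * w x))) \<longlonglongrightarrow> 0"
    proof (rule Lim_null_comparison)
      show "\<forall>\<^sub>F n in sequentially. norm (L2_norm \<Omega> ((\<lambda>x. a * \<phi> n x + b * \<psi> n x) - (\<lambda>x. a * v x + b * w x)))
        \<le> \<bar>a\<bar> * L2_norm \<Omega> (\<phi> n - v) + \<bar>b\<bar> * L2_norm \<Omega> (\<psi> n - w)"
        unfolding e using L2_norm_lincomb_le[OF L2_minus[OF smooth_imp_L2[OF s(1)] L(1)] L2_minus[OF smooth_imp_L2[OF s(2)] L(2)]]
        by (intro always_eventually allI) simp
      show "(\<lambda>n. \<bar>a\<bar> * L2_norm \<Omega> (\<phi> n - v) + \<bar>b\<bar> * L2_norm \<Omega> (\<psi> n - w)) \<longlonglongrightarrow> 0"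
        using tendsto_add[OF tendsto_mult_right_zero[OF l(1), of "\<bar>a\<bar>"] tendsto_mult_right_zero[OF l(2), of "\<bar>b\<bar>"]] by simp
    qed
    show "(\<lambda>n. L2_norm \<Omega> (classical_grad (\<lambda>x. a * \<phi> n x + b * \<psi> n x) - grad \<Omega> (\<lambda>x. a * v x + b * w x))) \<longlonglongrightarrow> 0"
    proof (rule Lim_null_comparison)
      have cg: "classical_grad (\<phi> n) - grad \<Omega> v \<in> L2 \<Omega>" "classical_grad (\<psi> n) - grad \<Omega> w \<in> L2 \<Omega>" for n
        by (intro L2_minus continuous_imp_L2 classical_grad_continuous s grad_L2 v w)+
      have "L2_norm \<Omega> (classical_grad (\<lambda>x. a * \<phi> n x + b * \<psi> n x) - grad \<Omega> (\<lambda>x. a * v x + b * w x)) =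
         L2_norm \<Omega> (\<lambda>x. a *\<^sub>R (classical_grad (\<phi> n) - grad \<Omega> v) x + b *\<^sub>R (classical_grad (\<psi> n) - grad \<Omega> w) x)" for n
      proof (rule L2_norm_cong)
        show "AE x in lebesgue_on \<Omega>. (classical_grad (\<lambda>x. a * \<phi> n x + b * \<psi> n x) - grad \<Omega> (\<lambda>x. a * v x + b * w x)) x =
           a *\<^sub>R (classical_grad (\<phi> n) - grad \<Omega> v) x + b *\<^sub>R (classical_grad (\<psi> n) - grad \<Omega> w) x"
          using W12_lincomb(2)[OF v w, of a b]
          by eventually_elim (simp add: classical_grad_lincomb s algebra_simps)
        show "classical_grad (\<lambda>x. a * \<phi> n x + b * \<psi> n x) - grad \<Omega> (\<lambda>x. a * v x + b * w x) \<in> L2 \<Omega>"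
          by (intro L2_minus continuous_imp_L2 classical_grad_continuous smooth_lincomb s grad_L2 W12_lincomb(1) v w)
      qed (rule L2_lincomb[OF cg])
      then show "\<forall>\<^sub>F n in sequentially. norm (L2_norm \<Omega> (classical_grad (\<lambda>x. a * \<phi> n x + b * \<psi> n x) - grad \<Omega> (\<lambda>x. a * v x + b * w x)))
        \<le> \<bar>a\<bar> * L2_norm \<Omega> (classical_grad (\<phi> n) - grad \<Omega> v) + \<bar>b\<bar> * L2_norm \<Omega> (classical_grad (\<psi> n) - grad \<Omega> w)"
        using L2_norm_lincomb_le[OF cg, of a _ b] by (intro always_eventually allI) simp
      show "(\<lambda>n. \<bar>a\<bar> * L2_norm \<Omega> (classical_grad (\<phi> n) - grad \<Omega> v) + \<bar>b\<bar> * L2_norm \<Omega> (classical_grad (\<psi> n) - grad \<Omega> w)) \<longlonglongrightarrow> 0"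
        using tendsto_add[OF tendsto_mult_right_zero[OF g(1), of "\<bar>a\<bar>"] tendsto_mult_right_zero[OF g(2), of "\<bar>b\<bar>"]] by simp
    qed
    show "(\<lambda>n. \<integral>\<^sup>+x. ennreal ((a * \<phi> n x + b * \<psi> n x - (a * \<tau> x + b * \<sigma> x))\<^sup>2) \<partial>?S) \<longlonglongrightarrow> 0"
    proof (rule tendsto_sandwich[OF _ _ tendsto_const])
      let ?U = "\<lambda>n. ennreal (2 * a\<^sup>2) * (\<integral>\<^sup>+x. ennreal ((\<phi> n x - \<tau> x)\<^sup>2) \<partial>?S) + ennreal (2 * b\<^sup>2) * (\<integral>\<^sup>+x. ennreal ((\<psi> n x - \<sigma> x)\<^sup>2) \<partial>?S)"
      have e: "a * \<phi> n x + b * \<psi> n x - (a * \<tau> x + b * \<sigma> x) = a * (\<phi> n x - \<tau> x) + b * (\<psi> n x - \<sigma> x)" for n x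
        by (simp add: algebra_simps)
      show "\<forall>\<^sub>F n in sequentially. (\<integral>\<^sup>+x. ennreal ((a * \<phi> n x + b * \<psi> n x - (a * \<tau> x + b * \<sigma> x))\<^sup>2) \<partial>?S) \<le> ?U n"
        unfolding e by (intro always_eventually allI quad) measurable
      have "?U \<longlonglongrightarrow> ennreal (2 * a\<^sup>2) * 0 + ennreal (2 * b\<^sup>2) * 0"
        by (intro tendsto_add ennreal_tendsto_cmult t) auto
      then show "?U \<longlonglongrightarrow> 0" by simp
    qed simp
  qed
qed

section \<open>The space V with the gradient seminorm, and its dual\<close>

lemma V_space_imp_W12: "v \<in> V_space \<Omega> \<Gamma> \<Longrightarrow> v \<in> W12 \<Omega>"
  by (simp add: V_space_def)

lemma V_space_imp_L2: "v \<in> V_space \<Omega> \<Gamma> \<Longrightarrow> v \<in> L2 \<Omega>"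
  by (simp add: V_space_def W12_def)

lemma V_space_lincomb:
  assumes "v \<in> V_space \<Omega> \<Gamma>" "w \<in> V_space \<Omega> \<Gamma>"
  shows "(\<lambda>x. a * v x + b * w x) \<in> V_space \<Omega> \<Gamma>"
proof -
  obtain \<tau> \<sigma> where t: "has_trace \<Omega> v \<tau>" "has_trace \<Omega> w \<sigma>"
    and "AE x in surface_measure \<Omega>. x \<in> \<Gamma> \<longrightarrow> \<tau> x = 0" "AE x in surface_measure \<Omega>. x \<in> \<Gamma> \<longrightarrow> \<sigma> x = 0"
    using assms unfolding V_space_def by blast
  from this(3,4) have "AE x in surface_measure \<Omega>. x \<in> \<Gamma> \<longrightarrow> a * \<tau> x + b * \<sigma> x = 0"
    by eventually_elim simp
  moreover have "has_trace \<Omega> (\<lambda>x. a * v x + b * w x) (\<lambda>x. a * \<tau> x + b * \<sigma> x)"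
    using assms t by (intro has_trace_lincomb) (auto simp: V_space_def)
  ultimately show ?thesis
    using assms W12_lincomb(1)[of v w a b] unfolding V_space_def by blast
qed

lemma V_norm_zero: "V_norm \<Omega> 0 = 0"
  unfolding V_norm_def using L2_norm_eq_0_iff[OF grad_L2[OF W12_zero]] grad_zero by simp

lemma V_space_zero: "0 \<in> V_space \<Omega> \<Gamma>"
proof -
  have s: "smooth (0::'a \<Rightarrow> real)" using smooth_const[of 0] by (simp add: zero_fun_def)
  have "classical_grad (0::'a \<Rightarrow> real) = 0"
    using classical_grad_lincomb[OF s s, of 0 0] by (simp add: zero_fun_def)
  \<comment> \<open>\<open>grad \<Omega> 0\<close> is a chosen representative that vanishes only
    almost everywhere, so its norm has to be used instead of its value.\<close>
  then have "L2_norm \<Omega> (classical_grad 0 - grad \<Omega> 0) = 0"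
    using L2.norm_uminus[OF grad_L2[OF W12_zero]] V_norm_zero by (simp add: V_norm_def)
  then have "has_trace \<Omega> 0 0"
    unfolding has_trace_def using s
    by (intro conjI exI[of _ "\<lambda>n. 0"]) (simp_all add: zero_fun_def L2_norm_def)
  then show ?thesis using W12_zero unfolding V_space_def by auto
qed

lemma grad_minus:
  assumes "v \<in> W12 \<Omega>" "w \<in> W12 \<Omega>"
  shows "AE x in lebesgue_on \<Omega>. grad \<Omega> (v - w) x = (grad \<Omega> v - grad \<Omega> w) x"
  using W12_lincomb(2)[OF assms, of 1 "-1"] by (simp add: fun_diff_def)

lemma W12_minus: "v \<in> W12 \<Omega> \<Longrightarrow> w \<in> W12 \<Omega> \<Longrightarrow> v - w \<in> W12 \<Omega>"
  using W12_lincomb(1)[of v w 1 "-1"] by (simp add: fun_diff_def)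

lemma V_space_minus: "v \<in> V_space \<Omega> \<Gamma> \<Longrightarrow> w \<in> V_space \<Omega> \<Gamma> \<Longrightarrow> v - w \<in> V_space \<Omega> \<Gamma>"
  using V_space_lincomb[of v \<Gamma> w 1 "-1"] by (simp add: fun_diff_def)

lemma V_norm_minus:
  assumes "v \<in> W12 \<Omega>" "w \<in> W12 \<Omega>"
  shows "V_norm \<Omega> (v - w) = L2_norm \<Omega> (grad \<Omega> v - grad \<Omega> w)"
  unfolding V_norm_def
  by (intro L2_norm_cong grad_minus grad_L2 W12_minus L2_minus assms)

lemma V_norm_scale:
  assumes "v \<in> W12 \<Omega>"
  shows "V_norm \<Omega> (\<lambda>x. a * v x) = \<bar>a\<bar> * V_norm \<Omega> v"
proof -
  have "V_norm \<Omega> (\<lambda>x. a * v x + 0 * v x) = L2_norm \<Omega> (\<lambda>x. a *\<^sub>R grad \<Omega> v x + 0 *\<^sub>R grad \<Omega> v x)"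
    unfolding V_norm_def using assms
    by (intro L2_norm_cong W12_lincomb L2_lincomb grad_L2)
  then show ?thesis by (simp add: L2_norm_scale V_norm_def)
qed

sublocale V: seminormed_carrier "V_space \<Omega> \<Gamma>" "V_norm \<Omega>" for \<Gamma>
proof
  fix v w assume "v \<in> V_space \<Omega> \<Gamma>" "w \<in> V_space \<Omega> \<Gamma>"
  then have "v \<in> W12 \<Omega>" "w \<in> W12 \<Omega>" by (auto simp: V_space_imp_W12)
  then show "V_norm \<Omega> (v - w) \<le> V_norm \<Omega> v + V_norm \<Omega> w"
    by (simp add: V_norm_minus) (simp add: V_norm_def L2_norm_triangle_minus grad_L2)
qed (auto simp: V_norm_zero V_space_zero V_space_minus)

text \<open>A supremum of reals is meaningful only for a bounded set; the constant \<open>C\<close>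
  from \<open>V_dual\<close> provides the bound, and the claim follows by scaling to unit
  norm.\<close>

lemma V_dual_bound:
  assumes F: "F \<in> V_dual \<Omega> \<Gamma>" and v: "v \<in> V_space \<Omega> \<Gamma>"
  shows "\<bar>F v\<bar> \<le> V_dual_norm \<Omega> \<Gamma> F * V_norm \<Omega> v"
proof -
  obtain C where C: "\<And>v. v \<in> V_space \<Omega> \<Gamma> \<Longrightarrow> \<bar>F v\<bar> \<le> C * V_norm \<Omega> v"
    using F unfolding V_dual_def by blast
  have lin: "F (\<lambda>x. a * v x) = a * F v" for a
  proof -
    have "F (\<lambda>x. a * v x + 0 * v x) = a * F v + 0 * F v" using F v unfolding V_dual_def by blast
    then show ?thesis by simp
  qed
  show ?thesis
  \<comment> \<open>A function of seminorm 0 cannot be scaled to norm one; for it the constant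
    \<open>C\<close> forces \<open>F v\<close> to be 0.\<close>
  proof (cases "V_norm \<Omega> v = 0")
    case True
    then show ?thesis using C[OF v] by simp
  next
    case False
    then have p: "V_norm \<Omega> v > 0" using V.norm_nonneg[OF v] by simp
    let ?w = "\<lambda>x. inverse (V_norm \<Omega> v) * v x"
    have w: "?w \<in> V_space \<Omega> \<Gamma>" using V_space_lincomb[OF v v, of "inverse (V_norm \<Omega> v)" 0] by simp
    have nw: "V_norm \<Omega> ?w = 1"
      using p V_norm_scale[OF V_space_imp_W12[OF v], of "inverse (V_norm \<Omega> v)"] by simp
    have "\<bar>F ?w\<bar> \<le> V_dual_norm \<Omega> \<Gamma> F"
      unfolding V_dual_norm_def
    proof (rule cSUP_upper)
      show "?w \<in> {v \<in> V_space \<Omega> \<Gamma>. V_norm \<Omega> v \<le> 1}" using w nw by simp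
      show "bdd_above ((\<lambda>v. \<bar>F v\<bar>) ` {v \<in> V_space \<Omega> \<Gamma>. V_norm \<Omega> v \<le> 1})"
      proof (rule bdd_aboveI2)
        fix v assume v: "v \<in> {v \<in> V_space \<Omega> \<Gamma>. V_norm \<Omega> v \<le> 1}"
        have "\<bar>F v\<bar> \<le> C * V_norm \<Omega> v" using C v by simp
        also have "\<dots> \<le> \<bar>C\<bar> * V_norm \<Omega> v" using V.norm_nonneg[of v] v by (intro mult_right_mono) auto
        also have "\<dots> \<le> \<bar>C\<bar> * 1" using v by (intro mult_left_mono) auto
        finally show "\<bar>F v\<bar> \<le> \<bar>C\<bar>" by simp
      qed
    qed
    then have "inverse (V_norm \<Omega> v) * \<bar>F v\<bar> \<le> V_dual_norm \<Omega> \<Gamma> F"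
      using p unfolding lin by (simp add: abs_mult)
    then show ?thesis using p by (simp add: field_simps)
  qed
qed

lemma V_dual_minus:
  assumes "F \<in> V_dual \<Omega> \<Gamma>" "G \<in> V_dual \<Omega> \<Gamma>"
  shows "F - G \<in> V_dual \<Omega> \<Gamma>"
proof -
  have "\<bar>(F - G) v\<bar> \<le> (V_dual_norm \<Omega> \<Gamma> F + V_dual_norm \<Omega> \<Gamma> G) * V_norm \<Omega> v" if "v \<in> V_space \<Omega> \<Gamma>" for v
    using V_dual_bound[OF assms(1) that] V_dual_bound[OF assms(2) that] by (simp add: algebra_simps)
  moreover have "(F - G) (\<lambda>x. a * v x + b * w x) = a * (F - G) v + b * (F - G) w"
    if vw: "v \<in> V_space \<Omega> \<Gamma>" "w \<in> V_space \<Omega> \<Gamma>" for v w a b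
  proof -
    have "F (\<lambda>x. a * v x + b * w x) = a * F v + b * F w"
      "G (\<lambda>x. a * v x + b * w x) = a * G v + b * G w"
      using assms vw unfolding V_dual_def by blast+
    then show ?thesis by (simp add: algebra_simps)
  qed
  ultimately show ?thesis unfolding V_dual_def by blast
qed

lemma V_dual_diff:
  assumes "F \<in> V_dual \<Omega> \<Gamma>" "v \<in> V_space \<Omega> \<Gamma>" "w \<in> V_space \<Omega> \<Gamma>"
  shows "F (v - w) = F v - F w"
proof -
  have "F (\<lambda>x. 1 * v x + (-1) * w x) = 1 * F v + (-1) * F w"
    using assms unfolding V_dual_def by blast
  then show ?thesis by (simp add: fun_diff_def)
qed

end

section \<open>Separability\<close>

text \<open>Outer regularity gives an open set slightly larger than \<open>S\<close>, and continuity
  from below a finite union of basis sets slightly smaller than that open set. The finite unions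
  from a countable basis are countably many.\<close>

lemma countable_sets_approximating_lmeasurable:
  obtains \<B> :: "'a::euclidean_space set set"
  where "countable \<B>" "\<B> \<subseteq> sets borel"
    "\<And>S e. S \<in> lmeasurable \<Longrightarrow> e > 0 \<Longrightarrow> \<exists>B\<in>\<B>. B \<in> lmeasurable \<and> measure lebesgue (S - B) < e \<and> measure lebesgue (B - S) < e"
proof -
  obtain \<Q> :: "'a set set" where \<Q>: "countable \<Q>" "topological_basis \<Q>"
    using ex_countable_basis by blast
  define \<B> where "\<B> = Union ` {F. finite F \<and> F \<subseteq> \<Q>}"
  have opens: "open B" if "B \<in> \<B>" for B
    using that \<Q>(2) unfolding \<B>_def by (auto intro!: open_Union topological_basis_open)
  show thesis
  proof (rule that[of \<B>])
    show "countable \<B>" unfolding \<B>_def using \<Q>(1) by (intro countable_image countable_Collect_finite_subset)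
    show "\<B> \<subseteq> sets borel" using opens by auto
    fix S :: "'a set" and e :: real assume S: "S \<in> lmeasurable" and e: "e > 0"
    obtain U where U: "open U" "S \<subseteq> U" "U - S \<in> lmeasurable" "emeasure lebesgue (U - S) < ennreal e"
      using sets_lebesgue_outer_open[OF fmeasurableD[OF S] e] by metis
    have Um: "U \<in> lmeasurable"
    proof -
      have "S \<union> (U - S) \<in> lmeasurable" using S U(3) by (rule fmeasurable.Un)
      moreover have "S \<union> (U - S) = U" using U(2) by blast
      ultimately show ?thesis by simp
    qed
    obtain \<F> where \<F>: "\<F> \<subseteq> \<Q>" "\<Union>\<F> = U" using \<Q>(2) U(1) unfolding topological_basis_def by blast
    \<comment> \<open>\<open>from_nat_into\<close> is meaningful only for a nonempty family; the
      empty family is enumerated by empty sets.\<close>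
    define b where "b n = (if \<F> = {} then {} else from_nat_into \<F> n)" for n
    define A where "A n = (\<Union>i\<le>n. b i)" for n
    have "countable \<F>" using \<F>(1) \<Q>(1) countable_subset by blast
    then have bU: "(\<Union>n. b n) = U" using \<F>(2) unfolding b_def by (auto simp: range_from_nat_into)
    have AB: "A n \<in> \<B>" for n
    proof (cases "\<F> = {}")
      case True then show ?thesis by (auto simp: A_def b_def \<B>_def intro!: image_eqI[of _ _ "{}"])
    next
      case False
      then have "b ` {..n} \<subseteq> \<Q>" using \<F>(1) from_nat_into[OF False] by (auto simp: b_def)
      then show ?thesis unfolding A_def \<B>_def by (intro image_eqI[of _ _ "b ` {..n}"]) auto
    qed
    have AU: "A n \<subseteq> U" for n using bU by (auto simp: A_def)
    have Am: "A n \<in> lmeasurable" for n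
      using fmeasurableI2[OF Um AU] opens[OF AB] by simp
    have "(\<lambda>n. measure lebesgue (A n)) \<longlonglongrightarrow> measure lebesgue (\<Union>n. A n)"
    proof (rule Lim_measure_incseq)
      show "range A \<subseteq> sets lebesgue" using Am by auto
      show "incseq A" unfolding A_def by (force simp: incseq_def)
      show "emeasure lebesgue (\<Union>n. A n) \<noteq> \<infinity>"
      proof -
        have "(\<Union>n. A n) \<subseteq> U" using AU by blast
        then have "emeasure lebesgue (\<Union>n. A n) \<le> emeasure lebesgue U"
          using Um by (intro emeasure_mono) auto
        also have "\<dots> < \<infinity>" using Um unfolding fmeasurable_def by blast
        finally show ?thesis by simp
      qed
    qed
    moreover have "(\<Union>n. A n) = U" using bU by (auto simp: A_def)
    ultimately have "\<forall>\<^sub>F n in sequentially. measure lebesgue (A n) > measure lebesgue U - e"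
      using e by (intro order_tendstoD(1)) auto
    then obtain n where "measure lebesgue (A n) > measure lebesgue U - e"
      using eventually_happens'[OF trivial_limit_sequentially] by blast
    then have n: "measure lebesgue U - measure lebesgue (A n) < e" by linarith
    have "measure lebesgue (S - A n) \<le> measure lebesgue (U - A n)"
      using S U(2) Um Am by (intro measure_mono_fmeasurable) auto
    also have "\<dots> = measure lebesgue U - measure lebesgue (A n)"
      using Um Am AU by (intro measurable_measure_Diff) auto
    finally have 1: "measure lebesgue (S - A n) < e" using n by simp
    have "measure lebesgue (A n - S) \<le> measure lebesgue (U - S)"
      using S U AU Am by (intro measure_mono_fmeasurable) auto
    also have "\<dots> < e" using U(3,4) e by (simp add: emeasure_eq_measure2 ennreal_less_iff)
    finally have "measure lebesgue (A n - S) < e" .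
    with 1 AB Am show "\<exists>B\<in>\<B>. B \<in> lmeasurable \<and> measure lebesgue (S - B) < e \<and> measure lebesgue (B - S) < e" by blast
  qed
qed

lemma L2_indicator:
  assumes "\<Omega> \<in> lmeasurable" "A \<in> sets lebesgue"
  shows "(\<lambda>x. indicator A x *\<^sub>R c) \<in> L2 \<Omega>"
    and "L2_norm \<Omega> (\<lambda>x. indicator A x *\<^sub>R c) = norm c * sqrt (measure lebesgue (A \<inter> \<Omega>))"
proof -
  have \<Omega>: "\<Omega> \<in> sets lebesgue" using assms by auto
  have e: "(norm (indicator A x *\<^sub>R c))\<^sup>2 = (norm c)\<^sup>2 * indicator A x" for x
    by (simp add: indicator_def)
  have [measurable]: "A \<inter> \<Omega> \<in> sets (lebesgue_on \<Omega>)" "(\<lambda>x. indicat_real A x) \<in> borel_measurable (lebesgue_on \<Omega>)"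
    using assms \<Omega> by (auto simp: sets_restrict_space intro: measurable_restrict_space1)
  have fin: "finite_measure (lebesgue_on \<Omega>)" using assms(1) by (rule finite_measure_lebesgue_on)
  have i: "integrable (lebesgue_on \<Omega>) (indicat_real A)"
    by (rule finite_measure.integrable_const_bound[OF fin, of _ 1]) auto
  show "(\<lambda>x. indicator A x *\<^sub>R c) \<in> L2 \<Omega>"
    using i unfolding L2_def mem_Collect_eq e
    by (auto intro!: borel_measurable_scaleR)
  have "(LINT x|lebesgue_on \<Omega>. indicat_real A x) = (LINT x|lebesgue_on \<Omega>. indicat_real (A \<inter> \<Omega>) x)"
    by (intro Bochner_Integration.integral_cong) (auto simp: indicator_def)
  also have "\<dots> = measure lebesgue (A \<inter> \<Omega>)"
    using assms \<Omega> by (simp add: measure_restrict_space)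
  finally show "L2_norm \<Omega> (\<lambda>x. indicator A x *\<^sub>R c) = norm c * sqrt (measure lebesgue (A \<inter> \<Omega>))"
    unfolding L2_norm_def e by (simp add: real_sqrt_mult)
qed

text \<open>The countable set consists of step functions with sets from \<open>\<B>\<close> and
  coefficients from a dense set \<open>E\<close>. The functions it approximates, \<open>P\<close>,
  are closed under sums and contain indicators with arbitrary coefficients, hence simple functions,
  hence all of L2.\<close>

lemma L2_separable:
  assumes \<Omega>: "\<Omega> \<in> lmeasurable"
  obtains D :: "('a::euclidean_space \<Rightarrow> 'b::euclidean_space) set"
  where "countable D" "D \<subseteq> L2 \<Omega>" "\<And>f e. f \<in> L2 \<Omega> \<Longrightarrow> e > 0 \<Longrightarrow> \<exists>d\<in>D. L2_norm \<Omega> (f - d) < e"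
proof -
  obtain \<B> :: "'a set set" where \<B>: "countable \<B>" "\<B> \<subseteq> sets borel"
    and approx: "\<And>S e. S \<in> lmeasurable \<Longrightarrow> e > 0 \<Longrightarrow> \<exists>B\<in>\<B>. B \<in> lmeasurable \<and> measure lebesgue (S - B) < e \<and> measure lebesgue (B - S) < e"
    using countable_sets_approximating_lmeasurable by metis
  obtain E :: "'b set" where E: "countable E" "\<And>X. open X \<Longrightarrow> X \<noteq> {} \<Longrightarrow> \<exists>d\<in>E. d \<in> X"
    using countable_dense_exists by metis
  \<comment> \<open>Lists of pairs make the sum of two step functions the step function of the
    concatenated list.\<close>
  define step :: "('a set \<times> 'b) list \<Rightarrow> 'a \<Rightarrow> 'b"
    where "step xs x = (\<Sum>(B, c)\<leftarrow>xs. indicator B x *\<^sub>R c)" for xs x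
  define D where "D = step ` lists (\<B> \<times> E)"
  have step: "step xs \<in> L2 \<Omega>" if "xs \<in> lists (\<B> \<times> E)" for xs
    using that
  proof (induction xs)
    case Nil then show ?case using L2_zero by (simp add: step_def[abs_def] zero_fun_def)
  next
    case (Cons p xs)
    obtain B c where p: "p = (B, c)" by (cases p)
    have "step (p # xs) = (\<lambda>x. indicator B x *\<^sub>R c) + step xs"
      by (auto simp: step_def p)
    moreover have "(\<lambda>x. indicator B x *\<^sub>R c) \<in> L2 \<Omega>"
      using Cons p \<B>(2) by (intro L2_indicator \<Omega>) auto
    moreover have "step xs \<in> L2 \<Omega>" using Cons by simp
    ultimately show ?case by (metis L2_plus)
  qed
  then have DL: "D \<subseteq> L2 \<Omega>" by (auto simp: D_def)
  have Dadd: "d + d' \<in> D" if "d \<in> D" "d' \<in> D" for d d'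
  proof -
    obtain xs ys where "d = step xs" "d' = step ys" "xs \<in> lists (\<B> \<times> E)" "ys \<in> lists (\<B> \<times> E)"
      using \<open>d \<in> D\<close> \<open>d' \<in> D\<close> unfolding D_def by blast
    then have "d + d' = step (xs @ ys)" "xs @ ys \<in> lists (\<B> \<times> E)"
      by (auto simp: step_def fun_eq_iff)
    then show ?thesis by (auto simp: D_def)
  qed
  define P where "P f \<longleftrightarrow> f \<in> L2 \<Omega> \<and> (\<forall>e>0. \<exists>d\<in>D. L2_norm \<Omega> (f - d) < e)" for f
  have Padd: "P (f + g)" if fg: "P f" "P g" for f g
    unfolding P_def
  proof (intro conjI allI impI)
    show "f + g \<in> L2 \<Omega>" using that by (auto simp: P_def intro: L2_plus)
    fix e :: real assume "e > 0"
    then obtain d d' where d: "d \<in> D" "d' \<in> D" "L2_norm \<Omega> (f - d) < e / 2" "L2_norm \<Omega> (g - d') < e / 2"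
      using fg half_gt_zero[OF \<open>e > 0\<close>] unfolding P_def by blast
    have "L2_norm \<Omega> ((f - d) + (g - d')) \<le> L2_norm \<Omega> (f - d) + L2_norm \<Omega> (g - d')"
      using that d DL by (intro L2.norm_plus_le L2_minus) (auto simp: P_def)
    moreover have "(f - d) + (g - d') = (f + g) - (d + d')" by (simp add: algebra_simps)
    ultimately show "\<exists>d\<in>D. L2_norm \<Omega> (f + g - d) < e"
      using d Dadd by (intro bexI[of _ "d + d'"]) auto
  qed
  have Pind: "P (\<lambda>x. indicator A x *\<^sub>R c)" if A: "A \<in> sets lebesgue" "A \<subseteq> \<Omega>" for A c
    unfolding P_def
  proof (intro conjI allI impI)
    show "(\<lambda>x. indicator A x *\<^sub>R c) \<in> L2 \<Omega>" by (intro L2_indicator \<Omega> A)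
    fix e :: real assume e: "e > 0"
    have Am: "A \<in> lmeasurable" using fmeasurableI2[OF \<Omega> A(2,1)] .
    \<comment> \<open>The error splits into \<open>c - k\<close> on \<open>A\<close>, plus
      \<open>k\<close> on \<open>A - B\<close>, minus \<open>k\<close> on \<open>B - A\<close>. The
      tolerance for \<open>c - k\<close> is scaled by \<open>m\<close>, and \<open>\<delta>\<close>
      below makes \<open>norm k * sqrt \<delta>\<close> at most \<open>e / 4\<close>; the added 1
      keeps both denominators positive.\<close>
    define m where "m = sqrt (measure lebesgue \<Omega>) + 1"
    have m: "m > 0" by (simp add: m_def add_nonneg_pos)
    obtain k where k: "k \<in> E" "dist c k < e / (4 * m)"
    proof -
      have "e / (4 * m) > 0" using e m by simp
      then show thesis using E(2)[of "ball c (e / (4 * m))"] that by auto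
    qed
    have k1: "norm k + 1 > 0" by (simp add: add_nonneg_pos)
    define \<delta> where "\<delta> = (e / (4 * (norm k + 1)))\<^sup>2"
    have \<delta>: "\<delta> > 0" using e k1 by (simp add: \<delta>_def del: power_divide)
    obtain B where B: "B \<in> \<B>" "B \<in> lmeasurable" "measure lebesgue (A - B) < \<delta>" "measure lebesgue (B - A) < \<delta>"
      using approx[OF Am \<delta>] by blast
    have Bs: "B \<in> sets lebesgue" using B(2) by auto
    have sm: "norm k * sqrt (measure lebesgue (C \<inter> \<Omega>)) \<le> e / 4"
      if "C \<in> lmeasurable" "measure lebesgue C < \<delta>" for C
    proof -
      have "measure lebesgue (C \<inter> \<Omega>) \<le> measure lebesgue C"
        using that(1) \<Omega> by (intro measure_mono_fmeasurable) auto
      then have "sqrt (measure lebesgue (C \<inter> \<Omega>)) \<le> sqrt \<delta>"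
        using that(2) by (intro real_sqrt_le_mono) linarith
      also have "sqrt \<delta> = e / (4 * (norm k + 1))" using e k1 by (simp add: \<delta>_def del: power_divide)
      finally have "norm k * sqrt (measure lebesgue (C \<inter> \<Omega>)) \<le> (norm k + 1) * (e / (4 * (norm k + 1)))"
        by (intro mult_mono) auto
      also have "\<dots> = e / 4"
      proof -
        have "r * (e / (4 * r)) = e / 4" if "r > 0" for r :: real using that by simp
        then show ?thesis using k1 by blast
      qed
      finally show ?thesis .
    qed
    let ?a = "\<lambda>x. indicator A x *\<^sub>R (c - k)" and ?b = "\<lambda>x. indicator (A - B) x *\<^sub>R k"
      and ?c = "\<lambda>x. indicator (B - A) x *\<^sub>R k"
    have L: "?a \<in> L2 \<Omega>" "?b \<in> L2 \<Omega>" "?c \<in> L2 \<Omega>"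
      using A Bs by (auto intro!: L2_indicator \<Omega>)
    have "L2_norm \<Omega> ?a \<le> e / (4 * m) * m"
      unfolding L2_indicator(2)[OF \<Omega> A(1)]
    proof (rule mult_mono)
      show "norm (c - k) \<le> e / (4 * m)" using k(2) by (simp add: dist_norm)
      have "measure lebesgue (A \<inter> \<Omega>) \<le> measure lebesgue \<Omega>"
        using A \<Omega> by (intro measure_mono_fmeasurable) auto
      then have "sqrt (measure lebesgue (A \<inter> \<Omega>)) \<le> sqrt (measure lebesgue \<Omega>)" by simp
      then show "sqrt (measure lebesgue (A \<inter> \<Omega>)) \<le> m" unfolding m_def by linarith
    qed (use e m in auto)
    then have "L2_norm \<Omega> ?a \<le> e / 4" using m by (simp add: field_simps)
    moreover have "L2_norm \<Omega> ?b \<le> e / 4"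
      using sm[of "A - B"] B(3) Am B(2) Bs A by (subst L2_indicator(2)[OF \<Omega>]) auto
    moreover have "L2_norm \<Omega> ?c \<le> e / 4"
      using sm[of "B - A"] B(4) Am B(2) Bs A by (subst L2_indicator(2)[OF \<Omega>]) auto
    moreover have "(\<lambda>x. indicator A x *\<^sub>R c) - step [(B, k)] = ?a + (?b - ?c)"
      by (auto simp: step_def indicator_def fun_eq_iff scaleR_diff_right)
    moreover have "L2_norm \<Omega> (?a + (?b - ?c)) \<le> L2_norm \<Omega> ?a + (L2_norm \<Omega> ?b + L2_norm \<Omega> ?c)"
      using L2.norm_plus_le[OF L(1) L2_minus[OF L(2,3)]] L2.norm_minus_le[OF L(2,3)] by simp
    ultimately have "L2_norm \<Omega> ((\<lambda>x. indicator A x *\<^sub>R c) - step [(B, k)]) < e" using e by simp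
    moreover have "step [(B, k)] \<in> D" using B(1) k(1) by (auto simp: D_def)
    ultimately show "\<exists>d\<in>D. L2_norm \<Omega> ((\<lambda>x. indicator A x *\<^sub>R c) - d) < e" by blast
  qed
  have P0: "P 0"
    using Pind[of "{}" 0] by (simp add: zero_fun_def)
  have Psum: "P (\<lambda>x. \<Sum>i\<in>I. h i x)" if "finite I" "\<And>i. i \<in> I \<Longrightarrow> P (h i)" for I :: "'b set" and h
    using that
  proof (induction I rule: finite_induct)
    case empty then show ?case using P0 by (simp add: zero_fun_def)
  next
    case (insert i I) then show ?case using Padd[of "h i" "\<lambda>x. \<Sum>i\<in>I. h i x"] by (simp add: plus_fun_def)
  qed
  have Pcong: "P f" if "P g" and eq: "\<And>x. x \<in> \<Omega> \<Longrightarrow> f x = g x" for f g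
  proof -
    have n: "L2_norm \<Omega> (f - d) = L2_norm \<Omega> (g - d)" for d
      unfolding L2_norm_def using eq
      by (intro arg_cong[where f=sqrt] Bochner_Integration.integral_cong) auto
    have "f \<in> borel_measurable (lebesgue_on \<Omega>) \<longleftrightarrow> g \<in> borel_measurable (lebesgue_on \<Omega>)"
      using eq by (intro measurable_cong) auto
    moreover have "integrable (lebesgue_on \<Omega>) (\<lambda>x. (norm (f x))\<^sup>2) \<longleftrightarrow> integrable (lebesgue_on \<Omega>) (\<lambda>x. (norm (g x))\<^sup>2)"
      using eq by (intro Bochner_Integration.integrable_cong) auto
    ultimately have "f \<in> L2 \<Omega>" using \<open>P g\<close> by (auto simp: P_def L2_def)
    then show ?thesis using \<open>P g\<close> unfolding P_def n by blast
  qed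
  have Psimple: "P s" if s: "simple_function (lebesgue_on \<Omega>) s" for s
  proof -
    have "P (\<lambda>x. \<Sum>y\<in>s ` \<Omega>. indicator (s -` {y} \<inter> \<Omega>) x *\<^sub>R y)"
    proof (rule Psum)
      show "finite (s ` \<Omega>)" using simple_functionD(1)[OF s] by simp
      fix y
      have "s -` {y} \<inter> \<Omega> \<in> sets (lebesgue_on \<Omega>)" using simple_functionD(2)[OF s, of "{y}"] by simp
      then have "s -` {y} \<inter> \<Omega> \<in> sets lebesgue"
        using \<Omega> by (auto simp: sets_restrict_space)
      then show "P (\<lambda>x. indicator (s -` {y} \<inter> \<Omega>) x *\<^sub>R y)" by (rule Pind) auto
    qed
    moreover have "s x = (\<Sum>y\<in>s ` \<Omega>. indicator (s -` {y} \<inter> \<Omega>) x *\<^sub>R y)" if "x \<in> \<Omega>" for x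
      by (rule simple_function_indicator_representation_banach[OF s, simplified]) (use that in simp)
    ultimately show ?thesis by (rule Pcong)
  qed
  show thesis
  proof (rule that[of D])
    show "countable D" unfolding D_def using \<B>(1) E(1) by (intro countable_image countable_lists countable_SIGMA)
    show "D \<subseteq> L2 \<Omega>" by (rule DL)
    fix f :: "'a \<Rightarrow> 'b" and e :: real assume f: "f \<in> L2 \<Omega>" and e: "e > 0"
    obtain s where s: "\<And>i. simple_function (lebesgue_on \<Omega>) (s i)"
      "\<And>x. x \<in> space (lebesgue_on \<Omega>) \<Longrightarrow> (\<lambda>i. s i x) \<longlonglongrightarrow> f x"
      "\<And>i x. x \<in> space (lebesgue_on \<Omega>) \<Longrightarrow> dist (s i x) 0 \<le> 2 * dist (f x) 0"
      using borel_measurable_implies_sequence_metric[OF L2_measurable[OF f], of 0] by metis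
    note [measurable] = L2_measurable[OF f] borel_measurable_simple_function[OF s(1)]
    have "(\<lambda>i. LINT x|lebesgue_on \<Omega>. (norm ((f - s i) x))\<^sup>2) \<longlonglongrightarrow> (LINT x|lebesgue_on \<Omega>. 0)"
    \<comment> \<open>The approximants are bounded by 2 |f|, so the difference is at most 3
      |f|.\<close>
    proof (rule integral_dominated_convergence[where w="\<lambda>x. 9 * (norm (f x))\<^sup>2"])
      show "integrable (lebesgue_on \<Omega>) (\<lambda>x. 9 * (norm (f x))\<^sup>2)" using L2_integrable_sq[OF f] by simp
      show "AE x in lebesgue_on \<Omega>. (\<lambda>i. (norm ((f - s i) x))\<^sup>2) \<longlonglongrightarrow> 0"
      proof (rule AE_I2)
        fix x assume x: "x \<in> space (lebesgue_on \<Omega>)"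
        have "(\<lambda>i. (norm (f x - s i x))\<^sup>2) \<longlonglongrightarrow> (norm (f x - f x))\<^sup>2"
          by (intro tendsto_intros s x)
        then show "(\<lambda>i. (norm ((f - s i) x))\<^sup>2) \<longlonglongrightarrow> 0" by simp
      qed
      show "AE x in lebesgue_on \<Omega>. norm ((norm ((f - s i) x))\<^sup>2) \<le> 9 * (norm (f x))\<^sup>2" for i
      proof (rule AE_I2)
        fix x assume x: "x \<in> space (lebesgue_on \<Omega>)"
        have "norm (f x - s i x) \<le> 3 * norm (f x)"
          using s(3)[OF x, of i] norm_triangle_ineq4[of "f x" "s i x"] by simp
        then have "(norm (f x - s i x))\<^sup>2 \<le> (3 * norm (f x))\<^sup>2" by (rule power_mono) simp
        then show "norm ((norm ((f - s i) x))\<^sup>2) \<le> 9 * (norm (f x))\<^sup>2" by (simp add: power_mult_distrib)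
      qed
    qed (simp_all add: fun_diff_def)
    then have "(\<lambda>i. L2_norm \<Omega> (f - s i)) \<longlonglongrightarrow> sqrt 0"
      unfolding L2_norm_def by (intro tendsto_real_sqrt) simp
    then have "\<forall>\<^sub>F i in sequentially. L2_norm \<Omega> (f - s i) < e / 2"
      using e by (intro order_tendstoD(2)[where y=0]) auto
    then obtain i where i: "L2_norm \<Omega> (f - s i) < e / 2" by (auto simp: eventually_sequentially)
    obtain d where d: "d \<in> D" "L2_norm \<Omega> (s i - d) < e / 2"
      using Psimple[OF s(1), of i] half_gt_zero[OF e] unfolding P_def by blast
    have "L2_norm \<Omega> (f - d) \<le> L2_norm \<Omega> (f - s i) + L2_norm \<Omega> (s i - d)"
      using Psimple[OF s(1), of i] d DL f by (intro L2.norm_triangle) (auto simp: P_def)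
    then show "\<exists>d\<in>D. L2_norm \<Omega> (f - d) < e" using d i by (intro bexI[of _ d]) auto
  qed
qed

context bounded_open_set
begin

text \<open>A subset of a separable metric space is separable, applied to the pairs (v, grad v). The
  dense points need not come from \<open>V\<close>, so one member of \<open>V\<close> is selected
  near each pair of them whenever there is one. Both norms are controlled at once: the L2 norm for
  inner products with \<open>e\<close>, the gradient norm for the forcing.\<close>

lemma W12_subset_separable:
  assumes V: "V \<subseteq> W12 \<Omega>"
  obtains S where "countable S" "S \<subseteq> V"
    "\<And>v e. v \<in> V \<Longrightarrow> e > 0 \<Longrightarrow> \<exists>s\<in>S. L2_norm \<Omega> (v - s) < e \<and> V_norm \<Omega> (v - s) < e"
proof -
  obtain D1 :: "('a \<Rightarrow> real) set" where D1: "countable D1" "D1 \<subseteq> L2 \<Omega>"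
    "\<And>f e. f \<in> L2 \<Omega> \<Longrightarrow> e > 0 \<Longrightarrow> \<exists>d\<in>D1. L2_norm \<Omega> (f - d) < e"
    using L2_separable[OF lmeasurable_domain] by metis
  obtain D2 :: "('a \<Rightarrow> 'a) set" where D2: "countable D2" "D2 \<subseteq> L2 \<Omega>"
    "\<And>f e. f \<in> L2 \<Omega> \<Longrightarrow> e > 0 \<Longrightarrow> \<exists>d\<in>D2. L2_norm \<Omega> (f - d) < e"
    using L2_separable[OF lmeasurable_domain] by metis
  define near where "near = (\<lambda>(d1, d2, n::nat) v.
    v \<in> V \<and> L2_norm \<Omega> (v - d1) < 1 / Suc n \<and> L2_norm \<Omega> (grad \<Omega> v - d2) < 1 / Suc n)"
  define S where "S = (\<lambda>p. SOME v. near p v) ` {p \<in> D1 \<times> D2 \<times> UNIV. \<exists>v. near p v}"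
  have near: "near p (SOME v. near p v)" if "\<exists>v. near p v" for p
    using that by (rule someI_ex)
  show thesis
  proof (rule that[of S])
    show "countable S" unfolding S_def using D1(1) D2(1)
      by (intro countable_image countable_subset[OF _ countable_SIGMA[OF D1(1) countable_SIGMA[OF D2(1) countableI_type[of UNIV]]]]) auto
    show "S \<subseteq> V" unfolding S_def using near by (force simp: near_def)
    fix v and e :: real assume v: "v \<in> V" and e: "e > 0"
    obtain n where n: "1 / real (Suc n) < e / 2" using e nat_approx_posE[of "e / 2"] by auto
    have vL: "v \<in> L2 \<Omega>" "v \<in> W12 \<Omega>" using v V by (auto simp: W12_def)
    obtain d1 d2 where d: "d1 \<in> D1" "d2 \<in> D2" "L2_norm \<Omega> (v - d1) < 1 / Suc n" "L2_norm \<Omega> (grad \<Omega> v - d2) < 1 / Suc n"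
      using D1(3)[OF vL(1), of "1 / Suc n"] D2(3)[OF grad_L2[OF vL(2)], of "1 / Suc n"] by auto
    define w where "w = (SOME w. near (d1, d2, n) w)"
    have "near (d1, d2, n) v" using v d by (simp add: near_def)
    then have w: "near (d1, d2, n) w" unfolding w_def by (intro near exI)
    have "w \<in> S" unfolding S_def w_def using d \<open>near (d1, d2, n) v\<close> by (intro image_eqI[of _ _ "(d1, d2, n)"]) auto
    have wW: "w \<in> V" "w \<in> W12 \<Omega>" "w \<in> L2 \<Omega>" using w V by (auto simp: near_def W12_def)
    have dL: "d1 \<in> L2 \<Omega>" "d2 \<in> L2 \<Omega>" using d D1(2) D2(2) by auto
    have w': "L2_norm \<Omega> (w - d1) < 1 / Suc n" "L2_norm \<Omega> (grad \<Omega> w - d2) < 1 / Suc n"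
      using w by (auto simp: near_def)
    have "L2_norm \<Omega> (v - w) \<le> L2_norm \<Omega> (v - d1) + L2_norm \<Omega> (d1 - w)"
      by (intro L2.norm_triangle vL wW dL)
    then have 1: "L2_norm \<Omega> (v - w) < e"
      using d w' n L2.norm_minus_commute[OF dL(1) wW(3)] by linarith
    have "L2_norm \<Omega> (grad \<Omega> v - grad \<Omega> w) \<le> L2_norm \<Omega> (grad \<Omega> v - d2) + L2_norm \<Omega> (d2 - grad \<Omega> w)"
      by (intro L2.norm_triangle grad_L2 vL wW dL)
    then have "V_norm \<Omega> (v - w) < e"
      using d w' n L2.norm_minus_commute[OF dL(2) grad_L2[OF wW(2)]] V_norm_minus[OF vL(2) wW(2)] by linarith
    with 1 \<open>w \<in> S\<close> show "\<exists>s\<in>S. L2_norm \<Omega> (v - s) < e \<and> V_norm \<Omega> (v - s) < e" by blast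
  qed
qed

end

section \<open>Weak derivatives on an interval\<close>

text \<open>This is completeness of Lebesgue measure; it supplies measurability of integrands that
  involve choices such as \<open>grad\<close>.\<close>

lemma borel_measurable_lebesgue_on_cong_AE:
  fixes f g :: "'a::euclidean_space \<Rightarrow> real"
  assumes S: "S \<in> sets lebesgue" and f: "f \<in> borel_measurable (lebesgue_on S)"
    and ae: "AE x in lebesgue_on S. f x = g x"
  shows "g \<in> borel_measurable (lebesgue_on S)"
proof -
  have S': "S \<inter> space lebesgue \<in> sets lebesgue" using S by simp
  have "(\<lambda>x. indicator S x *\<^sub>R f x) \<in> borel_measurable lebesgue"
    using f by (simp add: borel_measurable_restrict_space_iff[OF S'])
  moreover have "AE x in lebesgue. indicator S x *\<^sub>R f x = indicator S x *\<^sub>R g x"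
    using ae by (auto simp: AE_restrict_space_iff[OF S'] elim: eventually_mono)
  ultimately have "(\<lambda>x. indicator S x *\<^sub>R g x) \<in> borel_measurable lebesgue"
    by (rule borel_measurable_AE)
  then show ?thesis by (simp add: borel_measurable_restrict_space_iff[OF S'])
qed

lemma borel_measurable_lebesgue_on_LIMSEQ_AE:
  fixes g :: "'a::euclidean_space \<Rightarrow> real"
  assumes S: "S \<in> sets lebesgue" and [measurable]: "\<And>n. f n \<in> borel_measurable (lebesgue_on S)"
    and ae: "AE x in lebesgue_on S. (\<lambda>n. f n x) \<longlonglongrightarrow> g x"
  shows "g \<in> borel_measurable (lebesgue_on S)"
proof (rule borel_measurable_lebesgue_on_cong_AE[OF S])
  show "(\<lambda>x. lim (\<lambda>n. f n x)) \<in> borel_measurable (lebesgue_on S)" by measurable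
  show "AE x in lebesgue_on S. lim (\<lambda>n. f n x) = g x"
    using ae by eventually_elim (rule limI)
qed

text \<open>Integrability is stated over open intervals, while additivity over adjacent intervals
  and continuity in the upper limit come from the gauge integral over closed ones; the endpoints
  form a null set.\<close>

lemma
  fixes p :: "real \<Rightarrow> real"
  assumes p: "integrable (lebesgue_on {0<..<T}) p"
  shows open_interval_absolutely_integrable: "p absolutely_integrable_on {0..T}"
    and open_interval_integrable_on: "\<And>a b :: real. 0 \<le> a \<Longrightarrow> b \<le> T \<Longrightarrow> p integrable_on {a..b}"
    and open_interval_LINT: "\<And>a b :: real. 0 \<le> a \<Longrightarrow> b \<le> T \<Longrightarrow> (LINT s|lebesgue_on {a<..<b}. p s) = integral {a..b} p"
    and open_interval_integrable: "\<And>a b :: real. 0 \<le> a \<Longrightarrow> b \<le> T \<Longrightarrow> integrable (lebesgue_on {a<..<b}) p"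
proof -
  have si: "set_integrable lebesgue {0<..<T} p"
    using p by (simp add: integrable_restrict_space set_integrable_def)
  have "negligible {0, T}" by simp
  have "p absolutely_integrable_on {0<..<T} \<longleftrightarrow> p absolutely_integrable_on {0..T}"
  proof (rule absolutely_integrable_spike_set_eq)
    show "negligible {x \<in> {0<..<T} - {0..T}. p x \<noteq> 0}" by (auto intro: negligible_subset[of "{}"])
    show "negligible {x \<in> {0..T} - {0<..<T}. p x \<noteq> 0}" by (rule negligible_subset[OF \<open>negligible {0, T}\<close>]) auto
  qed
  with si show ai: "p absolutely_integrable_on {0..T}" by simp
  fix a b :: real assume ab: "0 \<le> a" "b \<le> T"
  then have "set_integrable lebesgue {a..b} p"
    by (intro set_integrable_subset[OF ai]) auto
  then show "p integrable_on {a..b}" by (rule set_lebesgue_integral_eq_integral)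
  have i: "set_integrable lebesgue {a<..<b} p"
    using ab by (intro set_integrable_subset[OF si]) auto
  then show ib: "integrable (lebesgue_on {a<..<b}) p"
    by (simp add: integrable_restrict_space set_integrable_def)
  have "(LINT s|lebesgue_on {a<..<b}. p s) = integral {a<..<b} p"
    using ib by (rule lebesgue_integral_eq_integral) simp
  then show "(LINT s|lebesgue_on {a<..<b}. p s) = integral {a..b} p"
    by (simp add: integral_open_interval_real)
qed

lemma real_smooth_DERIV:
  fixes \<phi> :: "real \<Rightarrow> real"
  assumes "smooth \<phi>"
  shows "(\<phi> has_real_derivative deriv \<phi> x) (at x)"
    and "smooth (deriv \<phi>)"
proof -
  have d: "\<phi> field_differentiable at x" for x
    by (rule has_real_derivative[OF smooth_has_derivative[OF assms, of x]]) (auto simp: field_differentiable_def)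
  then show D: "(\<phi> has_real_derivative deriv \<phi> x) (at x)" for x
    by (simp add: DERIV_deriv_iff_field_differentiable)
  have "frechet_derivative \<phi> (at x) 1 = deriv \<phi> x" for x
    using frechet_derivative_at[OF D[unfolded has_field_derivative_def], of x] by (metis mult.right_neutral)
  then show "smooth (deriv \<phi>)"
    using smooth_frechet_derivative[OF assms, of 1] by (simp add: fun_eq_iff[symmetric])
qed

lemma real_smooth_antiderivative:
  fixes \<phi> \<omega> :: "real \<Rightarrow> real"
  assumes d: "\<And>x. (\<phi> has_real_derivative \<omega> x) (at x)" and w: "smooth \<omega>"
  shows "smooth \<phi>"
  unfolding smooth_def
proof
  fix k show "Ck k \<phi>"
  proof (cases k)
    case 0
    then show ?thesis
      using DERIV_continuous_on[of UNIV \<phi> \<omega>] d by (simp add: has_field_derivative_at_within)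
  next
    case (Suc l)
    have "Ck (Suc l) \<phi>"
    proof (rule CkI)
      show "(\<phi> has_derivative (\<lambda>h. \<omega> x * h)) (at x)" for x
        using d[of x] by (simp add: has_field_derivative_def)
      show "Ck l (\<lambda>x. \<omega> x * b)" if "b \<in> Basis" for b
        using w that by (simp add: smooth_def)
    qed
    then show ?thesis by (simp add: Suc)
  qed
qed

text \<open>The compact support keeps a positive distance from both ends of the interval, which
  leaves room for a strictly larger interval inside and, later, for small shifts in time.\<close>

lemma test_functions_supp:
  fixes \<phi> :: "real \<Rightarrow> real"
  assumes \<phi>: "\<phi> \<in> test_functions {0<..<T}" and T: "0 < T"
  obtains \<alpha> \<beta> where "0 < \<alpha>" "\<alpha> < \<beta>" "\<beta> < T" "\<And>x. x \<notin> {\<alpha><..<\<beta>} \<Longrightarrow> \<phi> x = 0"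
proof -
  let ?K = "closure {x. \<phi> x \<noteq> 0}"
  have K: "compact ?K" "?K \<subseteq> {0<..<T}" using \<phi> by (auto simp: test_functions_def)
  show thesis
  proof (cases "?K = {}")
    case True
    then show thesis using T by (intro that[of "T / 3" "2 * T / 3"]) auto
  next
    case False
    obtain s where s: "s \<in> ?K" "\<And>x. x \<in> ?K \<Longrightarrow> s \<le> x"
      using compact_attains_inf[OF K(1) False] by blast
    obtain t where t: "t \<in> ?K" "\<And>x. x \<in> ?K \<Longrightarrow> x \<le> t"
      using compact_attains_sup[OF K(1) False] by blast
    have "0 < s" "s \<le> t" "t < T" using s t K(2) by auto
    show thesis
    proof (rule that[of "s / 2" "(t + T) / 2"])
      fix x assume x: "x \<notin> {s / 2<..<(t + T) / 2}"
      show "\<phi> x = 0"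
      proof (rule ccontr)
        assume "\<phi> x \<noteq> 0"
        then have "x \<in> ?K" using closure_subset[of "{x. \<phi> x \<noteq> 0}"] by auto
        then show False using s(2) t(2) x \<open>0 < s\<close> \<open>t < T\<close> by fastforce
      qed
    qed (use \<open>0 < s\<close> \<open>s \<le> t\<close> \<open>t < T\<close> in auto)
  qed
qed

lemma test_functionsI_real:
  fixes \<phi> :: "real \<Rightarrow> real"
  assumes "smooth \<phi>" "0 < \<alpha>" "\<beta> < T" "\<And>x. x \<notin> {\<alpha><..<\<beta>} \<Longrightarrow> \<phi> x = 0"
  shows "\<phi> \<in> test_functions {0<..<T}"
proof (rule test_functions_subset_support[where K="{\<alpha>..\<beta>}"])
  show "{x. \<phi> x \<noteq> 0} \<subseteq> {\<alpha>..\<beta>}"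
  proof
    fix x assume "x \<in> {x. \<phi> x \<noteq> 0}"
    then have "x \<in> {\<alpha><..<\<beta>}" using assms(4) by blast
    then show "x \<in> {\<alpha>..\<beta>}" by simp
  qed
qed (use assms in auto)

lemma deriv_zero_outside:
  fixes \<phi> :: "real \<Rightarrow> real"
  assumes "\<And>x. x \<notin> {\<alpha><..<\<beta>} \<Longrightarrow> \<phi> x = 0" "x \<notin> {\<alpha>..\<beta>}"
  shows "deriv \<phi> x = 0"
proof -
  have "((\<lambda>x. 0) has_real_derivative 0) (at x)" by simp
  then have "(\<phi> has_real_derivative 0) (at x)"
    by (rule has_field_derivative_transform_within_open[where S="- {\<alpha>..\<beta>}"]) (use assms in auto)
  then show ?thesis by (rule DERIV_imp_deriv)
qed

text \<open>Fubini for p(s) times the derivative of \<phi> at t on the triangle s < t: integrating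
  in t first gives -p(s) \<phi>(s), integrating in s first gives the indefinite integral of
  \<open>p\<close>.\<close>

lemma integral_deriv_test_function:
  fixes p :: "real \<Rightarrow> real"
  assumes T: "0 < T" and p: "integrable (lebesgue_on {0<..<T}) p"
    and \<phi>: "\<phi> \<in> test_functions {0<..<T}"
  shows "integrable (lebesgue_on {0<..<T}) (\<lambda>t. deriv \<phi> t * integral {0..t} p)"
    and "(LINT t|lebesgue_on {0<..<T}. deriv \<phi> t * integral {0..t} p) = - (LINT t|lebesgue_on {0<..<T}. \<phi> t * p t)"
proof -
  have sm: "smooth \<phi>" using \<phi> by (simp add: test_functions_def)
  note D = real_smooth_DERIV(1)[OF sm] and sd = real_smooth_DERIV(2)[OF sm]
  obtain \<alpha> \<beta> where ab: "0 < \<alpha>" "\<alpha> < \<beta>" "\<beta> < T" and supp: "\<And>x. x \<notin> {\<alpha><..<\<beta>} \<Longrightarrow> \<phi> x = 0"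
    using test_functions_supp[OF \<phi> T] by metis
  have I: "{0<..<T} \<inter> space lebesgue \<in> sets lebesgue" by simp
  define p0 where "p0 x = indicator {0<..<T} x *\<^sub>R p x" for x
  have "integrable lebesgue p0" using p unfolding p0_def by (simp add: integrable_restrict_space[OF I])
  \<comment> \<open>A Borel version of the integrand gives joint measurability on the
    product.\<close>
  then obtain p1 where p1: "p1 \<in> borel_measurable borel" and pp: "AE x in lebesgue. p0 x = p1 x"
    using completion_ex_borel_measurable_real[of p0 lborel] AE_completion[of _ lborel] by auto
  have ip1: "integrable lborel p1"
  proof -
    have "integrable lebesgue p1"
      using \<open>integrable lebesgue p0\<close> pp p1
      by (subst integrable_cong_AE[where g=p0]) (auto simp: measurable_completion elim: eventually_mono)
    then show ?thesis using p1 by (simp add: integrable_completion)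
  qed
  have d0: "deriv \<phi> x = 0" if "x \<notin> {\<alpha>..\<beta>}" for x using supp that by (rule deriv_zero_outside)
  have [measurable]: "deriv \<phi> \<in> borel_measurable borel" "\<phi> \<in> borel_measurable borel"
    using smooth_continuous[OF sd] smooth_continuous[OF sm] by (auto intro: borel_measurable_continuous_onI)
  note p1[measurable]
  have id: "integrable lborel (deriv \<phi>)"
  proof -
    have "integrable lborel (\<lambda>x. indicator {\<alpha>..\<beta>} x *\<^sub>R deriv \<phi> x)"
      by (rule borel_integrable_compact) (auto intro: smooth_continuous sd)
    moreover have "(\<lambda>x. indicator {\<alpha>..\<beta>} x *\<^sub>R deriv \<phi> x) = deriv \<phi>" using d0 by (intro ext) (auto simp: indicator_def)
    ultimately show ?thesis by metis
  qed
  define f where "f s t = (if s < t then p1 s * deriv \<phi> t else 0)" for s t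
  have int: "integrable (lborel \<Otimes>\<^sub>M lborel) (\<lambda>(s, t). f s t)"
  proof -
    have "integrable (lborel \<Otimes>\<^sub>M lborel) (\<lambda>(s, t). p1 s * deriv \<phi> t)"
    proof (rule lborel_pair.Fubini_integrable)
      have "integrable lborel (\<lambda>s. norm (p1 s) * (LINT t|lborel. norm (deriv \<phi> t)))"
        using ip1 by simp
      then show "integrable lborel (\<lambda>s. LINT t|lborel. norm (case (s, t) of (s, t) \<Rightarrow> p1 s * deriv \<phi> t))"
        by (simp add: abs_mult)
      show "AE s in lborel. integrable lborel (\<lambda>t. case (s, t) of (s, t) \<Rightarrow> p1 s * deriv \<phi> t)"
        using id by simp
    qed measurable
    then show ?thesis
      by (rule Bochner_Integration.integrable_bound) (auto simp: f_def)
  qed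
  have "(LINT t|lborel. LINT s|lborel. f s t) = (LINT s|lborel. LINT t|lborel. f s t)"
    by (rule lborel_pair.Fubini_integral[OF int])
  moreover have ft: "(LINT t|lborel. f s t) = - (p1 s * \<phi> s)" for s
  proof -
    \<comment> \<open>A point beyond both \<open>s\<close> and the support, so that the upper
      boundary term vanishes.\<close>
    define m where "m = max s \<beta> + 1"
    have "(LINT t|lborel. f s t) = (LINT t|lborel. p1 s * (indicator {s..m} t *\<^sub>R deriv \<phi> t))"
    proof (rule integral_cong_AE)
      have "AE t in lborel. t \<noteq> s" by (rule AE_lborel_singleton)
      then show "AE t in lborel. f s t = p1 s * (indicator {s..m} t *\<^sub>R deriv \<phi> t)"
        by eventually_elim (auto simp: f_def indicator_def m_def intro: d0)
    qed (auto simp: f_def)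
    also have "\<dots> = p1 s * (LINT t|lborel. indicator {s..m} t *\<^sub>R deriv \<phi> t)"
      by (rule integral_mult_right_zero)
    also have "(LINT t|lborel. indicator {s..m} t *\<^sub>R deriv \<phi> t) = \<phi> m - \<phi> s"
      using D by (intro integral_FTC_atLeastAtMost smooth_continuous sd)
        (auto simp: m_def has_real_derivative_iff_has_vector_derivative intro: has_vector_derivative_at_within)
    also have "\<phi> m = 0" by (rule supp) (auto simp: m_def)
    finally show ?thesis by simp
  qed
  moreover have fs: "(LINT s|lborel. f s t) = indicator {0<..<T} t * (deriv \<phi> t * integral {0..t} p)" for t
  proof (cases "t \<in> {0<..<T}")
    case True
    have "(LINT s|lborel. f s t) = (LINT s|lborel. deriv \<phi> t * (if s < t then p1 s else 0))"
      by (intro Bochner_Integration.integral_cong) (auto simp: f_def)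
    also have "\<dots> = deriv \<phi> t * (LINT s|lborel. (if s < t then p1 s else 0))"
      by (rule integral_mult_right_zero)
    also have "(LINT s|lborel. (if s < t then p1 s else 0)) = (LINT s|lebesgue. (if s < t then p1 s else 0))"
      by (rule integral_completion[symmetric]) measurable
    also have "\<dots> = (LINT s|lebesgue. indicator {0<..<t} s *\<^sub>R p s)"
    proof (rule integral_cong_AE)
      show "AE s in lebesgue. (if s < t then p1 s else 0) = indicator {0<..<t} s *\<^sub>R p s"
        using pp by eventually_elim (use True in \<open>auto simp: p0_def indicator_def\<close>)
      show "(\<lambda>s. indicator {0<..<t} s *\<^sub>R p s) \<in> borel_measurable lebesgue"
        using open_interval_integrable[OF p, of 0 t] True integrable_restrict_space[of "{0<..<t}" lebesgue p] by auto
    qed (auto simp: measurable_completion)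
    also have "\<dots> = integral {0..t} p"
      using open_interval_LINT[OF p, of 0 t] True by (simp add: integral_restrict_space)
    finally show ?thesis using True by simp
  next
    case False
    then have "deriv \<phi> t = 0" using ab by (intro d0) auto
    then have "f s t = 0" for s by (simp add: f_def)
    with \<open>deriv \<phi> t = 0\<close> show ?thesis by simp
  qed
  ultimately have eq: "(LINT t|lborel. indicator {0<..<T} t * (deriv \<phi> t * integral {0..t} p)) = - (LINT s|lborel. p1 s * \<phi> s)"
    by simp
  have i1: "integrable lborel (\<lambda>t. indicator {0<..<T} t * (deriv \<phi> t * integral {0..t} p))"
    using lborel_pair.integrable_snd[OF int] by (simp add: fs)
  then have i2: "integrable lebesgue (\<lambda>t. indicator {0<..<T} t * (deriv \<phi> t * integral {0..t} p))"
    by (simp add: integrable_completion)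
  then show "integrable (lebesgue_on {0<..<T}) (\<lambda>t. deriv \<phi> t * integral {0..t} p)"
    by (simp add: integrable_restrict_space)
  have "(LINT t|lebesgue_on {0<..<T}. deriv \<phi> t * integral {0..t} p) = (LINT t|lebesgue. indicator {0<..<T} t * (deriv \<phi> t * integral {0..t} p))"
    by (simp add: integral_restrict_space)
  also have "\<dots> = - (LINT s|lborel. p1 s * \<phi> s)" using i1 by (simp add: integral_completion eq)
  also have "(LINT s|lborel. p1 s * \<phi> s) = (LINT s|lebesgue. p1 s * \<phi> s)"
    by (rule integral_completion[symmetric]) measurable
  also have "\<dots> = (LINT s|lebesgue. indicator {0<..<T} s *\<^sub>R (\<phi> s * p s))"
  proof (rule integral_cong_AE)
    show "AE s in lebesgue. p1 s * \<phi> s = indicator {0<..<T} s *\<^sub>R (\<phi> s * p s)"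
      using pp by eventually_elim (auto simp: p0_def indicator_def)
    have "(\<lambda>s. \<phi> s * p0 s) \<in> borel_measurable lebesgue"
      using \<open>integrable lebesgue p0\<close> by (intro borel_measurable_times) (auto simp: measurable_completion)
    then show "(\<lambda>s. indicator {0<..<T} s *\<^sub>R (\<phi> s * p s)) \<in> borel_measurable lebesgue"
      by (simp add: p0_def mult.left_commute)
  qed (auto simp: measurable_completion)
  also have "\<dots> = (LINT t|lebesgue_on {0<..<T}. \<phi> t * p t)"
    by (simp add: integral_restrict_space)
  finally show "(LINT t|lebesgue_on {0<..<T}. deriv \<phi> t * integral {0..t} p) = - (LINT t|lebesgue_on {0<..<T}. \<phi> t * p t)" .
qed

text \<open>The antiderivative that vanishes at \<alpha> is constant to the right of \<beta>, and
  mean zero says that this constant is 0.\<close>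

lemma test_function_antiderivative:
  fixes \<omega> :: "real \<Rightarrow> real"
  assumes \<omega>: "\<omega> \<in> test_functions {0<..<T}" and T: "0 < T"
    and zero: "(LINT t|lebesgue_on {0<..<T}. \<omega> t) = 0"
  obtains \<phi> where "\<phi> \<in> test_functions {0<..<T}" "deriv \<phi> = \<omega>"
proof -
  have sm: "smooth \<omega>" using \<omega> by (simp add: test_functions_def)
  have cont: "continuous_on S \<omega>" for S by (rule smooth_continuous[OF sm])
  obtain \<alpha> \<beta> where ab: "0 < \<alpha>" "\<alpha> < \<beta>" "\<beta> < T" and supp: "\<And>x. x \<notin> {\<alpha><..<\<beta>} \<Longrightarrow> \<omega> x = 0"
    using test_functions_supp[OF \<omega> T] by metis
  have "isCont \<omega> x" for x using cont[of UNIV] by (simp add: continuous_on_eq_continuous_at)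
  then obtain F where F: "\<And>x. (F has_vector_derivative \<omega> x) (at x)"
    using einterval_antiderivative[of "-\<infinity>" "\<infinity>" \<omega>] by auto
  have FTC: "integral {a..b} \<omega> = F b - F a" if "a \<le> b" for a b
    by (rule integral_unique, rule fundamental_theorem_of_calculus[OF that])
       (rule has_vector_derivative_at_within[OF F])
  have z: "integral {a..b} \<omega> = 0" if "\<And>x. x \<in> {a..b} \<Longrightarrow> \<omega> x = 0" for a b
    using integral_cong[of "{a..b}" \<omega> "\<lambda>x. 0"] that by simp
  define \<phi> where "\<phi> t = F t - F \<alpha>" for t
  have D: "(\<phi> has_real_derivative \<omega> t) (at t)" for t
    using has_vector_derivative_diff[OF F[of t] has_vector_derivative_const[of "F \<alpha>"]]
    unfolding \<phi>_def by (simp add: has_real_derivative_iff_has_vector_derivative)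
  have "0 = integral {0..T} \<omega>"
  proof -
    have "integrable (lebesgue_on {0<..<T}) \<omega>"
    proof -
      interpret bounded_open_set "{0<..<T}" by unfold_locales auto
      show ?thesis
        using L2_has_integrable_norm(1)[OF smooth_imp_L2[OF sm] lmeasurable_domain] L2_measurable[OF smooth_imp_L2[OF sm]]
        by (simp add: integrable_abs_iff)
    qed
    from open_interval_LINT[OF this, of 0 T] zero show ?thesis by simp
  qed
  also have "\<dots> = integral {0..\<alpha>} \<omega> + (integral {\<alpha>..\<beta>} \<omega> + integral {\<beta>..T} \<omega>)"
    using ab FTC by simp
  also have "integral {0..\<alpha>} \<omega> = 0" by (rule z) (simp add: supp)
  also have "integral {\<beta>..T} \<omega> = 0" by (rule z) (simp add: supp)
  finally have mid: "F \<beta> = F \<alpha>" using ab FTC[of \<alpha> \<beta>] by simp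
  have "\<phi> x = 0" if "x \<notin> {\<alpha><..<\<beta>}" for x
  proof (cases "x \<le> \<alpha>")
    case True
    have "integral {x..\<alpha>} \<omega> = 0" by (rule z) (simp add: supp)
    then show ?thesis using FTC[OF True] by (simp add: \<phi>_def)
  next
    case False
    then have b: "\<beta> \<le> x" using that by auto
    have "integral {\<beta>..x} \<omega> = 0" by (rule z) (simp add: supp)
    then show ?thesis using FTC[OF b] mid by (simp add: \<phi>_def)
  qed
  then have "\<phi> \<in> test_functions {0<..<T}"
    using ab by (intro test_functionsI_real[OF real_smooth_antiderivative[OF D sm]]) auto
  moreover have "deriv \<phi> = \<omega>" using DERIV_imp_deriv[OF D] by blast
  ultimately show thesis by (rule that)
qed

lemma test_functions_lincomb:
  assumes "\<phi> \<in> test_functions {0<..<T}" "\<psi> \<in> test_functions {0<..<T::real}"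
  shows "(\<lambda>x. a * \<phi> x + b * \<psi> x) \<in> test_functions {0<..<T}"
proof (rule test_functions_subset_support[where K="closure {x. \<phi> x \<noteq> 0} \<union> closure {x. \<psi> x \<noteq> 0}"])
  show "{x. a * \<phi> x + b * \<psi> x \<noteq> 0} \<subseteq> closure {x. \<phi> x \<noteq> 0} \<union> closure {x. \<psi> x \<noteq> 0}"
  proof
    fix x assume "x \<in> {x. a * \<phi> x + b * \<psi> x \<noteq> 0}"
    then have "x \<in> {x. \<phi> x \<noteq> 0} \<or> x \<in> {x. \<psi> x \<noteq> 0}" by auto
    then show "x \<in> closure {x. \<phi> x \<noteq> 0} \<union> closure {x. \<psi> x \<noteq> 0}"
      using closure_subset[of "{x. \<phi> x \<noteq> 0}"] closure_subset[of "{x. \<psi> x \<noteq> 0}"] by blast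
  qed
qed (use assms in \<open>auto simp: test_functions_def intro: smooth_lincomb\<close>)

lemma smooth_ident: "smooth (\<lambda>x::real. x)"
  by (rule real_smooth_antiderivative[where \<omega>="\<lambda>x. 1"]) (auto intro: smooth_const)

text \<open>For a test function \<open>\<theta>\<close> of mass one, a test function minus its mass
  times \<open>\<theta>\<close> has mean zero and is therefore a derivative. Inserting it shows that
  all test functions annihilate \<open>u - c\<close>, where \<open>c\<close> is the integral of
  \<open>u\<close> against \<open>\<theta>\<close>.\<close>

lemma ex_const_if_weak_derivative_zero:
  fixes u :: "real \<Rightarrow> real"
  assumes T: "0 < T"
    and u: "\<And>\<phi>. \<phi> \<in> test_functions {0<..<T} \<Longrightarrow> integrable (lebesgue_on {0<..<T}) (\<lambda>t. u t * \<phi> t)"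
    and d: "\<And>\<phi>. \<phi> \<in> test_functions {0<..<T} \<Longrightarrow> (LINT t|lebesgue_on {0<..<T}. u t * deriv \<phi> t) = 0"
  shows "\<exists>c. AE t in lebesgue_on {0<..<T}. u t = c"
proof -
  interpret bounded_open_set "{0<..<T}" by unfold_locales auto
  let ?M = "lebesgue_on {0<..<T}"
  have int: "integrable ?M \<phi>" if "smooth \<phi>" for \<phi>
    using L2_has_integrable_norm(1)[OF smooth_imp_L2[OF that] lmeasurable_domain] L2_measurable[OF smooth_imp_L2[OF that]]
    by (simp add: integrable_abs_iff)
  let ?b = "bump (T / 4) (3 * T / 4) 1 :: real \<Rightarrow> real"
  have b: "?b \<in> test_functions {0<..<T}"
    using test_functions_bump[of 1 "T / 4" "3 * T / 4" "{0<..<T}", OF _ _ smooth_const[of 1]] T by (simp add: subset_eq)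
  define J where "J = (LINT t|?M. ?b t)"
  have "J \<noteq> 0"
  proof
    assume "J = 0"
    then have "AE t in ?M. ?b t = 0"
      unfolding J_def by (subst (asm) integral_nonneg_eq_0_iff_AE[OF int[OF smooth_bump]]) (simp_all add: bump_bounds)
    then have "AE t in lebesgue. t \<in> {0<..<T} \<longrightarrow> ?b t = 0" by (simp add: AE_restrict_space_iff)
    then have "AE t in lebesgue. t \<notin> {T / 4<..<3 * T / 4}"
    proof eventually_elim
      case (elim t)
      then show ?case using bump_pos_iff[of 1 "T / 4" "3 * T / 4" t] T by (auto simp: box_real)
    qed
    then have "{T / 4<..<3 * T / 4} \<in> null_sets lebesgue"
      by (subst (asm) AE_iff_null_sets[symmetric]) auto
    then show False using T by (simp add: null_sets_def)
  qed
  define \<theta> where "\<theta> t = ?b t / J" for t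
  have \<theta>: "\<theta> \<in> test_functions {0<..<T}"
    using test_functions_lincomb[OF b b, of "1 / J" 0] by (simp add: \<theta>_def[abs_def])
  have sm: "smooth \<phi>" if "\<phi> \<in> test_functions {0<..<T}" for \<phi> using that by (simp add: test_functions_def)
  have \<theta>1: "(LINT t|?M. \<theta> t) = 1" using \<open>J \<noteq> 0\<close> by (simp add: \<theta>_def J_def[symmetric])
  define c where "c = (LINT t|?M. u t * \<theta> t)"
  have "AE t in ?M. u t - c = 0"
  proof (rule fundamental_lemma)
    fix \<psi> assume \<psi>: "\<psi> \<in> test_functions {0<..<T}"
    define m where "m = (LINT t|?M. \<psi> t)"
    have i: "integrable ?M (\<lambda>t. c * \<psi> t)" using int[OF sm[OF \<psi>]] by simp
    show "integrable ?M (\<lambda>t. (u t - c) * \<psi> t)"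
      using Bochner_Integration.integrable_diff[OF u[OF \<psi>] i] by (simp add: left_diff_distrib)
    define \<omega> where "\<omega> t = 1 * \<psi> t + (- m) * \<theta> t" for t
    have \<omega>: "\<omega> \<in> test_functions {0<..<T}" unfolding \<omega>_def by (rule test_functions_lincomb[OF \<psi> \<theta>])
    have "(LINT t|?M. \<omega> t) = m - m * 1"
      unfolding \<omega>_def using int[OF sm[OF \<psi>]] int[OF sm[OF \<theta>]] \<theta>1 by (simp add: m_def)
    then obtain \<phi> where \<phi>: "\<phi> \<in> test_functions {0<..<T}" "deriv \<phi> = \<omega>"
      using test_function_antiderivative[OF \<omega> T] by auto
    have "0 = (LINT t|?M. u t * \<omega> t)" using d[OF \<phi>(1)] \<phi>(2) by simp
    also have "\<dots> = (LINT t|?M. u t * \<psi> t - m * (u t * \<theta> t))"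
      by (intro Bochner_Integration.integral_cong) (auto simp: \<omega>_def algebra_simps)
    also have "\<dots> = (LINT t|?M. u t * \<psi> t) - m * c"
      using u[OF \<psi>] u[OF \<theta>] by (simp add: c_def)
    finally show "(LINT t|?M. (u t - c) * \<psi> t) = 0"
      using u[OF \<psi>] i by (simp add: left_diff_distrib m_def[symmetric])
  qed simp
  then show ?thesis by auto
qed

text \<open>By Fubini the indefinite integral of \<open>p\<close> has the same weak derivative as
  \<open>q\<close>, so the two differ by a constant.\<close>

lemma du_bois_reymond:
  fixes p q :: "real \<Rightarrow> real"
  assumes T: "0 < T" and p: "integrable (lebesgue_on {0<..<T}) p"
    and d: "\<And>\<phi>. \<phi> \<in> test_functions {0<..<T} \<Longrightarrow> has_bochner_integral (lebesgue_on {0<..<T})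
      (\<lambda>t. deriv \<phi> t * q t) (- (LINT t|lebesgue_on {0<..<T}. \<phi> t * p t))"
  shows "\<exists>c. AE t in lebesgue_on {0<..<T}. q t = c + integral {0..t} p"
proof -
  let ?M = "lebesgue_on {0<..<T}"
  let ?P = "\<lambda>t. integral {0..t} p"
  have qint: "integrable ?M (\<lambda>t. q t * \<phi> t)" if \<phi>: "\<phi> \<in> test_functions {0<..<T}" for \<phi>
  proof -
    have sm: "smooth \<phi>" using \<phi> by (simp add: test_functions_def)
    obtain \<alpha> \<beta> where ab: "0 < \<alpha>" "\<alpha> < \<beta>" "\<beta> < T" and supp: "\<And>x. x \<notin> {\<alpha><..<\<beta>} \<Longrightarrow> \<phi> x = 0"
      using test_functions_supp[OF \<phi> T] by metis
    \<comment> \<open>The hypothesis controls products of \<open>q\<close> with derivatives only.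
      But \<phi> is the derivative of t \<phi>(t) minus t times the derivative of \<phi>, and t is
      bounded by \<open>T\<close>, so products with \<phi> are integrable too.\<close>
    let ?\<psi> = "\<lambda>t. t * \<phi> t"
    have \<psi>: "?\<psi> \<in> test_functions {0<..<T}"
      using ab supp by (intro test_functionsI_real[OF smooth_mult[OF smooth_ident sm]]) auto
    have "(?\<psi> has_real_derivative \<phi> t + t * deriv \<phi> t) (at t)" for t
      by (auto intro!: derivative_eq_intros real_smooth_DERIV(1)[OF sm])
    then have d\<psi>: "deriv ?\<psi> t = \<phi> t + t * deriv \<phi> t" for t by (rule DERIV_imp_deriv)
    have i1: "integrable ?M (\<lambda>t. deriv ?\<psi> t * q t)" and i2: "integrable ?M (\<lambda>t. deriv \<phi> t * q t)"
      using d[OF \<psi>] d[OF \<phi>] by (auto simp: has_bochner_integral_iff)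
    have "integrable ?M (\<lambda>t. T * (deriv \<phi> t * q t))" using i2 by simp
    then have "integrable ?M (\<lambda>t. t * (deriv \<phi> t * q t))"
    proof (rule Bochner_Integration.integrable_bound)
      have "(\<lambda>t. t) \<in> borel_measurable ?M" by (simp add: measurable_restrict_space1 measurable_completion)
      then show "(\<lambda>t. t * (deriv \<phi> t * q t)) \<in> borel_measurable ?M" by (rule borel_measurable_times[OF _ borel_measurable_integrable[OF i2]])
      show "AE t in ?M. norm (t * (deriv \<phi> t * q t)) \<le> norm (T * (deriv \<phi> t * q t))"
        using T by (intro AE_I2) (auto simp: abs_mult intro!: mult_right_mono)
    qed
    from Bochner_Integration.integrable_diff[OF i1 this] show ?thesis
      unfolding d\<psi> by (simp add: algebra_simps)
  qed
  have Pint: "integrable ?M (\<lambda>t. ?P t * \<phi> t)" if \<phi>: "\<phi> \<in> test_functions {0<..<T}" for \<phi>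
  proof -
    interpret bounded_open_set "{0<..<T}" by unfold_locales auto
    have c: "continuous_on {0..T} ?P"
      using open_interval_integrable_on[OF p] T by (intro indefinite_integral_continuous_1) auto
    then have c': "continuous_on {0<..<T} ?P" by (rule continuous_on_subset) auto
    have m: "?P \<in> borel_measurable ?M"
      by (rule continuous_imp_measurable_on_sets_lebesgue[OF c']) simp
    obtain B where B: "\<And>t. t \<in> {0..T} \<Longrightarrow> \<bar>?P t\<bar> \<le> B"
    proof -
      have "bounded (?P ` {0..T})" by (intro compact_imp_bounded compact_continuous_image[OF c]) simp
      then obtain B where "\<forall>x\<in>?P ` {0..T}. norm x \<le> B" unfolding bounded_iff by blast
      then show thesis using that[of B] by simp
    qed
    have "?P \<in> L2 {0<..<T}"
    proof -
      have "integrable ?M (\<lambda>t. (norm (?P t))\<^sup>2)"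
      proof (rule finite_measure.integrable_const_bound[where B="B\<^sup>2"])
        show "finite_measure ?M" by (rule finite_measure_lebesgue_on[OF lmeasurable_domain])
        show "AE t in ?M. norm ((norm (?P t))\<^sup>2) \<le> B\<^sup>2"
        proof (rule AE_I2)
          fix t assume "t \<in> space ?M"
          then have "\<bar>?P t\<bar> \<le> B" using B by simp
          then show "norm ((norm (?P t))\<^sup>2) \<le> B\<^sup>2" using power_mono[of "\<bar>?P t\<bar>" B 2] by simp
        qed
      qed (use m in measurable)
      then show ?thesis using m by (simp add: L2_def)
    qed
    from L2_integrable_inner[OF this smooth_imp_L2[of \<phi>]] show ?thesis using \<phi> by (simp add: test_functions_def)
  qed
  have "\<exists>c. AE t in ?M. q t - ?P t = c"
  proof (rule ex_const_if_weak_derivative_zero[OF T])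
    fix \<phi> assume \<phi>: "\<phi> \<in> test_functions {0<..<T}"
    show "integrable ?M (\<lambda>t. (q t - ?P t) * \<phi> t)"
      using Bochner_Integration.integrable_diff[OF qint[OF \<phi>] Pint[OF \<phi>]] by (simp add: left_diff_distrib)
    have "(LINT t|?M. deriv \<phi> t * q t - deriv \<phi> t * ?P t) = 0"
      using d[OF \<phi>] integral_deriv_test_function[OF T p \<phi>] by (simp add: has_bochner_integral_iff)
    then show "(LINT t|?M. (q t - ?P t) * deriv \<phi> t) = 0"
      by (simp add: algebra_simps)
  qed
  then obtain c where "AE t in ?M. q t - ?P t = c" by blast
  then show ?thesis by (intro exI[of _ c]) (auto elim: eventually_mono)
qed

section \<open>Translations and difference quotients in time\<close>

lemma nn_integral_translate:
  fixes f :: "real \<Rightarrow> ennreal"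
  assumes "f \<in> borel_measurable borel"
  shows "(\<integral>\<^sup>+t. f (t + \<sigma>) \<partial>lborel) = (\<integral>\<^sup>+t. f t \<partial>lborel)"
  using nn_integral_real_affine[OF assms, of 1 \<sigma>] by (simp add: add.commute)

lemma integral_translate:
  fixes f :: "real \<Rightarrow> real"
  shows "(LINT t|lborel. f (t + \<sigma>)) = (LINT t|lborel. f t)"
  using lborel_integral_real_affine[of 1 f \<sigma>] by (simp add: add.commute)

lemma bounded_if_zero_outside:
  fixes f :: "real \<Rightarrow> real"
  assumes "continuous_on UNIV f" "\<And>x. x \<notin> {\<alpha>..\<beta>} \<Longrightarrow> f x = 0"
  obtains B where "0 < B" "\<And>x. \<bar>f x\<bar> \<le> B"
proof -
  have "bounded (f ` {\<alpha>..\<beta>})"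
    using assms(1) by (intro compact_imp_bounded compact_continuous_image) (auto intro: continuous_on_subset)
  then obtain b where b: "\<forall>x\<in>f ` {\<alpha>..\<beta>}. norm x \<le> b" unfolding bounded_iff by blast
  have "\<bar>f x\<bar> \<le> \<bar>b\<bar> + 1" for x
  proof (cases "x \<in> {\<alpha>..\<beta>}")
    case True
    then have "norm (f x) \<le> b" using b by blast
    then show ?thesis by simp
  qed (simp add: assms(2))
  then show thesis by (intro that[of "\<bar>b\<bar> + 1"]) auto
qed

text \<open>Discrete integration by parts: translation invariance moves the difference quotient from
  \<open>R\<close> to \<phi>, where it converges and is bounded by the supremum of the
  derivative.\<close>

lemma integral_increment_test_function:
  fixes R :: "real \<Rightarrow> real"
  assumes T: "0 < T" and R: "integrable lborel R" and \<phi>: "\<phi> \<in> test_functions {0<..<T}"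
  shows "(\<lambda>n. LINT t|lborel. (R t - R (t + 1 / Suc n)) * \<phi> t * Suc n) \<longlonglongrightarrow> (LINT t|lborel. R t * deriv \<phi> t)"
proof -
  have sm: "smooth \<phi>" using \<phi> by (simp add: test_functions_def)
  note D = real_smooth_DERIV(1)[OF sm] and sd = real_smooth_DERIV(2)[OF sm]
  obtain \<alpha> \<beta> where ab: "0 < \<alpha>" "\<alpha> < \<beta>" "\<beta> < T" and supp: "\<And>x. x \<notin> {\<alpha><..<\<beta>} \<Longrightarrow> \<phi> x = 0"
    using test_functions_supp[OF \<phi> T] by metis
  have d0: "deriv \<phi> x = 0" if "x \<notin> {\<alpha>..\<beta>}" for x using supp that by (rule deriv_zero_outside)
  obtain B where B: "\<And>x. \<bar>\<phi> x\<bar> \<le> B"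
  proof (rule bounded_if_zero_outside[OF smooth_continuous[OF sm]])
    show "\<phi> x = 0" if "x \<notin> {\<alpha>..\<beta>}" for x using that by (intro supp) auto
  qed blast
  obtain B' where B': "\<And>x. \<bar>deriv \<phi> x\<bar> \<le> B'"
    using bounded_if_zero_outside[OF smooth_continuous[OF sd] d0] by blast
  note [measurable] = borel_measurable_integrable[OF R]
  have [measurable]: "deriv \<phi> \<in> borel_measurable borel" "\<phi> \<in> borel_measurable borel"
    using smooth_continuous[OF sd] smooth_continuous[OF sm] by (auto intro: borel_measurable_continuous_onI)
  have Rsh: "integrable lborel (\<lambda>t. R (t + \<sigma>))" for \<sigma>
    using lborel_integrable_real_affine[OF R, of 1 \<sigma>] by (simp add: add.commute)
  have R\<phi>: "integrable lborel (\<lambda>t. R (t + \<sigma>) * \<phi> (t + \<tau>))" for \<sigma> \<tau>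
  proof (rule Bochner_Integration.integrable_bound)
    show "integrable lborel (\<lambda>t. B * R (t + \<sigma>))" using Rsh by simp
    show "AE t in lborel. norm (R (t + \<sigma>) * \<phi> (t + \<tau>)) \<le> norm (B * R (t + \<sigma>))"
    proof (rule AE_I2)
      fix t
      have "\<bar>\<phi> (t + \<tau>)\<bar> \<le> \<bar>B\<bar>" using B[of "t + \<tau>"] by linarith
      then have "\<bar>\<phi> (t + \<tau>)\<bar> * \<bar>R (t + \<sigma>)\<bar> \<le> \<bar>B\<bar> * \<bar>R (t + \<sigma>)\<bar>" by (rule mult_right_mono) simp
      then show "norm (R (t + \<sigma>) * \<phi> (t + \<tau>)) \<le> norm (B * R (t + \<sigma>))" by (simp add: abs_mult mult.commute)
    qed
  qed measurable
  have "(LINT t|lborel. (R t - R (t + 1 / Suc n)) * \<phi> t * Suc n) =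
      (LINT t|lborel. R t * ((\<phi> t - \<phi> (t - 1 / Suc n)) * Suc n))" for n
  proof -
    let ?h = "1 / real (Suc n)"
    have "(LINT t|lborel. R (t + ?h) * \<phi> t) = (LINT t|lborel. R t * \<phi> (t - ?h))"
      using integral_translate[of "\<lambda>t. R t * \<phi> (t - ?h)" ?h] by simp
    moreover have "(LINT t|lborel. (R t - R (t + ?h)) * \<phi> t * Suc n) =
        ((LINT t|lborel. R t * \<phi> t) - (LINT t|lborel. R (t + ?h) * \<phi> t)) * Suc n"
      using R\<phi>[of 0 0] R\<phi>[of ?h 0] by (simp add: left_diff_distrib)
    moreover have "(LINT t|lborel. R t * ((\<phi> t - \<phi> (t - ?h)) * Suc n)) =
        ((LINT t|lborel. R t * \<phi> t) - (LINT t|lborel. R t * \<phi> (t - ?h))) * Suc n"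
      using R\<phi>[of 0 0] R\<phi>[of 0 "- ?h"] by (simp add: right_diff_distrib flip: mult.assoc)
    ultimately show ?thesis by simp
  qed
  moreover have "(\<lambda>n. LINT t|lborel. R t * ((\<phi> t - \<phi> (t - 1 / Suc n)) * Suc n)) \<longlonglongrightarrow> (LINT t|lborel. R t * deriv \<phi> t)"
  proof (rule integral_dominated_convergence[where w="\<lambda>t. B' * norm (R t)"])
    show "integrable lborel (\<lambda>t. B' * norm (R t))" using R by simp
    show "AE t in lborel. (\<lambda>n. R t * ((\<phi> t - \<phi> (t - 1 / Suc n)) * Suc n)) \<longlonglongrightarrow> R t * deriv \<phi> t"
    proof (intro AE_I2 tendsto_mult tendsto_const)
      fix t
      have "(\<lambda>n. - (1 / real (Suc n))) \<longlonglongrightarrow> - 0" by (intro tendsto_minus LIMSEQ_Suc[OF lim_1_over_n])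
      then have "filterlim (\<lambda>n. - (1 / real (Suc n))) (at 0) sequentially"
        by (simp add: filterlim_at)
      from filterlim_compose[OF D[of t, unfolded DERIV_def] this]
      show "(\<lambda>n. (\<phi> t - \<phi> (t - 1 / Suc n)) * Suc n) \<longlonglongrightarrow> deriv \<phi> t"
        by (simp add: field_simps)
    qed
    show "AE t in lborel. norm (R t * ((\<phi> t - \<phi> (t - 1 / Suc n)) * Suc n)) \<le> B' * norm (R t)" for n
    proof (rule AE_I2)
      fix t
      have "norm (\<phi> t - \<phi> (t - 1 / Suc n)) \<le> B' * norm (t - (t - 1 / Suc n))"
        using D B' by (intro field_differentiable_bound[of UNIV]) (auto intro: has_field_derivative_at_within)
      then have "\<bar>\<phi> t - \<phi> (t - 1 / Suc n)\<bar> \<le> B' / Suc n" by simp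
      then have "\<bar>(\<phi> t - \<phi> (t - 1 / Suc n)) * Suc n\<bar> \<le> B'"
        by (simp add: abs_mult pos_le_divide_eq del: of_nat_Suc)
      then show "norm (R t * ((\<phi> t - \<phi> (t - 1 / Suc n)) * Suc n)) \<le> B' * norm (R t)"
        by (simp only: norm_mult real_norm_def abs_mult mult.commute[of B'])
           (intro mult_left_mono; simp add: abs_mult)
    qed
  qed measurable
  ultimately show ?thesis by simp
qed

text \<open>Young's inequality with weight, applied to a b and a c separately; each uses half of the
  factor of a squared.\<close>

lemma ennreal_young:
  assumes "0 \<le> a" "0 \<le> b" "0 \<le> c" "0 < e"
  shows "ennreal (a * (b + c)) \<le> ennreal e * ennreal (a\<^sup>2) + (ennreal (1 / (2 * e)) * ennreal (b\<^sup>2) + ennreal (1 / (2 * e)) * ennreal (c\<^sup>2))"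
proof -
  have y: "a * x \<le> e / 2 * a\<^sup>2 + 1 / (2 * e) * x\<^sup>2" for x
  proof -
    have "0 \<le> (e * a - x)\<^sup>2 / (2 * e)" using assms by simp
    also have "\<dots> = e / 2 * a\<^sup>2 + 1 / (2 * e) * x\<^sup>2 - a * x"
      using assms by (simp add: power2_eq_square field_simps)
    finally show ?thesis by simp
  qed
  have "a * (b + c) \<le> e * a\<^sup>2 + (1 / (2 * e) * b\<^sup>2 + 1 / (2 * e) * c\<^sup>2)"
    using y[of b] y[of c] by (simp add: algebra_simps)
  then have "ennreal (a * (b + c)) \<le> ennreal (e * a\<^sup>2 + (1 / (2 * e) * b\<^sup>2 + 1 / (2 * e) * c\<^sup>2))"
    by (rule ennreal_leI)
  also have "\<dots> = ennreal (e * a\<^sup>2) + (ennreal (1 / (2 * e) * b\<^sup>2) + ennreal (1 / (2 * e) * c\<^sup>2))"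
    using assms by (subst ennreal_plus; (subst ennreal_plus)?) (auto simp del: ennreal_plus)
  also have "\<dots> = ennreal e * ennreal (a\<^sup>2) + (ennreal (1 / (2 * e)) * ennreal (b\<^sup>2) + ennreal (1 / (2 * e)) * ennreal (c\<^sup>2))"
    using assms by (simp only: ennreal_mult zero_le_power2 divide_nonneg_pos mult_pos_pos zero_le_one less_imp_le zero_less_numeral)
  finally show ?thesis .
qed

text \<open>
  The increments of \<open>R\<close> over time steps \<open>h\<close> are of order \<open>o(h)\<close> on average, so that
  \<open>R\<close> has weak derivative \<open>0\<close>.
\<close>

lemma ex_const_if_increment_bound:
  fixes R g :: "real \<Rightarrow> real" and D :: "real \<Rightarrow> real \<Rightarrow> real"
  assumes T: "0 < T" and R: "integrable lborel R"
    and [measurable]: "G \<in> sets borel" and G: "AE t in lborel. t \<in> {0<..<T} \<longrightarrow> t \<in> G"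
    and g[measurable]: "g \<in> borel_measurable borel" and g0: "\<And>t. 0 \<le> g t"
    and g2: "(\<integral>\<^sup>+t. ennreal ((g t)\<^sup>2) \<partial>lborel) < \<infinity>"
    and D[measurable]: "case_prod D \<in> borel_measurable (borel \<Otimes>\<^sub>M borel)" and D0: "\<And>s t. 0 \<le> D s t"
    and Dsym: "\<And>s t. D s t = D t s"
    and Dtrans: "\<And>\<eta>. 0 < \<eta> \<Longrightarrow> \<exists>\<delta>>0. \<forall>\<sigma>. 0 \<le> \<sigma> \<and> \<sigma> < \<delta> \<longrightarrow> (\<integral>\<^sup>+t. ennreal ((D t (t + \<sigma>))\<^sup>2) \<partial>lborel) \<le> ennreal \<eta>"
    and est: "\<And>s t. s \<in> G \<Longrightarrow> t \<in> G \<Longrightarrow> s < t \<Longrightarrow>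
      ennreal \<bar>R t - R s\<bar> \<le> (\<integral>\<^sup>+r. indicator {s..t} r * ennreal (g r * (D s r + D t r)) \<partial>lborel)"
  shows "\<exists>c. AE t in lebesgue_on {0<..<T}. R t = c"
proof (rule ex_const_if_weak_derivative_zero[OF T])
  note [measurable] = borel_measurable_integrable[OF R]
  have Dm[measurable]: "(\<lambda>x. D (p x) (q x)) \<in> borel_measurable M"
    if "p \<in> borel_measurable M" "q \<in> borel_measurable M" for M :: "'c measure" and p q
    using measurable_compose[OF measurable_Pair[OF that] D] by simp
  have small: "\<exists>\<delta>>0. \<forall>h. 0 < h \<and> h < \<delta> \<longrightarrow>
      (\<integral>\<^sup>+t. indicator {\<alpha><..<\<beta>} t * ennreal \<bar>R (t + h) - R t\<bar> \<partial>lborel) \<le> ennreal (h * \<eta>)"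
    if \<eta>: "0 < \<eta>" and ab: "0 < \<alpha>" "\<beta> < T" for \<eta> \<alpha> \<beta>
  proof -
    obtain A where A: "(\<integral>\<^sup>+t. ennreal ((g t)\<^sup>2) \<partial>lborel) = ennreal A" "0 \<le> A"
      using g2 by (cases "(\<integral>\<^sup>+t. ennreal ((g t)\<^sup>2) \<partial>lborel)") auto
    \<comment> \<open>Budget for Young's inequality: the \<open>g\<close> term costs at most
      \<open>\<eta> / 2\<close>, and each of the two \<open>D\<close> terms, bounded by
      \<open>e * \<eta> / 2\<close> and divided by \<open>2 * e\<close>, costs
      \<open>\<eta> / 4\<close>.\<close>
    define e where "e = \<eta> / 2 / (A + 1)"
    have e: "0 < e" using \<eta> A(2) by (simp add: e_def)
    obtain \<delta> where \<delta>: "0 < \<delta>" "\<And>\<sigma>. 0 \<le> \<sigma> \<Longrightarrow> \<sigma> < \<delta> \<Longrightarrow> (\<integral>\<^sup>+t. ennreal ((D t (t + \<sigma>))\<^sup>2) \<partial>lborel) \<le> ennreal (e * \<eta> / 2)"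
      using Dtrans[of "e * \<eta> / 2"] e \<eta> by auto
    show ?thesis
    proof (intro exI[of _ "min \<delta> (T - \<beta>)"] conjI allI impI)
      show "0 < min \<delta> (T - \<beta>)" using \<delta>(1) ab by simp
      fix h assume h: "0 < h \<and> h < min \<delta> (T - \<beta>)"
      let ?J = "\<lambda>t r. indicator {t..t + h} r * ennreal (g r * (D t r + D (t + h) r))"
      let ?K = "\<lambda>t \<sigma>. indicator {0..h} \<sigma> * ennreal (g (t + \<sigma>) * (D t (t + \<sigma>) + D (t + h) (t + \<sigma>)))"
      have "(\<integral>\<^sup>+t. indicator {\<alpha><..<\<beta>} t * ennreal \<bar>R (t + h) - R t\<bar> \<partial>lborel) \<le> (\<integral>\<^sup>+t. \<integral>\<^sup>+r. ?J t r \<partial>lborel \<partial>lborel)"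
      proof (rule nn_integral_mono_AE)
        \<comment> \<open>The estimate holds at pairs of good times. The shifted good set has full
          measure as well, and h < T - \<beta> keeps t + h inside the interval.\<close>
        have "AE t in lborel. t + h \<in> {0<..<T} \<longrightarrow> t + h \<in> G"
          using AE_borel_affine[of 1 "\<lambda>t. t \<in> {0<..<T} \<longrightarrow> t \<in> G" h] G by (simp add: add.commute)
        with G show "AE t in lborel. indicator {\<alpha><..<\<beta>} t * ennreal \<bar>R (t + h) - R t\<bar> \<le> (\<integral>\<^sup>+r. ?J t r \<partial>lborel)"
        proof eventually_elim
          case (elim t)
          show ?case
          proof (cases "t \<in> {\<alpha><..<\<beta>}")
            case True
            then have "t \<in> G" "t + h \<in> G" using elim ab h by auto
            moreover have "indicator {\<alpha><..<\<beta>} t = (1::ennreal)" using True by (rule indicator_simps)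
            ultimately show ?thesis using est[of t "t + h"] h by simp
          qed simp
        qed
      qed
      \<comment> \<open>With r = t + \<sigma> and the integral over t taken first, the only lags
        left are \<sigma> and h - \<sigma>, both below \<delta>; the integral over \<sigma> then
        supplies the factor h.\<close>
      also have "\<dots> = (\<integral>\<^sup>+t. \<integral>\<^sup>+\<sigma>. ?K t \<sigma> \<partial>lborel \<partial>lborel)"
      proof (rule nn_integral_cong)
        fix t
        show "(\<integral>\<^sup>+r. ?J t r \<partial>lborel) = (\<integral>\<^sup>+\<sigma>. ?K t \<sigma> \<partial>lborel)"
          using nn_integral_translate[of "?J t" t] by (simp add: add.commute indicator_def)
      qed
      also have "\<dots> = (\<integral>\<^sup>+\<sigma>. \<integral>\<^sup>+t. ?K t \<sigma> \<partial>lborel \<partial>lborel)"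
        by (rule lborel_pair.Fubini') measurable
      also have "\<dots> \<le> (\<integral>\<^sup>+\<sigma>. indicator {0..h} \<sigma> * ennreal \<eta> \<partial>lborel)"
      proof (rule nn_integral_mono)
        fix \<sigma> :: real
        show "(\<integral>\<^sup>+t. ?K t \<sigma> \<partial>lborel) \<le> indicator {0..h} \<sigma> * ennreal \<eta>"
        proof (cases "\<sigma> \<in> {0..h}")
          case True
          have "(\<integral>\<^sup>+t. ?K t \<sigma> \<partial>lborel) \<le> (\<integral>\<^sup>+t. ennreal e * ennreal ((g (t + \<sigma>))\<^sup>2) +
              (ennreal (1 / (2 * e)) * ennreal ((D t (t + \<sigma>))\<^sup>2) + ennreal (1 / (2 * e)) * ennreal ((D (t + h) (t + \<sigma>))\<^sup>2)) \<partial>lborel)"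
            using True by (intro nn_integral_mono) (simp add: ennreal_young g0 D0 e)
          also have "\<dots> = ennreal e * (\<integral>\<^sup>+t. ennreal ((g (t + \<sigma>))\<^sup>2) \<partial>lborel) +
              (ennreal (1 / (2 * e)) * (\<integral>\<^sup>+t. ennreal ((D t (t + \<sigma>))\<^sup>2) \<partial>lborel) +
               ennreal (1 / (2 * e)) * (\<integral>\<^sup>+t. ennreal ((D (t + h) (t + \<sigma>))\<^sup>2) \<partial>lborel))"
            by (simp add: nn_integral_add nn_integral_cmult)
          also have "(\<integral>\<^sup>+t. ennreal ((g (t + \<sigma>))\<^sup>2) \<partial>lborel) = ennreal A"
            unfolding A(1)[symmetric] by (rule nn_integral_translate) measurable
          also have "(\<integral>\<^sup>+t. ennreal ((D (t + h) (t + \<sigma>))\<^sup>2) \<partial>lborel) = (\<integral>\<^sup>+t. ennreal ((D t (t + (h - \<sigma>)))\<^sup>2) \<partial>lborel)"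
            using nn_integral_translate[of "\<lambda>t. ennreal ((D t (t + (h - \<sigma>)))\<^sup>2)" \<sigma>]
            by (simp add: Dsym[of "_ + \<sigma>"] add.commute[of h] flip: add.assoc)
          also have "ennreal e * ennreal A + (ennreal (1 / (2 * e)) * (\<integral>\<^sup>+t. ennreal ((D t (t + \<sigma>))\<^sup>2) \<partial>lborel) +
               ennreal (1 / (2 * e)) * (\<integral>\<^sup>+t. ennreal ((D t (t + (h - \<sigma>)))\<^sup>2) \<partial>lborel))
             \<le> ennreal e * ennreal A + (ennreal (1 / (2 * e)) * ennreal (e * \<eta> / 2) + ennreal (1 / (2 * e)) * ennreal (e * \<eta> / 2))"
            using \<delta>(2)[of \<sigma>] \<delta>(2)[of "h - \<sigma>"] True h by (intro add_mono mult_left_mono) auto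
          also have "\<dots> = ennreal (e * A + (1 / (2 * e) * (e * \<eta> / 2) + 1 / (2 * e) * (e * \<eta> / 2)))"
            using e \<eta> A(2) by (simp add: ennreal_mult[symmetric] ennreal_plus[symmetric] del: ennreal_plus)
          also have "\<dots> \<le> ennreal \<eta>"
          proof (rule ennreal_leI)
            have "e * A \<le> e * (A + 1)" using e by simp
            also have "\<dots> = \<eta> / 2"
              using nonzero_eq_divide_eq[of "A + 1" e "\<eta> / 2"] A(2) e_def by simp
            finally show "e * A + (1 / (2 * e) * (e * \<eta> / 2) + 1 / (2 * e) * (e * \<eta> / 2)) \<le> \<eta>"
              using e by simp
          qed
          finally show ?thesis using True by simp
        qed simp
      qed
      also have "\<dots> = ennreal (h * \<eta>)"
        using h \<eta> by (simp add: nn_integral_multc ennreal_mult)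
      finally show "(\<integral>\<^sup>+t. indicator {\<alpha><..<\<beta>} t * ennreal \<bar>R (t + h) - R t\<bar> \<partial>lborel) \<le> ennreal (h * \<eta>)" .
    qed
  qed
  fix \<phi> assume \<phi>: "\<phi> \<in> test_functions {0<..<T}"
  have sm: "smooth \<phi>" using \<phi> by (simp add: test_functions_def)
  obtain \<alpha> \<beta> where ab: "0 < \<alpha>" "\<alpha> < \<beta>" "\<beta> < T" and supp: "\<And>x. x \<notin> {\<alpha><..<\<beta>} \<Longrightarrow> \<phi> x = 0"
    using test_functions_supp[OF \<phi> T] by metis
  obtain B where B: "0 < B" "\<And>x. \<bar>\<phi> x\<bar> \<le> B"
  proof (rule bounded_if_zero_outside[OF smooth_continuous[OF sm]])
    show "\<phi> x = 0" if "x \<notin> {\<alpha>..\<beta>}" for x using that by (intro supp) auto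
  qed blast
  have [measurable]: "\<phi> \<in> borel_measurable borel" "deriv \<phi> \<in> borel_measurable borel"
    using smooth_continuous[OF sm] smooth_continuous[OF real_smooth_DERIV(2)[OF sm]]
    by (auto intro: borel_measurable_continuous_onI)
  have "integrable lborel (\<lambda>t. R t * \<phi> t)"
  proof (rule Bochner_Integration.integrable_bound)
    show "integrable lborel (\<lambda>t. B * R t)" using R by simp
    show "AE t in lborel. norm (R t * \<phi> t) \<le> norm (B * R t)"
    proof (rule AE_I2)
      fix t
      have "\<bar>\<phi> t\<bar> * \<bar>R t\<bar> \<le> B * \<bar>R t\<bar>" using B(2)[of t] by (rule mult_right_mono) simp
      then show "norm (R t * \<phi> t) \<le> norm (B * R t)" using B(1) by (simp add: abs_mult mult.commute)
    qed
  qed measurable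
  then have "integrable lebesgue (\<lambda>t. R t * \<phi> t)" by (simp add: integrable_completion)
  then have "integrable lebesgue (\<lambda>t. indicator {0<..<T} t *\<^sub>R (R t * \<phi> t))"
    by (intro integrable_mult_indicator) auto
  then show "integrable (lebesgue_on {0<..<T}) (\<lambda>t. R t * \<phi> t)"
    by (simp add: integrable_restrict_space)
  have "(LINT t|lborel. R t * deriv \<phi> t) = 0"
  proof (rule ccontr)
    assume n: "(LINT t|lborel. R t * deriv \<phi> t) \<noteq> 0"
    \<comment> \<open>Chosen so that the bound \<open>B * \<eta>\<close> on the limit is half of its
      absolute value.\<close>
    define \<eta> where "\<eta> = \<bar>LINT t|lborel. R t * deriv \<phi> t\<bar> / (2 * B)"
    have \<eta>: "0 < \<eta>" using n B by (simp add: \<eta>_def)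
    obtain \<delta> where \<delta>: "0 < \<delta>" "\<And>h. 0 < h \<Longrightarrow> h < \<delta> \<Longrightarrow>
      (\<integral>\<^sup>+t. indicator {\<alpha><..<\<beta>} t * ennreal \<bar>R (t + h) - R t\<bar> \<partial>lborel) \<le> ennreal (h * \<eta>)"
      using small[OF \<eta> ab(1,3)] by blast
    have "\<forall>\<^sub>F n in sequentially. 1 / real (Suc n) < \<delta>"
      using order_tendstoD(2)[OF LIMSEQ_Suc[OF lim_1_over_n] \<delta>(1)] by simp
    then have "\<forall>\<^sub>F n in sequentially. \<bar>LINT t|lborel. (R t - R (t + 1 / Suc n)) * \<phi> t * Suc n\<bar> \<le> B * \<eta>"
    proof eventually_elim
      case (elim n)
      let ?h = "1 / real (Suc n)"
      have "ennreal \<bar>LINT t|lborel. (R t - R (t + ?h)) * \<phi> t * Suc n\<bar> \<le>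
          (\<integral>\<^sup>+t. ennreal \<bar>(R t - R (t + ?h)) * \<phi> t * Suc n\<bar> \<partial>lborel)"
        using integral_norm_bound_ennreal[of lborel "\<lambda>t. (R t - R (t + ?h)) * \<phi> t * Suc n"]
        by (cases "integrable lborel (\<lambda>t. (R t - R (t + ?h)) * \<phi> t * Suc n)") (auto simp: not_integrable_integral_eq)
      also have "\<dots> \<le> (\<integral>\<^sup>+t. ennreal (B * Suc n) * (indicator {\<alpha><..<\<beta>} t * ennreal \<bar>R (t + ?h) - R t\<bar>) \<partial>lborel)"
      proof (rule nn_integral_mono)
        fix t
        show "ennreal \<bar>(R t - R (t + ?h)) * \<phi> t * Suc n\<bar> \<le> ennreal (B * Suc n) * (indicator {\<alpha><..<\<beta>} t * ennreal \<bar>R (t + ?h) - R t\<bar>)"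
        proof (cases "t \<in> {\<alpha><..<\<beta>}")
          case True
          have "\<bar>(R t - R (t + ?h)) * \<phi> t * Suc n\<bar> = (\<bar>\<phi> t\<bar> * Suc n) * \<bar>R (t + ?h) - R t\<bar>"
            by (simp only: abs_mult abs_minus_commute[of "R t"] mult.commute mult.left_commute abs_of_nat)
          also have "\<dots> \<le> (B * Suc n) * \<bar>R (t + ?h) - R t\<bar>" using B by (intro mult_right_mono) auto
          finally show ?thesis using True B(1) by (simp add: ennreal_mult[symmetric] ennreal_leI del: of_nat_Suc)
        qed (simp add: supp)
      qed
      also have "\<dots> = ennreal (B * Suc n) * (\<integral>\<^sup>+t. (indicator {\<alpha><..<\<beta>} t * ennreal \<bar>R (t + ?h) - R t\<bar>) \<partial>lborel)"
        by (rule nn_integral_cmult) measurable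
      also have "\<dots> \<le> ennreal (B * Suc n) * ennreal (?h * \<eta>)"
        using \<delta>(2)[of ?h] elim by (intro mult_left_mono) auto
      also have "\<dots> = ennreal (B * Suc n * (?h * \<eta>))" using B(1) \<eta> by (intro ennreal_mult[symmetric]) auto
      also have "B * Suc n * (?h * \<eta>) = B * \<eta>" by simp
      finally show ?case using B(1) \<eta> by (simp add: ennreal_le_iff)
    qed
    with tendsto_rabs[OF integral_increment_test_function[OF T R \<phi>]]
    have "\<bar>LINT t|lborel. R t * deriv \<phi> t\<bar> \<le> B * \<eta>" by (rule tendsto_upperbound) simp
    then show False using n B(1) by (simp add: \<eta>_def)
  qed
  moreover have "(LINT t|lebesgue_on {0<..<T}. R t * deriv \<phi> t) = (LINT t|lborel. R t * deriv \<phi> t)"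
  proof -
    have "deriv \<phi> x = 0" if "x \<notin> {\<alpha>..\<beta>}" for x using supp that by (rule deriv_zero_outside)
    then have e: "indicator {0<..<T} t *\<^sub>R (R t * deriv \<phi> t) = R t * deriv \<phi> t" for t
      using ab by (cases "t \<in> {\<alpha>..\<beta>}") auto
    have "(LINT t|lebesgue_on {0<..<T}. R t * deriv \<phi> t) = (LINT t|lebesgue. R t * deriv \<phi> t)"
      by (subst integral_restrict_space) (simp_all only: e, simp)
    then show ?thesis by (simp add: integral_completion)
  qed
  ultimately show "(LINT t|lebesgue_on {0<..<T}. R t * deriv \<phi> t) = 0" by simp
qed

section \<open>Bochner spaces\<close>

text \<open>A compact K inside \<open>A\<close> has positive distance from the complement of an open
  U around \<open>A\<close>. A shorter shift that leaves \<open>A\<close> therefore starts in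
  \<open>A - K\<close> or ends in \<open>U - A\<close>, and both sets are small.\<close>

lemma emeasure_translate_diff:
  fixes A :: "real set"
  assumes A: "A \<in> sets borel" "bounded A" and e: "0 < e"
  shows "\<exists>\<delta>>0. \<forall>\<sigma>. \<bar>\<sigma>\<bar> < \<delta> \<longrightarrow> emeasure lborel {t \<in> A. t + \<sigma> \<notin> A} \<le> ennreal e"
proof -
  have As: "A \<in> sets lebesgue" using A by simp
  obtain U where U: "open U" "A \<subseteq> U" "U - A \<in> lmeasurable" "emeasure lebesgue (U - A) < ennreal (e / 2)"
    using sets_lebesgue_outer_open[OF As, of "e / 2"] e by auto
  obtain K where K: "closed K" "K \<subseteq> A" "A - K \<in> lmeasurable" "emeasure lebesgue (A - K) < ennreal (e / 2)"
    using sets_lebesgue_inner_closed[OF As, of "e / 2"] e by auto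
  have "compact K" using K A(2) bounded_subset compact_eq_bounded_closed by blast
  then obtain d where d: "0 < d" "\<And>x y. x \<in> K \<Longrightarrow> y \<in> - U \<Longrightarrow> d \<le> dist x y"
    using separate_compact_closed[of K "- U"] U(1,2) K(2) by (metis ComplD Compl_disjoint closed_Compl disjoint_iff subsetD)
  have [measurable]: "A \<in> sets borel" "U \<in> sets borel" "K \<in> sets borel" using A U K by auto
  show ?thesis
  proof (intro exI[of _ d] conjI allI impI)
    show "0 < d" by (rule d)
    fix \<sigma> :: real assume \<sigma>: "\<bar>\<sigma>\<bar> < d"
    have "{t \<in> A. t + \<sigma> \<notin> A} \<subseteq> (A - K) \<union> {t. t + \<sigma> \<in> U - A}"
    proof
      fix t assume t: "t \<in> {t \<in> A. t + \<sigma> \<notin> A}"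
      show "t \<in> (A - K) \<union> {t. t + \<sigma> \<in> U - A}"
      proof (cases "t \<in> K")
        case True
        then have "t + \<sigma> \<in> U" using d(2)[of t "t + \<sigma>"] \<sigma> by (force simp: dist_real_def)
        then show ?thesis using t by auto
      qed (use t in auto)
    qed
    then have "emeasure lborel {t \<in> A. t + \<sigma> \<notin> A} \<le> emeasure lborel ((A - K) \<union> {t. t + \<sigma> \<in> U - A})"
      by (intro emeasure_mono) auto
    also have "\<dots> \<le> emeasure lborel (A - K) + emeasure lborel {t. t + \<sigma> \<in> U - A}"
      by (intro emeasure_subadditive) auto
    also have "emeasure lborel {t. t + \<sigma> \<in> U - A} = emeasure lborel (U - A)"
    proof -
      have "{t. t + \<sigma> \<in> U - A} \<in> sets lborel" by measurable
      then have "emeasure lborel {t. t + \<sigma> \<in> U - A} = (\<integral>\<^sup>+t. indicator {t. t + \<sigma> \<in> U - A} t \<partial>lborel)"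
        by (rule nn_integral_indicator[symmetric])
      also have "\<dots> = (\<integral>\<^sup>+t. indicator (U - A) (t + \<sigma>) \<partial>lborel)"
        by (intro nn_integral_cong) (simp add: indicator_def)
      also have "\<dots> = emeasure lborel (U - A)"
        by (subst nn_integral_translate) auto
      finally show ?thesis .
    qed
    also have "emeasure lborel (A - K) + emeasure lborel (U - A) \<le> ennreal (e / 2) + ennreal (e / 2)"
      using U(4) K(4) by (intro add_mono) auto
    also have "\<dots> = ennreal e" using e by (simp flip: ennreal_plus)
    finally show "emeasure lborel {t \<in> A. t + \<sigma> \<notin> A} \<le> ennreal e" .
  qed
qed

lemma square_sum3_le: "((a::real) + b + c)\<^sup>2 \<le> 3 * a\<^sup>2 + 3 * b\<^sup>2 + 3 * c\<^sup>2"
proof -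
  have "0 \<le> (a - b)\<^sup>2 + (b - c)\<^sup>2 + (a - c)\<^sup>2" by simp
  then show ?thesis by (simp add: power2_eq_square algebra_simps)
qed

text \<open>
  A square-integrable representative on a Borel set \<open>G\<close>, together with approximations that are
  simple with respect to Borel (not merely Lebesgue) sets, so that translates and functions of two
  times stay measurable.
\<close>

locale regular_bochner = seminormed_carrier X N
  for X :: "'x::ab_group_add set" and N :: "'x \<Rightarrow> real" +
  fixes T :: real and u :: "real \<Rightarrow> 'x" and s :: "nat \<Rightarrow> real \<Rightarrow> 'x" and G :: "real set"
  assumes G_borel: "G \<in> sets borel" and G_subset: "G \<subseteq> {0<..<T}"
    and simple: "simple_function lborel (s n)" and s_mem: "s n t \<in> X"
    and u_mem: "t \<in> G \<Longrightarrow> u t \<in> X"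
    and conv: "t \<in> G \<Longrightarrow> (\<lambda>n. N (s n t - u t)) \<longlonglongrightarrow> 0"
    and square_integral_finite: "(\<integral>\<^sup>+t. indicator G t * ennreal ((N (u t))\<^sup>2) \<partial>lborel) < \<infinity>"
begin

lemma G_pred [measurable]: "G \<in> sets borel" by (rule G_borel)

lemma simple_prod: "simple_function (lborel \<Otimes>\<^sub>M lborel) (\<lambda>p. f (s n (fst p)) (s m (snd p)))"
proof -
  have "simple_function (lborel \<Otimes>\<^sub>M lborel) (\<lambda>p. s n (fst p))"
    using simple_function_comp[OF measurable_fst, of lborel "s n" lborel] simple by (simp add: o_def)
  moreover have "simple_function (lborel \<Otimes>\<^sub>M lborel) (\<lambda>p. s m (snd p))"
    using simple_function_comp[OF measurable_snd, of lborel "s m" lborel] simple by (simp add: o_def)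
  ultimately show ?thesis by (rule simple_function_compose2)
qed

lemma tendsto_norm:
  assumes "t \<in> G"
  shows "(\<lambda>n. N (s n t)) \<longlonglongrightarrow> N (u t)"
proof (rule LIM_zero_cancel, rule Lim_null_comparison[OF _ conv[OF assms]])
  show "\<forall>\<^sub>F n in sequentially. norm (N (s n t) - N (u t)) \<le> N (s n t - u t)"
    using abs_norm_diff_le[OF s_mem u_mem[OF assms]] by simp
qed

lemma tendsto_norm_diff:
  assumes "t \<in> G" "r \<in> G"
  shows "(\<lambda>n. N (s n t - s n r)) \<longlonglongrightarrow> N (u t - u r)"
proof (rule LIM_zero_cancel, rule Lim_null_comparison)
  show "\<forall>\<^sub>F n in sequentially. norm (N (s n t - s n r) - N (u t - u r)) \<le> N (s n t - u t) + N (s n r - u r)"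
  proof (intro always_eventually allI)
    fix n
    have "\<bar>N (s n t - s n r) - N (u t - u r)\<bar> \<le> N ((s n t - s n r) - (u t - u r))"
      by (intro abs_norm_diff_le minus_mem s_mem u_mem assms)
    also have "\<dots> \<le> N (s n t - u t) + N (s n r - u r)"
      by (intro norm_minus_minus s_mem u_mem assms)
    finally show "norm (N (s n t - s n r) - N (u t - u r)) \<le> N (s n t - u t) + N (s n r - u r)" by simp
  qed
  show "(\<lambda>n. N (s n t - u t) + N (s n r - u r)) \<longlonglongrightarrow> 0"
    using tendsto_add[OF conv[OF assms(1)] conv[OF assms(2)]] by simp
qed

text \<open>Set to 0 off \<open>G\<close>, where \<open>u\<close> may lie outside \<open>X\<close>.
  As pointwise limits built from simple functions and the Borel set \<open>G\<close>, this function
  and \<open>gap\<close> are Borel on the whole line and plane.\<close>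

definition norm_at :: "real \<Rightarrow> real" where "norm_at t = (if t \<in> G then N (u t) else 0)"

definition gap :: "real \<Rightarrow> real \<Rightarrow> real" where "gap t r = (if t \<in> G \<and> r \<in> G then N (u t - u r) else 0)"

lemma norm_at_nonneg: "0 \<le> norm_at t" and gap_nonneg: "0 \<le> gap t r" and gap_sym: "gap t r = gap r t"
  by (auto simp: norm_at_def gap_def intro!: norm_nonneg minus_mem u_mem norm_minus_commute)

lemma norm_at_measurable [measurable]: "norm_at \<in> borel_measurable borel"
proof (rule borel_measurable_LIMSEQ_real)
  show "(\<lambda>n. if t \<in> G then N (s n t) else 0) \<longlonglongrightarrow> norm_at t" for t
    by (auto simp: norm_at_def tendsto_norm)
  have "(\<lambda>t. N (s n t)) \<in> borel_measurable lborel" for n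
    by (rule borel_measurable_simple_function, rule simple_function_compose1[OF simple])
  then show "(\<lambda>t. if t \<in> G then N (s n t) else 0) \<in> borel_measurable borel" for n
    by simp
qed

lemma gap_measurable: "case_prod gap \<in> borel_measurable (borel \<Otimes>\<^sub>M borel)"
proof (rule borel_measurable_LIMSEQ_real)
  let ?f = "\<lambda>n p. if fst p \<in> G \<and> snd p \<in> G then N (s n (fst p) - s n (snd p)) else 0"
  show "(\<lambda>n. ?f n p) \<longlonglongrightarrow> case_prod gap p" for p
    by (cases p) (auto simp: gap_def tendsto_norm_diff)
  fix n
  have "(\<lambda>p. N (s n (fst p) - s n (snd p))) \<in> borel_measurable (lborel \<Otimes>\<^sub>M lborel)"
    by (rule borel_measurable_simple_function[OF simple_prod])
  moreover have "sets (lborel \<Otimes>\<^sub>M lborel :: (real \<times> real) measure) = sets (borel \<Otimes>\<^sub>M borel)"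
    by (rule sets_pair_measure_cong) auto
  ultimately have "(\<lambda>p. N (s n (fst p) - s n (snd p))) \<in> borel_measurable (borel \<Otimes>\<^sub>M borel)"
    by (simp cong: measurable_cong_sets)
  then show "?f n \<in> borel_measurable (borel \<Otimes>\<^sub>M borel)" by measurable
qed

lemma norm_at_square_integrable: "integrable lborel (\<lambda>t. (norm_at t)\<^sup>2)"
proof (rule integrableI_bounded)
  have "(\<integral>\<^sup>+t. ennreal (norm ((norm_at t)\<^sup>2)) \<partial>lborel) = (\<integral>\<^sup>+t. indicator G t * ennreal ((N (u t))\<^sup>2) \<partial>lborel)"
    by (intro nn_integral_cong) (simp add: norm_at_def)
  then show "(\<integral>\<^sup>+t. ennreal (norm ((norm_at t)\<^sup>2)) \<partial>lborel) < \<infinity>" using square_integral_finite by simp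
qed measurable

text \<open>The sequence \<open>s\<close> converges pointwise without an integrable bound; cutting
  it off relative to \<open>norm_at\<close> provides one, and dominated convergence applies.\<close>

lemma simple_approximation:
  assumes \<eta>: "0 < \<eta>"
  obtains p where "simple_function lborel p" "\<And>t. p t \<in> X"
    "(\<lambda>t. if t \<in> G then N (p t - u t) else 0) \<in> borel_measurable borel"
    "(\<integral>\<^sup>+t. ennreal ((if t \<in> G then N (p t - u t) else 0)\<^sup>2) \<partial>lborel) \<le> ennreal \<eta>"
proof -
  \<comment> \<open>The summand 1 makes the cut-off eventually inactive even where
    \<open>norm_at\<close> is 0.\<close>
  define p where "p n t = (if N (s n t) \<le> 2 * norm_at t + 1 then s n t else 0)" for n t
  have p_simple: "simple_function lborel (p n)" for n
  proof -
    have [measurable]: "(\<lambda>t. N (s n t)) \<in> borel_measurable lborel"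
      by (rule borel_measurable_simple_function, rule simple_function_compose1[OF simple])
    show ?thesis unfolding p_def
      by (intro simple_function_If simple simple_function_const) measurable
  qed
  have p_mem: "p n t \<in> X" for n t by (simp add: p_def s_mem zero_mem)
  let ?d = "\<lambda>n t. if t \<in> G then N (p n t - u t) else 0"
  \<comment> \<open>No sigma-algebra on \<open>X\<close> is in play: the distance from
    \<open>p n\<close> to \<open>u\<close> is measurable as a limit of distances between simple
    functions.\<close>
  have d_meas: "?d n \<in> borel_measurable borel" for n
  proof (rule borel_measurable_LIMSEQ_real)
    show "(\<lambda>m. if t \<in> G then N (p n t - s m t) else 0) \<longlonglongrightarrow> ?d n t" for t
    proof (cases "t \<in> G")
      case True
      have "(\<lambda>m. N (p n t - s m t)) \<longlonglongrightarrow> N (p n t - u t)"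
      proof (rule LIM_zero_cancel, rule Lim_null_comparison[OF _ conv[OF True]])
        show "\<forall>\<^sub>F m in sequentially. norm (N (p n t - s m t) - N (p n t - u t)) \<le> N (s m t - u t)"
        proof (intro always_eventually allI)
          fix m
          have "\<bar>N (p n t - s m t) - N (p n t - u t)\<bar> \<le> N ((p n t - s m t) - (p n t - u t))"
            by (intro abs_norm_diff_le minus_mem s_mem u_mem True p_mem)
          also have "(p n t - s m t) - (p n t - u t) = u t - s m t" by simp
          also have "N \<dots> = N (s m t - u t)" by (intro norm_minus_commute s_mem u_mem True)
          finally show "norm (N (p n t - s m t) - N (p n t - u t)) \<le> N (s m t - u t)" by simp
        qed
      qed
      then show ?thesis using True by simp
    qed simp
    have "(\<lambda>t. N (p n t - s m t)) \<in> borel_measurable lborel" for m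
      by (rule borel_measurable_simple_function, rule simple_function_compose2[OF p_simple simple])
    then show "(\<lambda>t. if t \<in> G then N (p n t - s m t) else 0) \<in> borel_measurable borel" for m
      by simp
  qed
  \<comment> \<open>Squaring N(p n - u) <= 3 norm_at + 1 gives these constants; the indicator makes
    the constant term integrable.\<close>
  have bound: "(?d n t)\<^sup>2 \<le> indicator {0<..<T} t * (18 * (norm_at t)\<^sup>2 + 2)" for n t
  proof (cases "t \<in> G")
    case True
    have "N (p n t) \<le> 2 * norm_at t + 1"
      using norm_at_nonneg[of t] by (simp add: p_def norm_zero)
    then have "N (p n t - u t) \<le> 3 * norm_at t + 1"
      using norm_minus_le[OF p_mem u_mem[OF True], of n t] True by (simp add: norm_at_def)
    then have "(N (p n t - u t))\<^sup>2 \<le> (3 * norm_at t + 1)\<^sup>2"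
      by (intro power_mono norm_nonneg minus_mem p_mem u_mem True)
    also have "\<dots> \<le> 2 * (3 * norm_at t)\<^sup>2 + 2 * 1\<^sup>2"
      using sum_squares_bound[of "3 * norm_at t" 1] by (simp add: power2_sum)
    finally show ?thesis using True G_subset by (auto simp: power_mult_distrib)
  qed simp
  have lim: "(\<lambda>n. (?d n t)\<^sup>2) \<longlonglongrightarrow> 0" for t
  proof (cases "t \<in> G")
    case True
    have "\<forall>\<^sub>F n in sequentially. N (s n t) < 2 * norm_at t + 1"
      using norm_at_nonneg[of t] True by (intro order_tendstoD(2)[OF tendsto_norm]) (auto simp: norm_at_def)
    then have "\<forall>\<^sub>F n in sequentially. N (s n t - u t) = ?d n t"
      by eventually_elim (simp add: p_def True)
    then have "(\<lambda>n. ?d n t) \<longlonglongrightarrow> 0" using conv[OF True] by (rule tendsto_cong[THEN iffD1])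
    then have "(\<lambda>n. (?d n t)\<^sup>2) \<longlonglongrightarrow> 0\<^sup>2" by (rule tendsto_power)
    then show ?thesis by simp
  qed simp
  have wint: "integrable lborel (\<lambda>t. indicator {0<..<T} t * (18 * (norm_at t)\<^sup>2 + 2))"
  proof -
    have "integrable lborel (\<lambda>t. 18 * (indicator {0<..<T} t *\<^sub>R (norm_at t)\<^sup>2))"
      by (intro integrable_mult_right integrable_mult_indicator norm_at_square_integrable) simp
    moreover have "integrable lborel (\<lambda>t. 2 * indicator {0<..<T} t :: real)"
      using emeasure_bounded_finite[OF bounded_box[of 0 T, unfolded box_real]]
      by (intro integrable_mult_right integrable_real_indicator) auto
    ultimately have "integrable lborel (\<lambda>t. 18 * (indicator {0<..<T} t *\<^sub>R (norm_at t)\<^sup>2) + 2 * indicator {0<..<T} t)"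
      by (rule Bochner_Integration.integrable_add)
    then show ?thesis by (simp add: algebra_simps)
  qed
  have di: "integrable lborel (\<lambda>t. (?d n t)\<^sup>2)" for n
    by (rule Bochner_Integration.integrable_bound[OF wint])
       (use d_meas bound in \<open>auto intro!: AE_I2 order_trans[OF _ abs_ge_self] simp del: power2_eq_iff_nonneg\<close>)
  have "(\<lambda>n. LINT t|lborel. (?d n t)\<^sup>2) \<longlonglongrightarrow> (LINT t|(lborel :: real measure). 0)"
  proof (rule integral_dominated_convergence[where w="\<lambda>t. indicator {0<..<T} t * (18 * (norm_at t)\<^sup>2 + 2)"])
    show "AE t in lborel. norm ((?d n t)\<^sup>2) \<le> indicator {0<..<T} t * (18 * (norm_at t)\<^sup>2 + 2)" for n
      using bound[of _ n] by simp
  qed (use d_meas lim wint in auto)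
  then have "\<forall>\<^sub>F n in sequentially. (LINT t|lborel. (?d n t)\<^sup>2) < \<eta>"
    using \<eta> by (intro order_tendstoD(2)[where y=0]) auto
  then obtain n where n: "(LINT t|lborel. (?d n t)\<^sup>2) < \<eta>"
    using eventually_happens'[OF trivial_limit_sequentially] by blast
  show thesis
  proof (rule that[OF p_simple p_mem d_meas, of n])
    have "(\<integral>\<^sup>+t. ennreal ((?d n t)\<^sup>2) \<partial>lborel) = ennreal (LINT t|lborel. (?d n t)\<^sup>2)"
      by (rule nn_integral_eq_integral[OF di]) simp
    then show "(\<integral>\<^sup>+t. ennreal ((?d n t)\<^sup>2) \<partial>lborel) \<le> ennreal \<eta>"
      using n by (simp add: ennreal_leI)
  qed
qed

text \<open>Continuity of translations in L2(0,T;X). For a function with finitely many values a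
  shift matters only at times that leave their level set, and these have small measure;
  \<open>u\<close> is approximated by such a function. Since \<open>gap\<close> is 0 once one of the
  times is outside \<open>G\<close>, no boundary layer arises at 0 or \<open>T\<close>.\<close>

lemma gap_translation:
  assumes \<eta>: "0 < \<eta>"
  shows "\<exists>\<delta>>0. \<forall>\<sigma>. 0 \<le> \<sigma> \<and> \<sigma> < \<delta> \<longrightarrow> (\<integral>\<^sup>+t. ennreal ((gap t (t + \<sigma>))\<^sup>2) \<partial>lborel) \<le> ennreal \<eta>"
proof -
  obtain p where p: "simple_function lborel p" "\<And>t. p t \<in> X"
    and dm[measurable]: "(\<lambda>t. if t \<in> G then N (p t - u t) else 0) \<in> borel_measurable borel"
    and d2: "(\<integral>\<^sup>+t. ennreal ((if t \<in> G then N (p t - u t) else 0)\<^sup>2) \<partial>lborel) \<le> ennreal (\<eta> / 9)"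
    using simple_approximation[of "\<eta> / 9"] \<eta> by auto
  define d where "d t = (if t \<in> G then N (p t - u t) else 0)" for t
  have [measurable]: "d \<in> borel_measurable borel" using dm by (simp add: d_def[abs_def])
  have d2: "(\<integral>\<^sup>+t. ennreal ((d t)\<^sup>2) \<partial>lborel) \<le> ennreal (\<eta> / 9)" using d2 by (simp add: d_def)
  have fin: "finite (range p)" using simple_functionD(1)[OF p(1)] by simp
  \<comment> \<open>The added 1 keeps \<open>M\<close> positive when all these distances
    vanish.\<close>
  define M where "M = Max ((\<lambda>(x, y). N (x - y)) ` (range p \<times> range p)) + 1"
  have M1: "N (p t - p r) \<le> M - 1" for t r
  proof -
    have "N (p t - p r) \<le> Max ((\<lambda>(x, y). N (x - y)) ` (range p \<times> range p))"
      using fin by (intro Max_ge finite_imageI) (auto intro!: image_eqI[of _ _ "(p t, p r)"])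
    then show ?thesis by (simp add: M_def)
  qed
  have M: "N (p t - p r) \<le> M" for t r using M1[of t r] by simp
  have M0: "0 < M" using M1[of 0 0] norm_nonneg[OF minus_mem[OF p(2) p(2)], of 0 0] by linarith
  define A where "A x = {t \<in> {0<..<T}. p t = x}" for x
  have A: "A x \<in> sets borel" "bounded (A x)" for x
  proof -
    have "p -` {x} \<inter> space lborel \<in> sets lborel" by (rule simple_functionD(2)[OF p(1)])
    then have "p -` {x} \<in> sets borel" by simp
    moreover have "A x = {0<..<T} \<inter> p -` {x}" by (auto simp: A_def)
    ultimately show "A x \<in> sets borel" by simp
    show "bounded (A x)" by (rule bounded_subset[OF bounded_box[of 0 T, unfolded box_real]]) (auto simp: A_def)
  qed
  \<comment> \<open>The exceptional set then has measure at most
    \<open>\<eta> / (9 * M\<^sup>2)\<close>; after the factor \<open>3 * M\<^sup>2\<close> its share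
    is a third of \<open>\<eta>\<close>, like that of each of the two approximation errors.\<close>
  define e where "e = \<eta> / (9 * M\<^sup>2 * card (range p))"
  have "card (range p) > 0" using fin by (simp add: card_gt_0_iff)
  then have e: "0 < e" using \<eta> M0 by (simp add: e_def)
  have "\<forall>x. \<exists>\<delta>>0. \<forall>\<sigma>. \<bar>\<sigma>\<bar> < \<delta> \<longrightarrow> emeasure lborel {t \<in> A x. t + \<sigma> \<notin> A x} \<le> ennreal e"
    using emeasure_translate_diff[OF A e] by blast
  then obtain \<delta> where \<delta>: "\<And>x. 0 < \<delta> x"
    "\<And>x \<sigma>. \<bar>\<sigma>\<bar> < \<delta> x \<Longrightarrow> emeasure lborel {t \<in> A x. t + \<sigma> \<notin> A x} \<le> ennreal e" by metis
  show ?thesis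
  proof (intro exI[of _ "Min (\<delta> ` range p)"] conjI allI impI)
    show "0 < Min (\<delta> ` range p)" using fin \<delta>(1) by simp
    fix \<sigma> assume \<sigma>: "0 \<le> \<sigma> \<and> \<sigma> < Min (\<delta> ` range p)"
    define B where "B = (\<Union>x\<in>range p. {t \<in> A x. t + \<sigma> \<notin> A x})"
    have [measurable]: "{t \<in> A x. t + \<sigma> \<notin> A x} \<in> sets borel" for x
      using A(1)[of x] by measurable
    then have [measurable]: "B \<in> sets borel" unfolding B_def using fin by (intro sets.finite_UN) auto
    have "emeasure lborel B \<le> (\<Sum>x\<in>range p. emeasure lborel {t \<in> A x. t + \<sigma> \<notin> A x})"
      unfolding B_def using fin by (intro emeasure_subadditive_finite) auto
    also have "\<dots> \<le> (\<Sum>x\<in>range p. ennreal e)"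
      using \<sigma> fin by (intro sum_mono \<delta>(2)) auto
    also have "\<dots> = ennreal (card (range p) * e)"
      using e by (simp add: ennreal_of_nat_eq_real_of_nat ennreal_mult)
    also have "card (range p) * e = \<eta> / (9 * M\<^sup>2)" using \<open>card (range p) > 0\<close> by (simp add: e_def)
    finally have B: "emeasure lborel B \<le> ennreal (\<eta> / (9 * M\<^sup>2))" .
    have "(\<integral>\<^sup>+t. ennreal ((gap t (t + \<sigma>))\<^sup>2) \<partial>lborel) \<le>
      (\<integral>\<^sup>+t. 3 * ennreal ((d t)\<^sup>2) + 3 * ennreal ((d (t + \<sigma>))\<^sup>2) + ennreal (3 * M\<^sup>2) * indicator B t \<partial>lborel)"
    proof (rule nn_integral_mono)
      fix t
      have "(gap t (t + \<sigma>))\<^sup>2 \<le> 3 * (d t)\<^sup>2 + 3 * (d (t + \<sigma>))\<^sup>2 + 3 * M\<^sup>2 * indicator B t"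
      proof (cases "t \<in> G \<and> t + \<sigma> \<in> G")
        case True
        then have G: "t \<in> G" "t + \<sigma> \<in> G" by auto
        have pm: "N (p t - p (t + \<sigma>)) \<le> M * indicator B t"
        proof (cases "p t = p (t + \<sigma>)")
          case True then show ?thesis using M0 by (simp add: norm_zero)
        next
          case False
          then have "t \<in> B" using G G_subset by (auto simp: B_def A_def)
          then show ?thesis using M by simp
        qed
        have "N (u t - u (t + \<sigma>)) \<le> N (u t - p t) + N (p t - u (t + \<sigma>))"
          by (intro norm_triangle u_mem G p(2))
        also have "N (p t - u (t + \<sigma>)) \<le> N (p t - p (t + \<sigma>)) + N (p (t + \<sigma>) - u (t + \<sigma>))"
          by (intro norm_triangle u_mem G p(2))
        finally have "gap t (t + \<sigma>) \<le> d t + d (t + \<sigma>) + M * indicator B t"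
          using pm G norm_minus_commute[OF u_mem[OF G(1)] p(2)[of t]] by (simp add: gap_def d_def)
        then have "(gap t (t + \<sigma>))\<^sup>2 \<le> (d t + d (t + \<sigma>) + M * indicator B t)\<^sup>2"
          by (intro power_mono gap_nonneg)
        also have "\<dots> \<le> 3 * (d t)\<^sup>2 + 3 * (d (t + \<sigma>))\<^sup>2 + 3 * (M * indicator B t)\<^sup>2"
          by (rule square_sum3_le)
        also have "(M * indicator B t)\<^sup>2 = M\<^sup>2 * indicator B t" by (simp add: indicator_def)
        finally show ?thesis by simp
      qed (auto simp: gap_def)
      then have "ennreal ((gap t (t + \<sigma>))\<^sup>2) \<le> ennreal (3 * (d t)\<^sup>2 + 3 * (d (t + \<sigma>))\<^sup>2 + 3 * M\<^sup>2 * indicator B t)"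
        by (rule ennreal_leI)
      also have "\<dots> = 3 * ennreal ((d t)\<^sup>2) + 3 * ennreal ((d (t + \<sigma>))\<^sup>2) + ennreal (3 * M\<^sup>2) * indicator B t"
        by (simp add: ennreal_mult ennreal_plus indicator_def)
      finally show "ennreal ((gap t (t + \<sigma>))\<^sup>2) \<le> 3 * ennreal ((d t)\<^sup>2) + 3 * ennreal ((d (t + \<sigma>))\<^sup>2) + ennreal (3 * M\<^sup>2) * indicator B t" .
    qed
    also have "\<dots> = 3 * (\<integral>\<^sup>+t. ennreal ((d t)\<^sup>2) \<partial>lborel) + 3 * (\<integral>\<^sup>+t. ennreal ((d (t + \<sigma>))\<^sup>2) \<partial>lborel) + ennreal (3 * M\<^sup>2) * emeasure lborel B"
      by (simp add: nn_integral_add nn_integral_cmult)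
    also have "(\<integral>\<^sup>+t. ennreal ((d (t + \<sigma>))\<^sup>2) \<partial>lborel) = (\<integral>\<^sup>+t. ennreal ((d t)\<^sup>2) \<partial>lborel)"
      by (rule nn_integral_translate) measurable
    also have "3 * (\<integral>\<^sup>+t. ennreal ((d t)\<^sup>2) \<partial>lborel) + 3 * (\<integral>\<^sup>+t. ennreal ((d t)\<^sup>2) \<partial>lborel) + ennreal (3 * M\<^sup>2) * emeasure lborel B
      \<le> 3 * ennreal (\<eta> / 9) + 3 * ennreal (\<eta> / 9) + ennreal (3 * M\<^sup>2) * ennreal (\<eta> / (9 * M\<^sup>2))"
      using d2 B by (intro add_mono mult_left_mono) auto
    also have "\<dots> = ennreal (3 * (\<eta> / 9) + 3 * (\<eta> / 9) + 3 * M\<^sup>2 * (\<eta> / (9 * M\<^sup>2)))"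
      using \<eta> M0 by (simp only: ennreal_plus ennreal_mult ennreal_numeral mult_nonneg_nonneg divide_nonneg_nonneg zero_le_numeral zero_le_power2 less_imp_le add_nonneg_nonneg)
    also have "3 * (\<eta> / 9) + 3 * (\<eta> / 9) + 3 * M\<^sup>2 * (\<eta> / (9 * M\<^sup>2)) = \<eta>" using M0 by (simp add: field_simps)
    finally show "(\<integral>\<^sup>+t. ennreal ((gap t (t + \<sigma>))\<^sup>2) \<partial>lborel) \<le> ennreal \<eta>" .
  qed
qed

end

section \<open>Borel approximations and differences in Bochner spaces\<close>

lemma AE_lebesgue_on_borel_set:
  fixes P :: "real \<Rightarrow> bool"
  assumes S: "S \<in> sets borel" and P: "AE t in lebesgue_on S. P t"
  shows "\<exists>G\<in>sets borel. G \<subseteq> S \<and> (\<forall>t\<in>G. P t) \<and> (AE t in lborel. t \<in> S \<longrightarrow> t \<in> G)"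
proof -
  have "AE t in lborel. t \<in> S \<longrightarrow> P t"
    using P S by (simp add: AE_restrict_space_iff AE_completion_iff)
  then obtain Z where Z: "{t. \<not> (t \<in> S \<longrightarrow> P t)} \<subseteq> Z" "Z \<in> sets borel" "emeasure lborel Z = 0"
    by (auto elim!: AE_E)
  have "AE t in lborel. t \<notin> Z" using Z by (intro AE_not_in) (auto simp: null_sets_def)
  then have "AE t in lborel. t \<in> S \<longrightarrow> t \<in> S - Z" by eventually_elim auto
  with S Z show ?thesis by (intro bexI[of _ "S - Z"]) auto
qed

lemma AE_lebesgue_onI_lborel:
  assumes "S \<in> sets borel" "AE t in lborel. t \<in> S \<longrightarrow> P t"
  shows "AE t in lebesgue_on S. P t"
  using assms by (simp add: AE_restrict_space_iff AE_completion)

context seminormed_carrier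
begin

text \<open>The given functions are simple for the Lebesgue sigma-algebra and are exchanged for
  Borel simple ones that agree off a null set. All exceptional null sets, including that of the
  property \<open>P\<close>, are absorbed into the complement of one Borel set
  \<open>G\<close>.\<close>

lemma L2_Bochner_regular:
  assumes u: "u \<in> L2_Bochner T X N" and P: "AE t in lebesgue_on {0<..<T}. P t"
  obtains s G where "regular_bochner X N T u s G" "\<And>t. t \<in> G \<Longrightarrow> P t"
    "AE t in lborel. t \<in> {0<..<T} \<longrightarrow> t \<in> G"
proof -
  let ?I = "{0<..<T}"
  obtain s' where s': "\<And>n. simple_function (lebesgue_on ?I) (s' n)" "\<And>n. s' n ` space (lebesgue_on ?I) \<subseteq> X"
    and conv: "AE t in lebesgue_on ?I. (\<lambda>n. N (s' n t - u t)) \<longlonglongrightarrow> 0"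
    using u unfolding L2_Bochner_def strongly_measurable_def by blast
  have mem: "AE t in lebesgue_on ?I. u t \<in> X" and sq: "integrable (lebesgue_on ?I) (\<lambda>t. (N (u t))\<^sup>2)"
    using u by (auto simp: L2_Bochner_def)
  define s0 where "s0 n t = (if t \<in> ?I then s' n t else 0)" for n t
  have s0: "simple_function lebesgue (s0 n)" for n
  proof -
    have fin: "finite (s' n ` ?I)" using simple_functionD(1)[OF s'(1)[of n]] by simp
    have "range (s0 n) \<subseteq> insert 0 (s' n ` ?I)" by (auto simp: s0_def)
    then have "finite (range (s0 n))" using fin finite_subset by blast
    moreover have "s0 n -` {x} \<in> sets lebesgue" for x
    proof -
      have "s' n -` {x} \<inter> space (lebesgue_on ?I) \<in> sets (lebesgue_on ?I)"
        by (rule simple_functionD(2)[OF s'(1)])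
      then obtain B where "B \<in> sets lebesgue" "s' n -` {x} \<inter> ?I = ?I \<inter> B"
        by (auto simp: sets_restrict_space)
      then have "s' n -` {x} \<inter> ?I \<in> sets lebesgue" using sets.Int[of ?I lebesgue B] by simp
      moreover have "s0 n -` {x} = (s' n -` {x} \<inter> ?I) \<union> (if x = 0 then - ?I else {})"
        by (auto simp: s0_def split: if_splits)
      ultimately show ?thesis by auto
    qed
    ultimately show ?thesis by (simp add: simple_function_def)
  qed
  have "\<exists>f. simple_function lborel f \<and> (AE t in lborel. s0 n t = f t)" for n
    using completion_ex_simple_function[OF s0] .
  then obtain f where f: "\<And>n. simple_function lborel (f n)" "\<And>n. AE t in lborel. s0 n t = f n t" by metis
  \<comment> \<open>The Borel version may leave \<open>X\<close> on the null set where it differs;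
    such values are reset to 0.\<close>
  define s where "s n t = (if f n t \<in> X then f n t else 0)" for n t
  have s_simple: "simple_function lborel (s n)" for n
    unfolding s_def using simple_function_compose1[OF f(1), of "\<lambda>x. if x \<in> X then x else 0"] by simp
  have s_mem: "s n t \<in> X" for n t by (simp add: s_def zero_mem)
  have "AE t in lborel. \<forall>n. s0 n t = f n t" using f(2) by (simp add: AE_all_countable)
  then have "AE t in lebesgue_on ?I. \<forall>n. s0 n t = f n t"
    by (intro AE_lebesgue_onI_lborel) (auto elim: eventually_mono)
  moreover have "AE t in lebesgue_on ?I. t \<in> ?I" by (intro AE_I2) auto
  ultimately have ae: "AE t in lebesgue_on ?I. P t \<and> u t \<in> X \<and> (\<lambda>n. N (s n t - u t)) \<longlonglongrightarrow> 0"
    using P mem conv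
  proof eventually_elim
    case (elim t)
    have "t \<in> space (lebesgue_on ?I)" using elim(2) by simp
    then have "s' n t \<in> X" for n using s'(2)[of n] by blast
    then have "s n t = s' n t" for n using elim(1,2) by (simp add: s_def s0_def)
    then show ?case using elim by simp
  qed
  have I: "?I \<in> sets borel" by simp
  obtain G where G: "G \<in> sets borel" "G \<subseteq> ?I"
    "\<forall>t\<in>G. P t \<and> u t \<in> X \<and> (\<lambda>n. N (s n t - u t)) \<longlonglongrightarrow> 0"
    "AE t in lborel. t \<in> ?I \<longrightarrow> t \<in> G"
    using AE_lebesgue_on_borel_set[OF I ae] by blast
  have "(\<integral>\<^sup>+t. indicator G t * ennreal ((N (u t))\<^sup>2) \<partial>lborel) = (\<integral>\<^sup>+t. indicator G t * ennreal ((N (u t))\<^sup>2) \<partial>lebesgue)"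
    by (rule nn_integral_completion[symmetric])
  also have "\<dots> \<le> (\<integral>\<^sup>+t. ennreal ((N (u t))\<^sup>2) * indicator ?I t \<partial>lebesgue)"
    using G(2) by (intro nn_integral_mono) (auto simp: indicator_def)
  also have "\<dots> = (\<integral>\<^sup>+t. ennreal ((N (u t))\<^sup>2) \<partial>lebesgue_on ?I)"
    by (subst nn_integral_restrict_space) auto
  also have "\<dots> < \<infinity>" using sq by (simp add: integrable_iff_bounded)
  finally have fin: "(\<integral>\<^sup>+t. indicator G t * ennreal ((N (u t))\<^sup>2) \<partial>lborel) < \<infinity>" .
  show thesis
  proof (rule that[of s G])
    show "regular_bochner X N T u s G"
      by unfold_locales (use G s_simple s_mem fin in auto)
  qed (use G in auto)
qed

text \<open>Measurability of the norm of the difference comes from the differences of the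
  approximating functions.\<close>

lemma L2_Bochner_minus:
  assumes u: "u \<in> L2_Bochner T X N" and v: "v \<in> L2_Bochner T X N"
  shows "(\<lambda>t. u t - v t) \<in> L2_Bochner T X N"
proof -
  let ?M = "lebesgue_on {0<..<T}"
  obtain s where s: "\<And>n. simple_function ?M (s n)" "\<And>n. s n ` space ?M \<subseteq> X"
    and sc: "AE t in ?M. (\<lambda>n. N (s n t - u t)) \<longlonglongrightarrow> 0"
    using u unfolding L2_Bochner_def strongly_measurable_def by blast
  obtain r where r: "\<And>n. simple_function ?M (r n)" "\<And>n. r n ` space ?M \<subseteq> X"
    and rc: "AE t in ?M. (\<lambda>n. N (r n t - v t)) \<longlonglongrightarrow> 0"
    using v unfolding L2_Bochner_def strongly_measurable_def by blast
  have mem: "AE t in ?M. u t \<in> X" "AE t in ?M. v t \<in> X"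
    and sq: "integrable ?M (\<lambda>t. (N (u t))\<^sup>2)" "integrable ?M (\<lambda>t. (N (v t))\<^sup>2)"
    using u v by (auto simp: L2_Bochner_def)
  have sp: "AE t in ?M. t \<in> space ?M" by (rule AE_space)
  have smem: "s n t \<in> X" "r n t \<in> X" if "t \<in> space ?M" for n t using s(2)[of n] r(2)[of n] that by blast+
  have simp_diff: "simple_function ?M (\<lambda>t. s n t - r n t)" for n
    by (rule simple_function_compose2[OF s(1) r(1)])
  have c: "AE t in ?M. (\<lambda>n. N ((s n t - r n t) - (u t - v t))) \<longlonglongrightarrow> 0"
    using sc rc mem sp
  proof eventually_elim
    case (elim t)
    show ?case
    proof (rule Lim_null_comparison)
      show "\<forall>\<^sub>F n in sequentially. norm (N ((s n t - r n t) - (u t - v t))) \<le> N (s n t - u t) + N (r n t - v t)"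
        using norm_minus_minus[of "s _ t" "r _ t" "u t" "v t"] smem[OF elim(5)] elim(3,4)
          norm_nonneg[of "(s _ t - r _ t) - (u t - v t)"] minus_mem
        by (intro always_eventually allI) (simp add: abs_of_nonneg)
      show "(\<lambda>n. N (s n t - u t) + N (r n t - v t)) \<longlonglongrightarrow> 0" using tendsto_add[OF elim(1,2)] by simp
    qed
  qed
  have memd: "AE t in ?M. u t - v t \<in> X" using mem by eventually_elim (rule minus_mem)
  have "AE t in ?M. (\<lambda>n. (N (s n t - r n t))\<^sup>2) \<longlonglongrightarrow> (N (u t - v t))\<^sup>2"
    using c memd sp
  proof eventually_elim
    case (elim t)
    have "(\<lambda>n. N (s n t - r n t)) \<longlonglongrightarrow> N (u t - v t)"
    proof (rule LIM_zero_cancel, rule Lim_null_comparison[OF _ elim(1)])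
      show "\<forall>\<^sub>F n in sequentially. norm (N (s n t - r n t) - N (u t - v t)) \<le> N ((s n t - r n t) - (u t - v t))"
        using abs_norm_diff_le[OF minus_mem[OF smem[OF elim(3)]] elim(2)] by simp
    qed
    then show ?case by (rule tendsto_power)
  qed
  then have m: "(\<lambda>t. (N (u t - v t))\<^sup>2) \<in> borel_measurable ?M"
    by (rule borel_measurable_lebesgue_on_LIMSEQ_AE[rotated 2])
       (auto intro: borel_measurable_simple_function simple_function_compose1[OF simp_diff])
  have "integrable ?M (\<lambda>t. (N (u t - v t))\<^sup>2)"
  proof (rule Bochner_Integration.integrable_bound[OF _ m])
    show "integrable ?M (\<lambda>t. 2 * (N (u t))\<^sup>2 + 2 * (N (v t))\<^sup>2)" using sq by simp
    show "AE t in ?M. norm ((N (u t - v t))\<^sup>2) \<le> norm (2 * (N (u t))\<^sup>2 + 2 * (N (v t))\<^sup>2)"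
      using mem
    proof eventually_elim
      case (elim t)
      have "(N (u t - v t))\<^sup>2 \<le> (N (u t) + N (v t))\<^sup>2"
        using elim by (intro power_mono norm_minus_le norm_nonneg minus_mem)
      also have "\<dots> \<le> 2 * (N (u t))\<^sup>2 + 2 * (N (v t))\<^sup>2"
        using sum_squares_bound[of "N (u t)" "N (v t)"] by (simp add: power2_sum)
      finally show ?case by simp
    qed
  qed
  then show ?thesis
    unfolding L2_Bochner_def strongly_measurable_def
    using memd simp_diff c smem by (auto intro!: exI[of _ "\<lambda>n t. s n t - r n t"] minus_mem)
qed

end

lemma L2_imp_integrable_abs:
  fixes h :: "real \<Rightarrow> real"
  assumes "h \<in> borel_measurable (lebesgue_on {0<..<T})" "integrable (lebesgue_on {0<..<T}) (\<lambda>t. (h t)\<^sup>2)"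
  shows "integrable (lebesgue_on {0<..<T}) (\<lambda>t. \<bar>h t\<bar>)"
proof -
  interpret bounded_open_set "{0<..<T}" by unfold_locales (use bounded_box[of 0 T, unfolded box_real] in auto)
  have "h \<in> L2 {0<..<T}" using assms by (simp add: L2_def)
  from L2_has_integrable_norm(1)[OF this lmeasurable_domain] show ?thesis by simp
qed

context bounded_open_set
begin

text \<open>
  The operator norm of \<open>F t\<close> is replaced by a Borel majorant \<open>g\<close>, defined and nonnegative everywhere.
\<close>

definition weak_forcing :: "'a set \<Rightarrow> real \<Rightarrow> (real \<Rightarrow> ('a \<Rightarrow> real) \<Rightarrow> real) \<Rightarrow> (real \<Rightarrow> real) \<Rightarrow> bool" where
  "weak_forcing \<Gamma> T F g \<longleftrightarrow>
     g \<in> borel_measurable borel \<and> (\<forall>t. 0 \<le> g t) \<and> integrable lborel (\<lambda>t. (g t)\<^sup>2) \<and>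
     (AE t in lebesgue_on {0<..<T}. \<forall>v\<in>V_space \<Omega> \<Gamma>. \<bar>F t v\<bar> \<le> g t * V_norm \<Omega> v) \<and>
     (AE t in lebesgue_on {0<..<T}. \<forall>v\<in>V_space \<Omega> \<Gamma>. \<forall>w\<in>V_space \<Omega> \<Gamma>. F t (v - w) = F t v - F t w) \<and>
     (\<forall>w\<in>V_space \<Omega> \<Gamma>. (\<lambda>t. F t w) \<in> borel_measurable (lebesgue_on {0<..<T}))"

text \<open>Evaluation at a fixed \<open>w\<close> is continuous in the dual norm, so
  \<open>F t w\<close> is a limit of simple functions of time. The majorant is a Borel version of
  the dual norm.\<close>

lemma L2_V_dual_weak_forcing:
  assumes F: "F \<in> L2_V_dual T \<Omega> \<Gamma>"
  shows "\<exists>g. weak_forcing \<Gamma> T F g"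
proof -
  let ?I = "{0<..<T}" and ?M = "lebesgue_on {0<..<T}"
  have mem: "AE t in ?M. F t \<in> V_dual \<Omega> \<Gamma>" and sq: "integrable ?M (\<lambda>t. (V_dual_norm \<Omega> \<Gamma> (F t))\<^sup>2)"
    using F by (auto simp: L2_Bochner_def)
  obtain s where s: "\<And>n. simple_function ?M (s n)" "\<And>n. s n ` space ?M \<subseteq> V_dual \<Omega> \<Gamma>"
    and sc: "AE t in ?M. (\<lambda>n. V_dual_norm \<Omega> \<Gamma> (s n t - F t)) \<longlonglongrightarrow> 0"
    using F unfolding L2_Bochner_def strongly_measurable_def by blast
  \<comment> \<open>Measurability is known for the square of the norm; the absolute value is
    recovered as its root.\<close>
  define g0 where "g0 t = indicator ?I t *\<^sub>R \<bar>V_dual_norm \<Omega> \<Gamma> (F t)\<bar>" for t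
  have "(\<lambda>t. sqrt ((V_dual_norm \<Omega> \<Gamma> (F t))\<^sup>2)) \<in> borel_measurable ?M"
    using borel_measurable_integrable[OF sq] by measurable
  then have "g0 \<in> borel_measurable lebesgue"
    unfolding g0_def by (simp add: borel_measurable_restrict_space_iff)
  then obtain g1 where g1: "g1 \<in> borel_measurable borel" "AE t in lborel. g0 t = g1 t"
    using completion_ex_borel_measurable_real[of g0 lborel] by auto
  have eq: "AE t in ?M. \<bar>V_dual_norm \<Omega> \<Gamma> (F t)\<bar> = g1 t"
    by (rule AE_lebesgue_onI_lborel) (use g1(2) in \<open>auto simp: g0_def elim: eventually_mono\<close>)
  have int: "integrable lborel (\<lambda>t. \<bar>g1 t\<bar>\<^sup>2)"
  proof -
    have "integrable lebesgue (\<lambda>t. indicator ?I t *\<^sub>R (V_dual_norm \<Omega> \<Gamma> (F t))\<^sup>2)"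
      using sq by (simp add: integrable_restrict_space)
    then have "integrable lebesgue (\<lambda>t. \<bar>g1 t\<bar>\<^sup>2)"
    proof (rule integrable_cong_AE_imp)
      show "(\<lambda>t. \<bar>g1 t\<bar>\<^sup>2) \<in> borel_measurable lebesgue" using g1(1) by (simp add: measurable_completion)
      show "AE t in lebesgue. indicator ?I t *\<^sub>R (V_dual_norm \<Omega> \<Gamma> (F t))\<^sup>2 = \<bar>g1 t\<bar>\<^sup>2"
        using AE_completion[OF g1(2)]
      proof eventually_elim
        case (elim t)
        have "indicator ?I t *\<^sub>R (V_dual_norm \<Omega> \<Gamma> (F t))\<^sup>2 = (g0 t)\<^sup>2" by (simp add: g0_def indicator_def)
        then show ?case using elim by simp
      qed
    qed
    then show ?thesis using g1(1) by (simp add: integrable_completion)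
  qed
  have "AE t in ?M. \<forall>v\<in>V_space \<Omega> \<Gamma>. \<bar>F t v\<bar> \<le> \<bar>g1 t\<bar> * V_norm \<Omega> v"
    using mem eq
  proof eventually_elim
    case (elim t)
    show ?case
    proof
      fix v assume v: "v \<in> V_space \<Omega> \<Gamma>"
      have "\<bar>F t v\<bar> \<le> V_dual_norm \<Omega> \<Gamma> (F t) * V_norm \<Omega> v" by (rule V_dual_bound[OF elim(1) v])
      also have "\<dots> \<le> \<bar>g1 t\<bar> * V_norm \<Omega> v" using elim(2) V.norm_nonneg[OF v] by (intro mult_right_mono) auto
      finally show "\<bar>F t v\<bar> \<le> \<bar>g1 t\<bar> * V_norm \<Omega> v" .
    qed
  qed
  moreover have "AE t in ?M. \<forall>v\<in>V_space \<Omega> \<Gamma>. \<forall>w\<in>V_space \<Omega> \<Gamma>. F t (v - w) = F t v - F t w"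
    using mem by eventually_elim (auto simp: V_dual_diff)
  moreover have "(\<lambda>t. F t w) \<in> borel_measurable ?M" if w: "w \<in> V_space \<Omega> \<Gamma>" for w
  proof (rule borel_measurable_lebesgue_on_LIMSEQ_AE)
    show "(\<lambda>t. s n t w) \<in> borel_measurable ?M" for n
      by (rule borel_measurable_simple_function, rule simple_function_compose1[OF s(1)])
    show "AE t in ?M. (\<lambda>n. s n t w) \<longlonglongrightarrow> F t w"
      using sc mem AE_space
    proof eventually_elim
      case (elim t)
      have sm: "s n t \<in> V_dual \<Omega> \<Gamma>" for n using s(2)[of n] elim(3) by blast
      show ?case
      proof (rule LIM_zero_cancel, rule Lim_null_comparison)
        show "\<forall>\<^sub>F n in sequentially. norm (s n t w - F t w) \<le> V_dual_norm \<Omega> \<Gamma> (s n t - F t) * V_norm \<Omega> w"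
          using V_dual_bound[OF V_dual_minus[OF sm elim(2)] w] by simp
        show "(\<lambda>n. V_dual_norm \<Omega> \<Gamma> (s n t - F t) * V_norm \<Omega> w) \<longlonglongrightarrow> 0"
          using tendsto_mult_left_zero[OF elim(1)] .
      qed
    qed
  qed simp
  ultimately have "weak_forcing \<Gamma> T F (\<lambda>t. \<bar>g1 t\<bar>)"
    unfolding weak_forcing_def using g1(1) int by auto
  then show ?thesis by blast
qed

lemma weak_forcing_minus:
  assumes F: "weak_forcing \<Gamma> T F f" and G: "weak_forcing \<Gamma> T G g"
  shows "weak_forcing \<Gamma> T (\<lambda>t v. F t v - G t v) (\<lambda>t. f t + g t)"
proof -
  note F = F[unfolded weak_forcing_def] and G = G[unfolded weak_forcing_def]
  have [measurable]: "f \<in> borel_measurable borel" "g \<in> borel_measurable borel" using F G by auto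
  have "integrable lborel (\<lambda>t. 2 * (f t)\<^sup>2 + 2 * (g t)\<^sup>2)" using F G by simp
  then have "integrable lborel (\<lambda>t. (f t + g t)\<^sup>2)"
  proof (rule Bochner_Integration.integrable_bound)
    show "AE t in lborel. norm ((f t + g t)\<^sup>2) \<le> norm (2 * (f t)\<^sup>2 + 2 * (g t)\<^sup>2)"
    proof (rule AE_I2)
      fix t
      show "norm ((f t + g t)\<^sup>2) \<le> norm (2 * (f t)\<^sup>2 + 2 * (g t)\<^sup>2)"
        using sum_squares_bound[of "f t" "g t"] abs_of_nonneg[OF zero_le_power2[of "f t + g t"]]
        by (simp add: power2_sum)
    qed
  qed measurable
  moreover have "AE t in lebesgue_on {0<..<T}. \<forall>v\<in>V_space \<Omega> \<Gamma>. \<bar>F t v - G t v\<bar> \<le> (f t + g t) * V_norm \<Omega> v"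
  proof -
    have "AE t in lebesgue_on {0<..<T}. \<forall>v\<in>V_space \<Omega> \<Gamma>. \<bar>F t v\<bar> \<le> f t * V_norm \<Omega> v"
      "AE t in lebesgue_on {0<..<T}. \<forall>v\<in>V_space \<Omega> \<Gamma>. \<bar>G t v\<bar> \<le> g t * V_norm \<Omega> v" using F G by auto
    then show ?thesis
    proof eventually_elim
      case (elim t)
      show ?case
      proof
        fix v assume "v \<in> V_space \<Omega> \<Gamma>"
        then have "\<bar>F t v\<bar> \<le> f t * V_norm \<Omega> v" "\<bar>G t v\<bar> \<le> g t * V_norm \<Omega> v" using elim by auto
        then show "\<bar>F t v - G t v\<bar> \<le> (f t + g t) * V_norm \<Omega> v" unfolding distrib_right by linarith
      qed
    qed
  qed
  moreover have "AE t in lebesgue_on {0<..<T}. \<forall>v\<in>V_space \<Omega> \<Gamma>. \<forall>w\<in>V_space \<Omega> \<Gamma>.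
      F t (v - w) - G t (v - w) = (F t v - G t v) - (F t w - G t w)"
  proof -
    have "AE t in lebesgue_on {0<..<T}. \<forall>v\<in>V_space \<Omega> \<Gamma>. \<forall>w\<in>V_space \<Omega> \<Gamma>. F t (v - w) = F t v - F t w"
      "AE t in lebesgue_on {0<..<T}. \<forall>v\<in>V_space \<Omega> \<Gamma>. \<forall>w\<in>V_space \<Omega> \<Gamma>. G t (v - w) = G t v - G t w" using F G by auto
    then show ?thesis by eventually_elim simp
  qed
  moreover have "\<forall>w\<in>V_space \<Omega> \<Gamma>. (\<lambda>t. F t w - G t w) \<in> borel_measurable (lebesgue_on {0<..<T})"
    using F G by (intro ballI borel_measurable_diff) blast+
  ultimately show ?thesis unfolding weak_forcing_def using F G by auto
qed

end

section \<open>Continuous representatives\<close>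

text \<open>Every nondegenerate interval has positive measure and so contains a time with the
  property. This also reaches the endpoints 0 and \<open>T\<close>, which the open interval
  omits.\<close>

lemma AE_dense_sequence:
  assumes T: "0 < T" and P: "AE t in lebesgue_on {0<..<T}. P t" and t: "t \<in> {0..T}"
  obtains x :: "nat \<Rightarrow> real" where "\<And>n. x n \<in> {0<..<T}" "\<And>n. P (x n)" "x \<longlonglongrightarrow> t"
proof -
  have ex: "\<exists>x. x \<in> {a<..<b} \<and> P x" if ab: "0 \<le> a" "a < b" "b \<le> T" for a b
  proof (rule ccontr)
    assume n: "\<not> (\<exists>x. x \<in> {a<..<b} \<and> P x)"
    have "AE t in lebesgue. t \<in> {0<..<T} \<longrightarrow> P t" using P by (simp add: AE_restrict_space_iff)
    then have "AE t in lebesgue. t \<notin> {a<..<b}"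
      by eventually_elim (use ab n in auto)
    then have "{a<..<b} \<in> null_sets lebesgue"
      by (subst (asm) AE_iff_null_sets[symmetric]) auto
    then show False using ab by (simp add: null_sets_def)
  qed
  have "\<exists>x. x \<in> {max 0 (t - 1 / Suc n)<..<min T (t + 1 / Suc n)} \<and> P x" for n
  proof (rule ex)
    have "1 / real (Suc n) > 0" by simp
    then show "max 0 (t - 1 / Suc n) < min T (t + 1 / Suc n)"
      using t T unfolding atLeastAtMost_iff  by linarith
  qed auto
  then obtain x where x: "\<And>n. x n \<in> {max 0 (t - 1 / Suc n)<..<min T (t + 1 / Suc n)}" "\<And>n. P (x n)" by metis
  show thesis
  proof (rule that[of x])
    show "x n \<in> {0<..<T}" for n using x(1)[of n] by auto
    show "P (x n)" for n by (rule x)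
    show "x \<longlonglongrightarrow> t"
    proof (rule LIM_zero_cancel, rule Lim_null_comparison[OF _ LIMSEQ_Suc[OF lim_1_over_n]])
      show "\<forall>\<^sub>F n in sequentially. norm (x n - t) \<le> 1 / real (Suc n)"
      proof (intro always_eventually allI)
        fix n show "norm (x n - t) \<le> 1 / real (Suc n)" using x(1)[of n] by (simp add: abs_le_iff)
      qed
    qed
  qed
qed

lemma continuous_zero_if_AE_zero:
  fixes f :: "real \<Rightarrow> real"
  assumes T: "0 < T" and f: "continuous_on {0..T} f" and z: "AE t in lebesgue_on {0<..<T}. f t = 0" and t: "t \<in> {0..T}"
  shows "f t = 0"
proof -
  obtain x where x: "\<And>n. x n \<in> {0<..<T}" "\<And>n. f (x n) = 0" "x \<longlonglongrightarrow> t"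
    using AE_dense_sequence[OF T z t] by metis
  have "x n \<in> {0..T}" for n using x(1)[of n] by simp
  then have "(\<lambda>n. f (x n)) \<longlonglongrightarrow> f t"
    using continuous_on_tendsto_compose[OF f x(3) t] by simp
  then show ?thesis by (simp add: x(2) LIMSEQ_const_iff)
qed

lemma integral_abs_bound_AE:
  fixes p h :: "real \<Rightarrow> real"
  assumes p: "integrable (lebesgue_on {0<..<T}) p" and h: "integrable (lebesgue_on {0<..<T}) h"
    and le: "AE t in lebesgue_on {0<..<T}. t \<in> {a<..<b} \<longrightarrow> \<bar>p t\<bar> \<le> h t" and ab: "0 \<le> a" "b \<le> T"
  shows "\<bar>integral {a..b} p\<bar> \<le> integral {a..b} h"
proof -
  note pi = open_interval_integrable[OF p ab] and hi = open_interval_integrable[OF h ab]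
  have "AE t in lebesgue. t \<in> {0<..<T} \<longrightarrow> t \<in> {a<..<b} \<longrightarrow> \<bar>p t\<bar> \<le> h t" using le by (simp add: AE_restrict_space_iff)
  then have "AE t in lebesgue. t \<in> {a<..<b} \<longrightarrow> \<bar>p t\<bar> \<le> h t"
    by eventually_elim (use ab in auto)
  then have ae: "AE t in lebesgue_on {a<..<b}. \<bar>p t\<bar> \<le> h t" by (simp add: AE_restrict_space_iff)
  have "\<bar>LINT t|lebesgue_on {a<..<b}. p t\<bar> \<le> (LINT t|lebesgue_on {a<..<b}. \<bar>p t\<bar>)"
    using integral_norm_bound[of "lebesgue_on {a<..<b}" p] by simp
  also have "\<dots> \<le> (LINT t|lebesgue_on {a<..<b}. h t)"
    by (rule integral_mono_AE) (use pi hi ae in auto)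
  finally show ?thesis by (simp add: open_interval_LINT[OF p ab] open_interval_LINT[OF h ab])
qed

text \<open>A uniformly continuous map on a dense set of times extends to the closed interval
  because L2 is complete.\<close>

lemma L2_cont_rep_exists:
  fixes e :: "real \<Rightarrow> 'a::euclidean_space \<Rightarrow> real"
  assumes \<Omega>: "\<Omega> \<in> lmeasurable" and T: "0 < T" and full: "AE t in lebesgue_on {0<..<T}. t \<in> G"
    and e: "\<And>t. t \<in> G \<Longrightarrow> e t \<in> L2 \<Omega>"
    and unif: "\<And>\<epsilon>. 0 < \<epsilon> \<Longrightarrow> \<exists>\<delta>>0. \<forall>s\<in>G. \<forall>t\<in>G. \<bar>s - t\<bar> < \<delta> \<longrightarrow> L2_norm \<Omega> (e s - e t) < \<epsilon>"
  shows "\<exists>c. is_cont_rep T \<Omega> e c"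
proof -
  define U where "U \<epsilon> \<delta> \<longleftrightarrow> (\<forall>s\<in>G. \<forall>t\<in>G. \<bar>s - t\<bar> < \<delta> \<longrightarrow> L2_norm \<Omega> (e s - e t) < \<epsilon>)" for \<epsilon> \<delta> :: real
  \<comment> \<open>An admissible value at \<open>t\<close> respects every modulus of continuity
    that \<open>e\<close> has on \<open>G\<close>. The condition does not mention the sequence used
    to construct \<open>f\<close>, so values chosen at different times are compatible.\<close>
  define Q where "Q t f \<longleftrightarrow> f \<in> L2 \<Omega> \<and> (\<forall>\<epsilon> \<delta>. U \<epsilon> \<delta> \<longrightarrow> (\<forall>s\<in>G. \<bar>s - t\<bar> < \<delta> \<longrightarrow> L2_norm \<Omega> (e s - f) \<le> \<epsilon>))" for t f
  have QG: "Q t (e t)" if "t \<in> G" for t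
    using that e by (auto simp: Q_def U_def less_imp_le)
  have "\<exists>f. Q t f" if t: "t \<in> {0..T}" for t
  proof -
    obtain x where x: "\<And>n. x n \<in> {0<..<T}" "\<And>n. x n \<in> G" "x \<longlonglongrightarrow> t"
      using AE_dense_sequence[OF T full t] by metis
    have cau: "\<exists>n0::nat. \<forall>i\<ge>n0. \<forall>j\<ge>n0. L2_norm \<Omega> (e (x i) - e (x j)) < \<epsilon>" if \<epsilon>: "\<epsilon> > 0" for \<epsilon>
    proof -
      obtain \<delta> where \<delta>: "\<delta> > 0" "\<forall>s\<in>G. \<forall>t\<in>G. \<bar>s - t\<bar> < \<delta> \<longrightarrow> L2_norm \<Omega> (e s - e t) < \<epsilon>" using unif[OF \<epsilon>] by blast
      obtain n0 where n0: "\<forall>i\<ge>n0. \<forall>j\<ge>n0. norm (x i - x j) < \<delta>"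
        using LIMSEQ_imp_Cauchy[OF x(3)] \<delta>(1) unfolding Cauchy_iff by blast
      show ?thesis using n0 \<delta>(2) x(2) by (intro exI[of _ n0]) (simp add: real_norm_def)
    qed
    obtain f where f: "f \<in> L2 \<Omega>" "(\<lambda>n. L2_norm \<Omega> (e (x n) - f)) \<longlonglongrightarrow> 0"
      using L2_complete[OF \<Omega>, of "\<lambda>n. e (x n)"] e[OF x(2)] cau by blast
    have "L2_norm \<Omega> (e s - f) \<le> \<epsilon>" if U: "U \<epsilon> \<delta>" and s: "s \<in> G" "\<bar>s - t\<bar> < \<delta>" for \<epsilon> \<delta> s
    proof (rule tendsto_lowerbound)
      show "(\<lambda>n. \<epsilon> + L2_norm \<Omega> (e (x n) - f)) \<longlonglongrightarrow> \<epsilon>"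
        using tendsto_add[OF tendsto_const[of \<epsilon>] f(2)] by simp
      have "(\<lambda>n. \<bar>s - x n\<bar>) \<longlonglongrightarrow> \<bar>s - t\<bar>" by (intro tendsto_intros x)
      from order_tendstoD(2)[OF this s(2)]
      show "\<forall>\<^sub>F n in sequentially. L2_norm \<Omega> (e s - f) \<le> \<epsilon> + L2_norm \<Omega> (e (x n) - f)"
      proof eventually_elim
        case (elim n)
        have "L2_norm \<Omega> (e s - e (x n)) < \<epsilon>" using U s(1) x(2) elim by (simp add: U_def)
        then show ?case
          using L2.norm_triangle[OF e[OF s(1)] e[OF x(2)[of n]] f(1)] by linarith
      qed
    qed simp
    then show ?thesis using f(1) by (auto simp: Q_def)
  qed
  then obtain f where f: "\<And>t. t \<in> {0..T} \<Longrightarrow> Q t (f t)" by metis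
  \<comment> \<open>Keeping \<open>e\<close> itself on \<open>G\<close> makes the agreement almost
    everywhere immediate.\<close>
  define c where "c t = (if t \<in> G then e t else f t)" for t
  have c: "Q t (c t)" if "t \<in> {0..T}" for t using that f QG by (simp add: c_def)
  have cL: "c t \<in> L2 \<Omega>" if "t \<in> {0..T}" for t using c[OF that] by (simp add: Q_def)
  have close: "L2_norm \<Omega> (c s - c t) \<le> 2 * \<epsilon>"
    if U: "U \<epsilon> \<delta>" and \<delta>: "0 < \<delta>" and st: "s \<in> {0..T}" "t \<in> {0..T}" "\<bar>s - t\<bar> < \<delta> / 2" for s t \<epsilon> \<delta>
  proof -
    obtain x where x: "\<And>n. x n \<in> G" "x \<longlonglongrightarrow> t" using AE_dense_sequence[OF T full st(2)] by metis
    have "(\<lambda>n. \<bar>x n - t\<bar>) \<longlonglongrightarrow> \<bar>t - t\<bar>" by (intro tendsto_intros x)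
    then have "\<forall>\<^sub>F n in sequentially. \<bar>x n - t\<bar> < \<delta> / 2" using \<delta> by (intro order_tendstoD(2)) auto
    then obtain n where n: "\<bar>x n - t\<bar> < \<delta> / 2" using eventually_happens'[OF trivial_limit_sequentially] by blast
    have "\<bar>x n - s\<bar> < \<delta>" "\<bar>x n - t\<bar> < \<delta>" using n st(3) \<delta> by linarith+
    then have "L2_norm \<Omega> (e (x n) - c s) \<le> \<epsilon>" "L2_norm \<Omega> (e (x n) - c t) \<le> \<epsilon>"
      using c[OF st(1)] c[OF st(2)] U x(1) unfolding Q_def by blast+
    moreover have "L2_norm \<Omega> (c s - c t) \<le> L2_norm \<Omega> (c s - e (x n)) + L2_norm \<Omega> (e (x n) - c t)"
      by (intro L2.norm_triangle cL st e x)
    moreover have "L2_norm \<Omega> (c s - e (x n)) = L2_norm \<Omega> (e (x n) - c s)"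
      by (intro L2.norm_minus_commute cL st e x)
    ultimately show ?thesis by linarith
  qed
  have "is_cont_rep T \<Omega> e c"
    unfolding is_cont_rep_def
  proof (intro conjI ballI)
    show "c t \<in> L2 \<Omega>" if "t \<in> {0..T}" for t using that by (rule cL)
    show "((\<lambda>s. L2_norm \<Omega> (c s - c t)) \<longlongrightarrow> 0) (at t within {0..T})" if t: "t \<in> {0..T}" for t
      unfolding tendsto_iff
    proof (intro allI impI)
      fix \<epsilon> :: real assume \<epsilon>: "0 < \<epsilon>"
      then obtain \<delta> where \<delta>: "\<delta> > 0" "U (\<epsilon> / 3) \<delta>" using unif[of "\<epsilon> / 3"] by (auto simp: U_def)
      show "\<forall>\<^sub>F s in at t within {0..T}. dist (L2_norm \<Omega> (c s - c t)) 0 < \<epsilon>"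
        unfolding eventually_at
      proof (intro exI[of _ "\<delta> / 2"] conjI ballI impI)
        show "0 < \<delta> / 2" using \<delta> by simp
        fix s assume "s \<in> {0..T}" "s \<noteq> t \<and> dist s t < \<delta> / 2"
        then have "L2_norm \<Omega> (c s - c t) \<le> 2 * (\<epsilon> / 3)"
          using \<delta> t by (intro close) (auto simp: dist_real_def)
        then show "dist (L2_norm \<Omega> (c s - c t)) 0 < \<epsilon>" using \<epsilon> by simp
      qed
    qed
    show "AE t in lebesgue_on {0<..<T}. AE x in lebesgue_on \<Omega>. c t x = e t x"
      using full by eventually_elim (simp add: c_def)
  qed
  then show ?thesis by blast
qed

lemma is_cont_rep_L2_norm_continuous:
  assumes c: "is_cont_rep T \<Omega> v c"
  shows "continuous_on {0..T} (\<lambda>t. L2_norm \<Omega> (c t))"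
  unfolding continuous_on_def
proof
  fix t assume t: "t \<in> {0..T}"
  have cL: "c s \<in> L2 \<Omega>" if "s \<in> {0..T}" for s using c that by (auto simp: is_cont_rep_def)
  show "((\<lambda>s. L2_norm \<Omega> (c s)) \<longlongrightarrow> L2_norm \<Omega> (c t)) (at t within {0..T})"
  proof (rule LIM_zero_cancel, rule Lim_null_comparison)
    show "((\<lambda>s. L2_norm \<Omega> (c s - c t)) \<longlongrightarrow> 0) (at t within {0..T})" using c t by (auto simp: is_cont_rep_def)
    show "\<forall>\<^sub>F s in at t within {0..T}. norm (L2_norm \<Omega> (c s) - L2_norm \<Omega> (c t)) \<le> L2_norm \<Omega> (c s - c t)"
      unfolding eventually_at_filter real_norm_def
      by (intro always_eventually allI impI L2.abs_norm_diff_le cL t)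
  qed
qed

lemma is_cont_rep_minus:
  assumes c: "is_cont_rep T \<Omega> v c" and d: "is_cont_rep T \<Omega> w d"
  shows "is_cont_rep T \<Omega> (\<lambda>t. v t - w t) (\<lambda>t. c t - d t)"
  unfolding is_cont_rep_def
proof (intro conjI ballI)
  have cL: "c t \<in> L2 \<Omega>" "d t \<in> L2 \<Omega>" if "t \<in> {0..T}" for t using c d that by (auto simp: is_cont_rep_def)
  then show "c t - d t \<in> L2 \<Omega>" if "t \<in> {0..T}" for t using that by (intro L2_minus)
  show "((\<lambda>s. L2_norm \<Omega> ((c s - d s) - (c t - d t))) \<longlongrightarrow> 0) (at t within {0..T})" if t: "t \<in> {0..T}" for t
  proof (rule Lim_null_comparison)
    show "\<forall>\<^sub>F s in at t within {0..T}. norm (L2_norm \<Omega> ((c s - d s) - (c t - d t))) \<le> L2_norm \<Omega> (c s - c t) + L2_norm \<Omega> (d s - d t)"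
      unfolding eventually_at_filter
      using L2.norm_minus_minus[OF cL(1) cL(2) cL(1) cL(2), OF _ _ t t]
      by (intro always_eventually allI impI) simp
    have "((\<lambda>s. L2_norm \<Omega> (c s - c t) + L2_norm \<Omega> (d s - d t)) \<longlongrightarrow> 0 + 0) (at t within {0..T})"
      using c d t by (intro tendsto_add) (auto simp: is_cont_rep_def)
    then show "((\<lambda>s. L2_norm \<Omega> (c s - c t) + L2_norm \<Omega> (d s - d t)) \<longlongrightarrow> 0) (at t within {0..T})" by simp
  qed
  have "AE t in lebesgue_on {0<..<T}. AE x in lebesgue_on \<Omega>. c t x = v t x"
    "AE t in lebesgue_on {0<..<T}. AE x in lebesgue_on \<Omega>. d t x = w t x" using c d by (auto simp: is_cont_rep_def)
  then show "AE t in lebesgue_on {0<..<T}. AE x in lebesgue_on \<Omega>. (c t - d t) x = (v t - w t) x"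
  proof eventually_elim
    case (elim t)
    then show ?case by eventually_elim simp
  qed
qed

text \<open>The distance of two representatives is continuous and vanishes almost everywhere, hence
  also at the endpoints. So point values of the choice \<open>cont_rep\<close> are determined up to
  null sets of \<Omega>.\<close>

lemma is_cont_rep_unique:
  assumes T: "0 < T" and c: "is_cont_rep T \<Omega> v c" and d: "is_cont_rep T \<Omega> v d" and t: "t \<in> {0..T}"
  shows "AE x in lebesgue_on \<Omega>. c t x = d t x"
proof -
  let ?n = "\<lambda>t. L2_norm \<Omega> (c t - d t)"
  have cd: "c t - d t \<in> L2 \<Omega>" if "t \<in> {0..T}" for t
    using c d that by (auto simp: is_cont_rep_def intro: L2_minus)
  have "continuous_on {0..T} ?n" by (rule is_cont_rep_L2_norm_continuous[OF is_cont_rep_minus[OF c d]])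
  moreover have "AE t in lebesgue_on {0<..<T}. ?n t = 0"
  proof -
    have "AE t in lebesgue_on {0<..<T}. AE x in lebesgue_on \<Omega>. c t x = v t x"
      "AE t in lebesgue_on {0<..<T}. AE x in lebesgue_on \<Omega>. d t x = v t x"
      "AE t in lebesgue_on {0<..<T}. t \<in> space (lebesgue_on {0<..<T})"
      using c d by (auto simp: is_cont_rep_def)
    then show ?thesis
    proof eventually_elim
      case (elim t)
      have "AE x in lebesgue_on \<Omega>. (c t - d t) x = 0" using elim(1,2) by eventually_elim simp
      moreover have "t \<in> {0..T}" using elim(3) by simp
      ultimately show ?case using L2_norm_eq_0_iff[OF cd] by blast
    qed
  qed
  ultimately have "?n t = 0" using continuous_zero_if_AE_zero[OF T] t by blast
  then have "AE x in lebesgue_on \<Omega>. (c t - d t) x = 0" using L2_norm_eq_0_iff[OF cd[OF t]] by blast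
  then show ?thesis by eventually_elim simp
qed

section \<open>The energy identity\<close>

text \<open>Everything about \<open>F\<close> and \<open>e\<close> holds at each time in
  \<open>G\<close> for all of \<open>V\<close> simultaneously. The order of quantifiers in
  \<open>weak\<close> permits test functions that depend on the two times, such as
  \<open>e t1\<close>.\<close>

locale regular_evolution = bounded_open_set \<Omega> + B: regular_bochner "V_space \<Omega> \<Gamma>" "V_norm \<Omega>" T e s G
  for \<Omega> :: "'a::euclidean_space set" and \<Gamma> T e s G +
  fixes F :: "real \<Rightarrow> ('a \<Rightarrow> real) \<Rightarrow> real" and g :: "real \<Rightarrow> real"
  assumes T_pos: "0 < T"
    and g_measurable [measurable]: "g \<in> borel_measurable borel" and g_nonneg: "0 \<le> g t"
    and g_square_integrable: "integrable lborel (\<lambda>t. (g t)\<^sup>2)"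
    and F_bound: "t \<in> G \<Longrightarrow> v \<in> V_space \<Omega> \<Gamma> \<Longrightarrow> \<bar>F t v\<bar> \<le> g t * V_norm \<Omega> v"
    and F_diff: "t \<in> G \<Longrightarrow> v \<in> V_space \<Omega> \<Gamma> \<Longrightarrow> w \<in> V_space \<Omega> \<Gamma> \<Longrightarrow> F t (v - w) = F t v - F t w"
    and F_measurable: "w \<in> V_space \<Omega> \<Gamma> \<Longrightarrow> (\<lambda>t. F t w) \<in> borel_measurable (lebesgue_on {0<..<T})"
    and G_full: "AE t in lborel. t \<in> {0<..<T} \<longrightarrow> t \<in> G"
    and inner_measurable: "w \<in> V_space \<Omega> \<Gamma> \<Longrightarrow> (\<lambda>t. L2_inner \<Omega> (e t) w) \<in> borel_measurable (lebesgue_on {0<..<T})"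
    and weak: "t1 \<in> G \<Longrightarrow> t2 \<in> G \<Longrightarrow> t1 \<le> t2 \<Longrightarrow> w \<in> V_space \<Omega> \<Gamma> \<Longrightarrow>
      L2_inner \<Omega> (e t2) w - L2_inner \<Omega> (e t1) w = integral {t1..t2} (\<lambda>r. F r w)"

lemma integrable_lborel_imp_lebesgue_on:
  fixes h :: "real \<Rightarrow> real"
  assumes "integrable lborel h"
  shows "integrable (lebesgue_on {0<..<T}) h"
proof -
  have "integrable lebesgue h" using assms by (simp add: integrable_completion borel_measurable_integrable)
  then have "integrable lebesgue (\<lambda>t. indicator {0<..<T} t *\<^sub>R h t)" by (intro integrable_mult_indicator) auto
  then show ?thesis by (simp add: integrable_restrict_space)
qed

context bounded_open_set
begin

lemma integrable_forcing:
  assumes F: "weak_forcing \<Gamma> T F g" and w: "w \<in> V_space \<Omega> \<Gamma>"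
  shows "integrable (lebesgue_on {0<..<T}) g" and "integrable (lebesgue_on {0<..<T}) (\<lambda>t. F t w)"
proof -
  note F = F[unfolded weak_forcing_def]
  have gm: "g \<in> borel_measurable (lebesgue_on {0<..<T})"
    using F by (intro measurable_restrict_space1) (simp add: measurable_completion)
  have "integrable (lebesgue_on {0<..<T}) (\<lambda>t. (g t)\<^sup>2)"
    using F by (intro integrable_lborel_imp_lebesgue_on) blast
  from L2_imp_integrable_abs[OF gm this] show g: "integrable (lebesgue_on {0<..<T}) g" using F by simp
  have "integrable (lebesgue_on {0<..<T}) (\<lambda>t. g t * V_norm \<Omega> w)" using g by simp
  then show "integrable (lebesgue_on {0<..<T}) (\<lambda>t. F t w)"
  proof (rule Bochner_Integration.integrable_bound)
    have "AE t in lebesgue_on {0<..<T}. \<forall>v\<in>V_space \<Omega> \<Gamma>. \<bar>F t v\<bar> \<le> g t * V_norm \<Omega> v" using F by blast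
    then show "AE t in lebesgue_on {0<..<T}. norm (F t w) \<le> norm (g t * V_norm \<Omega> w)"
    proof eventually_elim
      case (elim t)
      then show ?case using w by (simp add: order_trans[OF _ abs_ge_self])
    qed
    show "(\<lambda>t. F t w) \<in> borel_measurable (lebesgue_on {0<..<T})" using F w by blast
  qed
qed

text \<open>For each \<open>w\<close>, \<open>du_bois_reymond\<close> gives an identity off its own
  null set. For a countable dense set these null sets can be united, and continuity in
  \<open>w\<close> extends the increments to all of \<open>V\<close>; the constant
  \<open>c w\<close>, whose dependence on \<open>w\<close> is uncontrolled, cancels in the
  increments.\<close>

lemma regular_evolution_exists:
  assumes T: "0 < T" and e: "e \<in> L2_V T \<Omega> \<Gamma>" and F: "weak_forcing \<Gamma> T F g"
    and d: "has_time_deriv T \<Omega> \<Gamma> e F"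
  obtains s G where "regular_evolution \<Omega> \<Gamma> T e s G F g"
proof -
  let ?M = "lebesgue_on {0<..<T}" and ?V = "V_space \<Omega> \<Gamma>"
  note F' = F[unfolded weak_forcing_def]
  note Fint = integrable_forcing(2)[OF F] and gint = integrable_forcing(1)[OF F V_space_zero]
  have "\<exists>c. AE t in ?M. L2_inner \<Omega> (e t) w = c + integral {0..t} (\<lambda>r. F r w)" if w: "w \<in> ?V" for w
    using du_bois_reymond[OF T Fint[OF w], of "\<lambda>t. L2_inner \<Omega> (e t) w"] d w
    unfolding has_time_deriv_def by blast
  then obtain c where c: "\<And>w. w \<in> ?V \<Longrightarrow> AE t in ?M. L2_inner \<Omega> (e t) w = c w + integral {0..t} (\<lambda>r. F r w)" by metis
  obtain S where S: "countable S" "S \<subseteq> ?V"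
    "\<And>v e. v \<in> ?V \<Longrightarrow> e > 0 \<Longrightarrow> \<exists>s\<in>S. L2_norm \<Omega> (v - s) < e \<and> V_norm \<Omega> (v - s) < e"
    using W12_subset_separable[of ?V] V_space_imp_W12 by (metis subsetI)
  have "AE t in ?M. \<forall>w\<in>S. L2_inner \<Omega> (e t) w = c w + integral {0..t} (\<lambda>r. F r w)"
    using S(1,2) c by (subst AE_ball_countable) auto
  moreover have "AE t in ?M. \<forall>v\<in>?V. \<bar>F t v\<bar> \<le> g t * V_norm \<Omega> v"
    "AE t in ?M. \<forall>v\<in>?V. \<forall>w\<in>?V. F t (v - w) = F t v - F t w" using F' by blast+
  ultimately have "AE t in ?M. (\<forall>w\<in>S. L2_inner \<Omega> (e t) w = c w + integral {0..t} (\<lambda>r. F r w)) \<and>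
     (\<forall>v\<in>?V. \<bar>F t v\<bar> \<le> g t * V_norm \<Omega> v) \<and> (\<forall>v\<in>?V. \<forall>w\<in>?V. F t (v - w) = F t v - F t w)"
    by eventually_elim blast
  then obtain s G where B: "regular_bochner ?V (V_norm \<Omega>) T e s G"
    and G: "\<And>t. t \<in> G \<Longrightarrow> (\<forall>w\<in>S. L2_inner \<Omega> (e t) w = c w + integral {0..t} (\<lambda>r. F r w)) \<and>
     (\<forall>v\<in>?V. \<bar>F t v\<bar> \<le> g t * V_norm \<Omega> v) \<and> (\<forall>v\<in>?V. \<forall>w\<in>?V. F t (v - w) = F t v - F t w)"
    and full: "AE t in lborel. t \<in> {0<..<T} \<longrightarrow> t \<in> G"
    using V.L2_Bochner_regular[OF e] by blast
  interpret B: regular_bochner ?V "V_norm \<Omega>" T e s G by (rule B)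
  have eL: "e t \<in> L2 \<Omega>" if "t \<in> G" for t using B.u_mem[OF that] by (rule V_space_imp_L2)
  have fullM: "AE t in ?M. t \<in> G" by (rule AE_lebesgue_onI_lborel) (use full in auto)
  have weak: "L2_inner \<Omega> (e t2) w - L2_inner \<Omega> (e t1) w = integral {t1..t2} (\<lambda>r. F r w)"
    if t: "t1 \<in> G" "t2 \<in> G" "t1 \<le> t2" and w: "w \<in> ?V" for t1 t2 w
  proof -
    have tI: "0 \<le> t1" "t2 \<le> T" using t B.G_subset by auto
    have weakS: "L2_inner \<Omega> (e t2) v - L2_inner \<Omega> (e t1) v = integral {t1..t2} (\<lambda>r. F r v)" if v: "v \<in> S" for v
    proof -
      have "integral {0..t1} (\<lambda>r. F r v) + integral {t1..t2} (\<lambda>r. F r v) = integral {0..t2} (\<lambda>r. F r v)"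
        using tI t v S(2) by (intro Henstock_Kurzweil_Integration.integral_combine open_interval_integrable_on[OF Fint]) auto
      then show ?thesis using G[OF t(1)] G[OF t(2)] v by simp
    qed
    \<comment> \<open>Bound for the change of the defect in \<open>w\<close> when both norms of the
      change are below \<epsilon>: two inner products and the integrated forcing.\<close>
    define A where "A = L2_norm \<Omega> (e t2) + L2_norm \<Omega> (e t1) + integral {t1..t2} g"
    have A0: "0 \<le> A"
      unfolding A_def using F' tI by (intro add_nonneg_nonneg L2_norm_nonneg integral_nonneg open_interval_integrable_on[OF gint]) auto
    have est: "\<bar>L2_inner \<Omega> (e t2) w - L2_inner \<Omega> (e t1) w - integral {t1..t2} (\<lambda>r. F r w)\<bar> \<le> A * \<epsilon>" if \<epsilon>: "0 < \<epsilon>" for \<epsilon>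
    proof -
      obtain v where v: "v \<in> S" "L2_norm \<Omega> (w - v) < \<epsilon>" "V_norm \<Omega> (w - v) < \<epsilon>" using S(3)[OF w \<epsilon>] by blast
      have vV: "v \<in> ?V" using v S(2) by auto
      have wvV: "w - v \<in> ?V" by (rule V_space_minus[OF w vV])
      have wL: "w \<in> L2 \<Omega>" "v \<in> L2 \<Omega>" using w vV by (auto intro: V_space_imp_L2)
      have wvL: "w - v \<in> L2 \<Omega>" by (rule L2_minus[OF wL])
      have cs: "\<bar>L2_inner \<Omega> (e t) w - L2_inner \<Omega> (e t) v\<bar> \<le> L2_norm \<Omega> (e t) * \<epsilon>" if "t \<in> G" for t
      proof -
        have "\<bar>L2_inner \<Omega> (e t) (w - v)\<bar> \<le> L2_norm \<Omega> (e t) * L2_norm \<Omega> (w - v)"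
          by (rule L2_Cauchy_Schwarz[OF eL[OF that] wvL])
        also have "\<dots> \<le> L2_norm \<Omega> (e t) * \<epsilon>" using v by (intro mult_left_mono) auto
        finally show ?thesis using L2_inner_diff_right[OF wL eL[OF that]] by simp
      qed
      have "integral {t1..t2} (\<lambda>r. F r w) - integral {t1..t2} (\<lambda>r. F r v) = integral {t1..t2} (\<lambda>r. F r w - F r v)"
        using w vV tI by (intro Henstock_Kurzweil_Integration.integral_diff[symmetric] open_interval_integrable_on[OF Fint]) auto
      moreover have "\<bar>integral {t1..t2} (\<lambda>r. F r w - F r v)\<bar> \<le> integral {t1..t2} (\<lambda>r. \<epsilon> * g r)"
      proof (rule integral_abs_bound_AE[OF _ _ _ tI])
        show "integrable ?M (\<lambda>r. F r w - F r v)" using Fint[OF w] Fint[OF vV] by simp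
        show "integrable ?M (\<lambda>r. \<epsilon> * g r)" using gint by simp
        show "AE t in ?M. t \<in> {t1<..<t2} \<longrightarrow> \<bar>F t w - F t v\<bar> \<le> \<epsilon> * g t"
          using fullM
        proof eventually_elim
          case (elim t)
          have "\<bar>F t w - F t v\<bar> \<le> g t * V_norm \<Omega> (w - v)" using G[OF elim] w vV wvV by metis
          also have "\<dots> \<le> g t * \<epsilon>" using v F' by (intro mult_left_mono) auto
          finally show ?case by (simp add: mult.commute)
        qed
      qed
      ultimately have "\<bar>integral {t1..t2} (\<lambda>r. F r w) - integral {t1..t2} (\<lambda>r. F r v)\<bar> \<le> integral {t1..t2} g * \<epsilon>"
        by (simp add: mult.commute)
      with cs[OF t(1)] cs[OF t(2)] weakS[OF v(1)] show ?thesis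
        unfolding A_def distrib_right by linarith
    qed
    have "\<bar>L2_inner \<Omega> (e t2) w - L2_inner \<Omega> (e t1) w - integral {t1..t2} (\<lambda>r. F r w)\<bar> \<le> 0"
    proof (rule field_le_epsilon)
      fix \<eta> :: real assume "0 < \<eta>"
      have "A * (\<eta> / (A + 1)) \<le> \<eta>" using \<open>0 < \<eta>\<close> A0 by (simp add: field_simps)
      then show "\<bar>L2_inner \<Omega> (e t2) w - L2_inner \<Omega> (e t1) w - integral {t1..t2} (\<lambda>r. F r w)\<bar> \<le> 0 + \<eta>"
        using est[of "\<eta> / (A + 1)"] \<open>0 < \<eta>\<close> A0 by simp
    qed
    then show ?thesis by simp
  qed
  have inner_meas: "(\<lambda>t. L2_inner \<Omega> (e t) w) \<in> borel_measurable ?M" if w: "w \<in> ?V" for w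
  proof (rule borel_measurable_lebesgue_on_cong_AE)
    have "continuous_on {0..T} (\<lambda>t. integral {0..t} (\<lambda>r. F r w))"
      using open_interval_integrable_on[OF Fint[OF w]] T by (intro indefinite_integral_continuous_1) auto
    then have "continuous_on {0<..<T} (\<lambda>t. c w + integral {0..t} (\<lambda>r. F r w))"
      by (intro continuous_intros) (auto elim: continuous_on_subset)
    then show "(\<lambda>t. c w + integral {0..t} (\<lambda>r. F r w)) \<in> borel_measurable ?M"
      by (rule continuous_imp_measurable_on_sets_lebesgue) simp
    show "AE t in ?M. c w + integral {0..t} (\<lambda>r. F r w) = L2_inner \<Omega> (e t) w"
      using c[OF w] by eventually_elim simp
  qed simp
  have "regular_evolution \<Omega> \<Gamma> T e s G F g"
  proof unfold_locales
    show "\<And>t v. t \<in> G \<Longrightarrow> v \<in> ?V \<Longrightarrow> \<bar>F t v\<bar> \<le> g t * V_norm \<Omega> v" using G by blast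
    show "\<And>t v w. t \<in> G \<Longrightarrow> v \<in> ?V \<Longrightarrow> w \<in> ?V \<Longrightarrow> F t (v - w) = F t v - F t w" using G by blast
  qed (use T F' full inner_meas weak in auto)
  then show thesis by (rule that)
qed

end

context regular_evolution
begin

lemma G_fullM: "AE t in lebesgue_on {0<..<T}. t \<in> G"
  by (rule AE_lebesgue_onI_lborel) (use G_full in auto)

lemma forcing: "weak_forcing \<Gamma> T F g"
  unfolding weak_forcing_def
  using g_nonneg g_square_integrable F_measurable
    eventually_mono[OF G_fullM, of "\<lambda>t. \<forall>v\<in>V_space \<Omega> \<Gamma>. \<bar>F t v\<bar> \<le> g t * V_norm \<Omega> v"] F_bound
    eventually_mono[OF G_fullM, of "\<lambda>t. \<forall>v\<in>V_space \<Omega> \<Gamma>. \<forall>w\<in>V_space \<Omega> \<Gamma>. F t (v - w) = F t v - F t w"] F_diff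
  by simp

lemma G_bounds: "t \<in> G \<Longrightarrow> 0 < t \<and> t < T" using B.G_subset by auto

lemma e_mem: "t \<in> G \<Longrightarrow> e t \<in> V_space \<Omega> \<Gamma>" by (rule B.u_mem)

lemma e_L2: "t \<in> G \<Longrightarrow> e t \<in> L2 \<Omega>" by (rule V_space_imp_L2[OF e_mem])

lemma F_integrable: "w \<in> V_space \<Omega> \<Gamma> \<Longrightarrow> integrable (lebesgue_on {0<..<T}) (\<lambda>t. F t w)"
  and g_integrable: "integrable (lebesgue_on {0<..<T}) g"
  using integrable_forcing[OF forcing] V_space_zero by blast+

lemmas g2_integrable = integrable_lborel_imp_lebesgue_on[OF g_square_integrable, where T=T]
  and norm_at2_integrable = integrable_lborel_imp_lebesgue_on[OF B.norm_at_square_integrable, where T=T]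

lemma borel_measurable_M:
  fixes h :: "real \<Rightarrow> real"
  shows "h \<in> borel_measurable borel \<Longrightarrow> h \<in> borel_measurable (lebesgue_on {0<..<T})"
  by (intro measurable_restrict_space1) (simp add: measurable_completion)

lemma norm_at_integrable: "integrable (lebesgue_on {0<..<T}) B.norm_at"
  using L2_imp_integrable_abs[OF borel_measurable_M[OF B.norm_at_measurable] norm_at2_integrable] B.norm_at_nonneg by simp

lemma g_norm_at_integrable: "integrable (lebesgue_on {0<..<T}) (\<lambda>t. g t * B.norm_at t)"
proof (rule Bochner_Integration.integrable_bound)
  show "integrable (lebesgue_on {0<..<T}) (\<lambda>t. (g t)\<^sup>2 + (B.norm_at t)\<^sup>2)"
    using g2_integrable norm_at2_integrable by simp
  show "(\<lambda>t. g t * B.norm_at t) \<in> borel_measurable (lebesgue_on {0<..<T})"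
    by (intro borel_measurable_M) measurable
  show "AE t in lebesgue_on {0<..<T}. norm (g t * B.norm_at t) \<le> norm ((g t)\<^sup>2 + (B.norm_at t)\<^sup>2)"
  proof (rule AE_I2)
    fix t
    have "0 \<le> g t * B.norm_at t" "2 * g t * B.norm_at t \<le> (g t)\<^sup>2 + (B.norm_at t)\<^sup>2"
      using g_nonneg B.norm_at_nonneg by (auto intro: sum_squares_bound)
    then show "norm (g t * B.norm_at t) \<le> norm ((g t)\<^sup>2 + (B.norm_at t)\<^sup>2)" by simp
  qed
qed

text \<open>Set to 0 off \<open>G\<close>, so that the bound by \<open>g\<close> and
  \<open>B.norm_at\<close> holds at every time.\<close>

definition pairing :: "real \<Rightarrow> real" where "pairing t = (if t \<in> G then F t (e t) else 0)"

lemma pairing_bound: "\<bar>pairing t\<bar> \<le> g t * B.norm_at t"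
  using F_bound[OF _ e_mem] by (simp add: pairing_def B.norm_at_def)

lemma pairing_integrable: "integrable (lebesgue_on {0<..<T}) pairing"
proof (rule Bochner_Integration.integrable_bound[OF g_norm_at_integrable])
  show "AE t in lebesgue_on {0<..<T}. norm (pairing t) \<le> norm (g t * B.norm_at t)"
    using pairing_bound g_nonneg B.norm_at_nonneg by (intro AE_I2) simp
  show "pairing \<in> borel_measurable (lebesgue_on {0<..<T})"
  proof (rule borel_measurable_lebesgue_on_LIMSEQ_AE)
    show "(\<lambda>t. F t (s n t)) \<in> borel_measurable (lebesgue_on {0<..<T})" for n
    proof -
      have fin: "finite (range (s n))" using simple_functionD(1)[OF B.simple] by simp
      \<comment> \<open>A simple function feeds finitely many arguments into \<open>F t\<close>, so
        measurability of \<open>F t x\<close> for fixed \<open>x\<close> suffices.\<close>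
      have "(\<lambda>t. \<Sum>x\<in>range (s n). indicator (s n -` {x}) t * F t x) \<in> borel_measurable (lebesgue_on {0<..<T})"
      proof (intro borel_measurable_sum borel_measurable_times F_measurable borel_measurable_M)
        fix x assume "x \<in> range (s n)"
        then show "x \<in> V_space \<Omega> \<Gamma>" using B.s_mem by auto
        have "s n -` {x} \<inter> space lborel \<in> sets lborel" by (rule simple_functionD(2)[OF B.simple])
        then show "indicator (s n -` {x}) \<in> borel_measurable borel" by simp
      qed
      moreover have "(\<Sum>x\<in>range (s n). indicator (s n -` {x}) t * F t x) = F t (s n t)" for t
      proof -
        have "(\<Sum>x\<in>range (s n). indicator (s n -` {x}) t * F t x) = (\<Sum>x\<in>range (s n). if x = s n t then F t x else 0)"
          by (intro sum.cong) (auto simp: indicator_def)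
        then show ?thesis using fin by simp
      qed
      ultimately show ?thesis by simp
    qed
    show "AE t in lebesgue_on {0<..<T}. (\<lambda>n. F t (s n t)) \<longlonglongrightarrow> pairing t"
      using G_fullM
    proof eventually_elim
      case (elim t)
      have "(\<lambda>n. F t (s n t)) \<longlonglongrightarrow> F t (e t)"
      proof (rule LIM_zero_cancel, rule Lim_null_comparison)
        show "\<forall>\<^sub>F n in sequentially. norm (F t (s n t) - F t (e t)) \<le> g t * V_norm \<Omega> (s n t - e t)"
          using F_bound[OF elim V_space_minus[OF B.s_mem e_mem[OF elim]]] F_diff[OF elim B.s_mem e_mem[OF elim]] by simp
        show "(\<lambda>n. g t * V_norm \<Omega> (s n t - e t)) \<longlonglongrightarrow> 0"
          by (rule tendsto_mult_right_zero[OF B.conv[OF elim]])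
      qed
      then show ?case using elim by (simp add: pairing_def)
    qed
  qed simp
qed

abbreviation sq :: "real \<Rightarrow> real" where "sq t \<equiv> (L2_norm \<Omega> (e t))\<^sup>2"

text \<open>Since \<open>\<parallel>b\<parallel>\<^sup>2 - \<parallel>a\<parallel>\<^sup>2 = (b - a, b) + (b - a, a)\<close>, the weak identity may be tested with both endpoints.\<close>

lemma sq_diff:
  assumes "t1 \<in> G" "t2 \<in> G" "t1 \<le> t2"
  shows "sq t2 - sq t1 = integral {t1..t2} (\<lambda>r. F r (e t1)) + integral {t1..t2} (\<lambda>r. F r (e t2))"
  using weak[OF assms e_mem[OF assms(1)]] weak[OF assms e_mem[OF assms(2)]]
  by (simp add: L2_norm_sq L2_inner_commute[of \<Omega> "e t2" "e t1"])

text \<open>By \<open>sq_diff\<close> the increment is the integral of the differences F r (e t1) -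
  F r (e r) and F r (e t2) - F r (e r), each bounded by \<open>g r\<close> times a gap. This is the
  estimate that \<open>ex_const_if_increment_bound\<close> asks for, with \<open>B.gap\<close> as
  \<open>D\<close>.\<close>

lemma sq_increment_bound:
  assumes t: "t1 \<in> G" "t2 \<in> G" "t1 < t2"
  shows "ennreal \<bar>(sq t2 - 2 * integral {0..t2} pairing) - (sq t1 - 2 * integral {0..t1} pairing)\<bar> \<le>
    (\<integral>\<^sup>+r. indicator {t1..t2} r * ennreal (g r * (B.gap t1 r + B.gap t2 r)) \<partial>lborel)"
proof -
  let ?J = "{t1<..<t2}" and ?p = "\<lambda>r. F r (e t1) + F r (e t2) - 2 * pairing r"
  have tI: "0 \<le> t1" "t2 \<le> T" "0 \<le> t2" using t G_bounds[of t1] G_bounds[of t2] by auto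
  have i: "integrable (lebesgue_on {0<..<T}) (\<lambda>r. F r (e t1))" "integrable (lebesgue_on {0<..<T}) (\<lambda>r. F r (e t2))"
    using t by (auto intro: F_integrable e_mem)
  have ip: "integrable (lebesgue_on {0<..<T}) ?p" using i pairing_integrable by simp
  have "integral {0..t1} pairing + integral {t1..t2} pairing = integral {0..t2} pairing"
    using tI t by (intro Henstock_Kurzweil_Integration.integral_combine open_interval_integrable_on[OF pairing_integrable]) auto
  then have "(sq t2 - 2 * integral {0..t2} pairing) - (sq t1 - 2 * integral {0..t1} pairing) =
      integral {t1..t2} (\<lambda>r. F r (e t1)) + integral {t1..t2} (\<lambda>r. F r (e t2)) - 2 * integral {t1..t2} pairing"
    using sq_diff[of t1 t2] t by simp
  also have "\<dots> = (LINT r|lebesgue_on ?J. F r (e t1)) + (LINT r|lebesgue_on ?J. F r (e t2)) - 2 * (LINT r|lebesgue_on ?J. pairing r)"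
    using tI by (simp add: open_interval_LINT[OF i(1)] open_interval_LINT[OF i(2)] open_interval_LINT[OF pairing_integrable])
  also have "\<dots> = (LINT r|lebesgue_on ?J. ?p r)"
    using open_interval_integrable[OF i(1) tI(1,2)] open_interval_integrable[OF i(2) tI(1,2)]
      open_interval_integrable[OF pairing_integrable tI(1,2)] by simp
  finally have "ennreal \<bar>(sq t2 - 2 * integral {0..t2} pairing) - (sq t1 - 2 * integral {0..t1} pairing)\<bar> = ennreal \<bar>LINT r|lebesgue_on ?J. ?p r\<bar>"
    by simp
  also have "\<dots> \<le> (\<integral>\<^sup>+r. ennreal \<bar>?p r\<bar> \<partial>lebesgue_on ?J)"
    using integral_norm_bound_ennreal[OF open_interval_integrable[OF ip tI(1,2)]] by simp
  also have "\<dots> = (\<integral>\<^sup>+r. ennreal \<bar>?p r\<bar> * indicator ?J r \<partial>lebesgue)"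
    by (rule nn_integral_restrict_space) simp
  also have "\<dots> \<le> (\<integral>\<^sup>+r. indicator {t1..t2} r * ennreal (g r * (B.gap t1 r + B.gap t2 r)) \<partial>lebesgue)"
  proof (rule nn_integral_mono_AE)
    show "AE r in lebesgue. ennreal \<bar>?p r\<bar> * indicator ?J r \<le> indicator {t1..t2} r * ennreal (g r * (B.gap t1 r + B.gap t2 r))"
      using AE_completion[OF G_full]
    proof eventually_elim
      case (elim r)
      show ?case
      proof (cases "r \<in> ?J")
        case True
        then have r: "r \<in> G" using elim tI by auto
        have "\<bar>F r (e t) - F r (e r)\<bar> \<le> g r * B.gap t r" if "t \<in> G" for t
          using F_bound[OF r V_space_minus[OF e_mem[OF that] e_mem[OF r]]] F_diff[OF r e_mem[OF that] e_mem[OF r]] that r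
          by (simp add: B.gap_def)
        from this[OF t(1)] this[OF t(2)]
        have "\<bar>?p r\<bar> \<le> g r * (B.gap t1 r + B.gap t2 r)" using r unfolding pairing_def distrib_left by (simp only: if_True)
        moreover have "r \<in> {t1..t2}" using True by simp
        ultimately show ?thesis using True by (simp add: ennreal_leI)
      qed simp
    qed
  qed
  also have "\<dots> = (\<integral>\<^sup>+r. indicator {t1..t2} r * ennreal (g r * (B.gap t1 r + B.gap t2 r)) \<partial>lborel)"
    by (rule nn_integral_completion)
  finally show ?thesis .
qed

text \<open>
  \<open>\<parallel>e(t)\<parallel>\<^sup>2 = sup\<^sub>w (2 (e(t), w) - \<parallel>w\<parallel>\<^sup>2)\<close> over a countable dense set of \<open>w\<close>.
\<close>

lemma sq_measurable: "(\<lambda>t. if t \<in> G then sq t else 0) \<in> borel_measurable (lebesgue_on {0<..<T})"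
proof -
  obtain S where S: "countable S" "S \<subseteq> V_space \<Omega> \<Gamma>"
    "\<And>v e. v \<in> V_space \<Omega> \<Gamma> \<Longrightarrow> e > 0 \<Longrightarrow> \<exists>s\<in>S. L2_norm \<Omega> (v - s) < e \<and> V_norm \<Omega> (v - s) < e"
    using W12_subset_separable[of "V_space \<Omega> \<Gamma>"] V_space_imp_W12 by (metis subsetI)
  have SL: "w \<in> L2 \<Omega>" if "w \<in> S" for w using that S(2) by (auto intro: V_space_imp_L2)
  define f where "f w t = (if t \<in> G then 2 * L2_inner \<Omega> (e t) w - (L2_norm \<Omega> w)\<^sup>2 else 0)" for w t
  have f_le: "f w t \<le> (if t \<in> G then sq t else 0)" if "w \<in> S" for w t
  proof (cases "t \<in> G")
    case True
    have "0 \<le> sq t - 2 * L2_inner \<Omega> (e t) w + (L2_norm \<Omega> w)\<^sup>2"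
      unfolding L2_norm_diff_sq[OF e_L2[OF True] SL[OF that], symmetric] by simp
    then show ?thesis using True by (simp add: f_def)
  qed (simp add: f_def)
  have ne: "S \<noteq> {}" using S(3)[OF V_space_zero, of 1] by auto
  have bdd: "bdd_above ((\<lambda>w. f w t) ` S)" for t
    using f_le by (intro bdd_aboveI2) auto
  have "(if t \<in> G then sq t else 0) = (SUP w\<in>S. f w t)" for t
  proof (rule antisym)
    show "(SUP w\<in>S. f w t) \<le> (if t \<in> G then sq t else 0)" using ne f_le by (rule cSUP_least)
    show "(if t \<in> G then sq t else 0) \<le> (SUP w\<in>S. f w t)"
    proof (cases "t \<in> G")
      case True
      have "sq t \<le> (SUP w\<in>S. f w t)"
      proof (rule field_le_epsilon)
        fix \<epsilon> :: real assume \<epsilon>: "0 < \<epsilon>"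
        then obtain w where w: "w \<in> S" "L2_norm \<Omega> (e t - w) < sqrt \<epsilon>" using S(3)[OF e_mem[OF True], of "sqrt \<epsilon>"] by auto
        have "(L2_norm \<Omega> (e t - w))\<^sup>2 \<le> (sqrt \<epsilon>)\<^sup>2" using w by (intro power_mono) auto
        then have "sq t \<le> f w t + \<epsilon>"
          using L2_norm_diff_sq[OF e_L2[OF True] SL[OF w(1)]] \<epsilon> True by (simp add: f_def)
        also have "f w t \<le> (SUP w\<in>S. f w t)" using w(1) bdd by (rule cSUP_upper)
        finally show "sq t \<le> (SUP w\<in>S. f w t) + \<epsilon>" by simp
      qed
      then show ?thesis using True by simp
    next
      case False
      obtain w where "w \<in> S" using ne by auto
      from cSUP_upper[OF this bdd, of t] show ?thesis using False by (simp add: f_def)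
    qed
  qed
  moreover have "(\<lambda>t. SUP w\<in>S. f w t) \<in> borel_measurable (lebesgue_on {0<..<T})"
  proof (rule borel_measurable_cSUP[OF S(1)])
    fix w assume "w \<in> S"
    then have [measurable]: "(\<lambda>t. L2_inner \<Omega> (e t) w) \<in> borel_measurable (lebesgue_on {0<..<T})"
      using S(2) by (intro inner_measurable) auto
    have [measurable]: "Measurable.pred (lebesgue_on {0<..<T}) (\<lambda>t. t \<in> G)"
      by (rule measurable_restrict_space1) (simp add: pred_def)
    show "f w \<in> borel_measurable (lebesgue_on {0<..<T})" unfolding f_def by measurable
  qed (rule bdd)
  ultimately show ?thesis by simp
qed

lemma finite_M: "finite_measure (lebesgue_on {0<..<T})"
  using bounded_box[of 0 T, unfolded box_real] by (intro finite_measure_lebesgue_on lmeasurable_open) auto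

lemma ex_G: "\<exists>t. t \<in> G"
proof -
  have "0 \<in> {0..T}" using T_pos by simp
  from AE_dense_sequence[OF T_pos G_fullM this] show ?thesis by metis
qed

lemma integral_mono_interval:
  fixes h :: "real \<Rightarrow> real"
  assumes h: "integrable (lebesgue_on {0<..<T}) h" "\<And>t. 0 \<le> h t" and i: "{a..b} \<subseteq> {c..d}" "0 \<le> c" "d \<le> T"
  shows "integral {a..b} h \<le> integral {c..d} h"
proof (cases "a \<le> b")
  case True
  then have "c \<le> a" "b \<le> d" using i(1) by auto
  then show ?thesis
    using h(2) i by (intro integral_subset_le open_interval_integrable_on[OF h(1)]) auto
next
  case False
  then show ?thesis using h i by (simp add: integral_nonneg open_interval_integrable_on[OF h(1)])
qed

lemma integral_F_bound:
  assumes t: "t \<in> G" and ab: "0 \<le> a" "b \<le> T"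
  shows "\<bar>integral {a..b} (\<lambda>r. F r (e t))\<bar> \<le> integral {a..b} (\<lambda>r. g r * B.norm_at t)"
proof (rule integral_abs_bound_AE[OF F_integrable[OF e_mem[OF t]] _ _ ab])
  show "integrable (lebesgue_on {0<..<T}) (\<lambda>r. g r * B.norm_at t)" using g_integrable by simp
  show "AE r in lebesgue_on {0<..<T}. r \<in> {a<..<b} \<longrightarrow> \<bar>F r (e t)\<bar> \<le> g r * B.norm_at t"
    using G_fullM by eventually_elim (use F_bound[OF _ e_mem[OF t]] t in \<open>simp add: B.norm_at_def\<close>)
qed

lemma integral_pairing_bound:
  assumes ab: "0 \<le> a" "b \<le> T"
  shows "\<bar>integral {a..b} pairing\<bar> \<le> integral {a..b} (\<lambda>r. g r * B.norm_at r)"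
  by (rule integral_abs_bound_AE[OF pairing_integrable g_norm_at_integrable _ ab]) (simp add: pairing_bound)

text \<open>The increment bound and the continuity of translations meet here; the remaining work is
  to make the candidate for the constant integrable and Borel.\<close>

lemma energy_balance_AE: "\<exists>c. AE t in lebesgue_on {0<..<T}. sq t = c + 2 * integral {0..t} pairing"
proof -
  let ?M = "lebesgue_on {0<..<T}"
  define R0 where "R0 t = (if t \<in> G then sq t - 2 * integral {0..t} pairing else 0)" for t
  define A where "A = integral {0..T} g"
  define B0 where "B0 = integral {0..T} (\<lambda>r. g r * B.norm_at r)"
  obtain t0 where t0: "t0 \<in> G" using ex_G by blast
  have b1: "\<bar>integral {a..b} (\<lambda>r. F r (e t))\<bar> \<le> A * B.norm_at t" if "t \<in> G" "0 \<le> a" "b \<le> T" for a b t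
  proof -
    have "\<bar>integral {a..b} (\<lambda>r. F r (e t))\<bar> \<le> integral {a..b} (\<lambda>r. g r * B.norm_at t)"
      by (rule integral_F_bound[OF that])
    also have "\<dots> \<le> integral {0..T} (\<lambda>r. g r * B.norm_at t)"
      using that g_integrable g_nonneg B.norm_at_nonneg by (intro integral_mono_interval) auto
    finally show ?thesis by (simp add: A_def)
  qed
  \<comment> \<open>Integrability of \<open>sq\<close> is drawn from its increments: compared with a
    fixed time \<open>t0\<close>, it grows at most linearly in \<open>B.norm_at\<close>.\<close>
  have b2: "\<bar>sq t - sq t0\<bar> \<le> A * B.norm_at t + A * B.norm_at t0" if t: "t \<in> G" for t
  proof (cases "t0 \<le> t")
    case True
    then show ?thesis
      using sq_diff[OF t0 t True] b1[OF t0, of t0 t] b1[OF t, of t0 t] G_bounds[OF t0] G_bounds[OF t] by linarith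
  next
    case False
    then have le: "t \<le> t0" by simp
    then show ?thesis
      using sq_diff[OF t t0 le] b1[OF t0, of t t0] b1[OF t, of t t0] G_bounds[OF t0] G_bounds[OF t] by linarith
  qed
  have b3: "\<bar>integral {0..t} pairing\<bar> \<le> B0" if t: "t \<in> G" for t
  proof -
    have "\<bar>integral {0..t} pairing\<bar> \<le> integral {0..t} (\<lambda>r. g r * B.norm_at r)"
      using G_bounds[OF t] by (intro integral_pairing_bound) auto
    also have "\<dots> \<le> B0"
      unfolding B0_def using G_bounds[OF t] g_nonneg B.norm_at_nonneg by (intro integral_mono_interval g_norm_at_integrable) auto
    finally show ?thesis .
  qed
  have bound: "norm (R0 t) \<le> norm (A * B.norm_at t + (A * B.norm_at t0 + 2 * B0 + sq t0))" for t
  proof (cases "t \<in> G")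
    case True
    then show ?thesis using b2[OF True] b3[OF True] zero_le_power2[of "L2_norm \<Omega> (e t0)"]
      unfolding R0_def real_norm_def by (simp only: if_True)
  next
    case False then show ?thesis by (simp add: R0_def)
  qed
  have R0_meas: "R0 \<in> borel_measurable ?M"
  proof -
    have "continuous_on {0..T} (\<lambda>t. integral {0..t} pairing)"
      using open_interval_integrable_on[OF pairing_integrable] T_pos by (intro indefinite_integral_continuous_1) auto
    then have "continuous_on {0<..<T} (\<lambda>t. integral {0..t} pairing)" by (rule continuous_on_subset) auto
    then have [measurable]: "(\<lambda>t. integral {0..t} pairing) \<in> borel_measurable ?M"
      by (rule continuous_imp_measurable_on_sets_lebesgue) simp
    note sq_measurable[measurable]
    have [measurable]: "Measurable.pred ?M (\<lambda>t. t \<in> G)"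
      by (rule measurable_restrict_space1) (simp add: pred_def)
    have "(\<lambda>t. (if t \<in> G then sq t else 0) - (if t \<in> G then 2 * integral {0..t} pairing else 0)) \<in> borel_measurable ?M"
      by measurable
    moreover have "(\<lambda>t. (if t \<in> G then sq t else 0) - (if t \<in> G then 2 * integral {0..t} pairing else 0)) = R0"
      by (auto simp: R0_def)
    ultimately show ?thesis by simp
  qed
  have "integrable ?M R0"
  proof (rule Bochner_Integration.integrable_bound[OF _ R0_meas AE_I2[OF bound]])
    show "integrable ?M (\<lambda>t. A * B.norm_at t + (A * B.norm_at t0 + 2 * B0 + sq t0))"
      by (intro Bochner_Integration.integrable_add integrable_mult_right norm_at_integrable finite_measure.integrable_const[OF finite_M])
  qed
  then have "integrable lebesgue (\<lambda>t. indicator {0<..<T} t *\<^sub>R R0 t)" by (simp add: integrable_restrict_space)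
  moreover have "(\<lambda>t. indicator {0<..<T} t *\<^sub>R R0 t) = R0"
    using G_bounds by (auto simp: R0_def indicator_def)
  ultimately have R0_int: "integrable lebesgue R0" by metis
  \<comment> \<open>The increment lemma works with Borel measure, so \<open>R0\<close> gets a
    version integrable there; \<open>G1\<close> below collects the good times at which the two
    agree.\<close>
  then obtain R where R: "R \<in> borel_measurable borel" "AE t in lborel. R0 t = R t"
    using completion_ex_borel_measurable_real[of R0 lborel] by auto
  have "integrable lebesgue R"
    by (rule integrable_cong_AE_imp[OF R0_int]) (use R in \<open>auto simp: measurable_completion intro!: AE_completion\<close>)
  then have R_int: "integrable lborel R" using R(1) by (simp add: integrable_completion)
  have "AE t in ?M. t \<in> G \<and> R0 t = R t"
  proof -
    have "AE t in ?M. R0 t = R t" by (rule AE_lebesgue_onI_lborel) (use R(2) in auto)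
    with G_fullM show ?thesis by eventually_elim simp
  qed
  then obtain G1 where G1: "G1 \<in> sets borel" "\<forall>t\<in>G1. t \<in> G \<and> R0 t = R t" "AE t in lborel. t \<in> {0<..<T} \<longrightarrow> t \<in> G1"
    using AE_lebesgue_on_borel_set[of "{0<..<T}" "\<lambda>t. t \<in> G \<and> R0 t = R t"] by auto
  have "\<exists>c. AE t in ?M. R t = c"
  proof (rule ex_const_if_increment_bound[OF T_pos R_int G1(1,3) g_measurable g_nonneg _ B.gap_measurable B.gap_nonneg B.gap_sym B.gap_translation])
    show "(\<integral>\<^sup>+t. ennreal ((g t)\<^sup>2) \<partial>lborel) < \<infinity>"
      using g_square_integrable by (simp add: integrable_iff_bounded)
    fix t1 t2 assume t: "t1 \<in> G1" "t2 \<in> G1" "t1 < t2"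
    then have tG: "t1 \<in> G" "t2 \<in> G" using G1(2) by auto
    have Rv: "R t = sq t - 2 * integral {0..t} pairing" if "t \<in> G1" for t
    proof -
      have "t \<in> G" "R0 t = R t" using G1(2) that by auto
      then show ?thesis by (simp add: R0_def)
    qed
    show "ennreal \<bar>R t2 - R t1\<bar> \<le> (\<integral>\<^sup>+r. indicator {t1..t2} r * ennreal (g r * (B.gap t1 r + B.gap t2 r)) \<partial>lborel)"
      using sq_increment_bound[OF tG t(3)] by (simp only: Rv[OF t(1)] Rv[OF t(2)])
  qed
  then obtain c where c: "AE t in ?M. R t = c" by blast
  have "AE t in ?M. t \<in> G1" by (rule AE_lebesgue_onI_lborel) (use G1 in auto)
  with c have "AE t in ?M. sq t = c + 2 * integral {0..t} pairing"
  proof eventually_elim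
    case (elim t)
    then have "t \<in> G" "R0 t = R t" using G1(2) by auto
    then show ?case using elim by (simp add: R0_def)
  qed
  then show ?thesis by blast
qed

text \<open>
  Comparing with a time in the interval at which the \<open>V\<close>-norm is at most its mean, the oscillation
  of \<open>e\<close> in \<open>L\<^sup>2(\<Omega>)\<close> is controlled by an integral over the interval.
\<close>

lemma oscillation_bound:
  assumes G': "\<And>t. t \<in> G' \<Longrightarrow> t \<in> G" "\<And>t. t \<in> G' \<Longrightarrow> sq t = c + 2 * integral {0..t} pairing"
    and full: "AE t in lebesgue_on {0<..<T}. t \<in> G'"
    and ab: "0 \<le> a" "a < b" "b \<le> T"
  obtains \<tau> where "\<tau> \<in> G'" "\<And>t. t \<in> G' \<Longrightarrow> t \<in> {a<..<b} \<Longrightarrow>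
    (L2_norm \<Omega> (e t - e \<tau>))\<^sup>2 \<le> 2 * integral {a..b} (\<lambda>r. (g r)\<^sup>2 + (B.norm_at r)\<^sup>2 + 1)"
proof -
  let ?M = "lebesgue_on {0<..<T}"
  have const: "integrable ?M (\<lambda>r. k)" for k :: real by (rule finite_measure.integrable_const[OF finite_M])
  have ci: "h integrable_on {x..y}" if "integrable ?M h" "0 \<le> x" "y \<le> T" for h :: "real \<Rightarrow> real" and x y :: real
    by (rule open_interval_integrable_on[OF that])
  define m where "m = integral {a..b} (\<lambda>r. (B.norm_at r)\<^sup>2)"
  have s2: "integral {a..b} (\<lambda>r. (B.norm_at r)\<^sup>2 + 1) = m + (b - a)"
    unfolding m_def using ab ci[OF norm_at2_integrable ab(1,3)]
    by (subst Henstock_Kurzweil_Integration.integral_add) auto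
  \<comment> \<open>A mean value argument for the squared norm; the slack b - a makes the
    contradiction strict.\<close>
  have "\<exists>s\<in>G'. s \<in> {a<..<b} \<and> (b - a) * (B.norm_at s)\<^sup>2 \<le> m + (b - a)"
  proof (rule ccontr)
    assume n: "\<not> (\<exists>s\<in>G'. s \<in> {a<..<b} \<and> (b - a) * (B.norm_at s)\<^sup>2 \<le> m + (b - a))"
    define k where "k = (m + (b - a)) / (b - a)"
    have m0: "0 \<le> m" unfolding m_def using ci[OF norm_at2_integrable ab(1,3)] by (intro integral_nonneg) auto
    have "\<bar>integral {a..b} (\<lambda>r. k)\<bar> \<le> integral {a..b} (\<lambda>r. (B.norm_at r)\<^sup>2)"
    proof (rule integral_abs_bound_AE[OF const norm_at2_integrable _ ab(1,3)])
      show "AE t in ?M. t \<in> {a<..<b} \<longrightarrow> \<bar>k\<bar> \<le> (B.norm_at t)\<^sup>2"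
        using full
      proof (rule eventually_mono, intro impI)
        fix t assume "t \<in> G'" "t \<in> {a<..<b}"
        then have "m + (b - a) < (b - a) * (B.norm_at t)\<^sup>2" using n not_le by blast
        then have "k \<le> (B.norm_at t)\<^sup>2" using ab by (simp add: k_def field_simps)
        then show "\<bar>k\<bar> \<le> (B.norm_at t)\<^sup>2" using m0 ab by (simp add: k_def)
      qed
    qed
    moreover have "integral {a..b} (\<lambda>r. k) = m + (b - a)" using ab by (simp add: k_def)
    ultimately show False using ab m0 by (simp add: m_def)
  qed
  then obtain s where s: "s \<in> G'" "s \<in> {a<..<b}" "(b - a) * (B.norm_at s)\<^sup>2 \<le> m + (b - a)" by blast
  \<comment> \<open>By Young's inequality this dominates
    \<open>g r * B.norm_at r + g r * B.norm_at s\<close>; each product uses half of the square of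
    \<open>g r\<close>.\<close>
  let ?h = "\<lambda>r. (g r)\<^sup>2 + (B.norm_at r)\<^sup>2 / 2 + (B.norm_at s)\<^sup>2 / 2"
  have hi: "integrable ?M ?h"
    by (intro Bochner_Integration.integrable_add g2_integrable integrable_divide_zero norm_at2_integrable const)
  have sG: "s \<in> G" using s G' by blast
  have est: "(L2_norm \<Omega> (e t - e s))\<^sup>2 \<le> 2 * integral {lo..hi} ?h"
    if t: "t \<in> G'" and lohi: "lo = min s t" "hi = max s t" for t lo hi
  proof -
    have tG: "t \<in> G" using t G' by blast
    have I: "0 \<le> lo" "lo \<le> hi" "hi \<le> T" using lohi G_bounds[OF sG] G_bounds[OF tG] by auto
    have "integral {0..lo} pairing + integral {lo..hi} pairing = integral {0..hi} pairing"
      using I by (intro Henstock_Kurzweil_Integration.integral_combine ci[OF pairing_integrable]) auto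
    then have d1: "\<bar>sq t - sq s\<bar> = 2 * \<bar>integral {lo..hi} pairing\<bar>"
      using G'(2)[OF t] G'(2)[OF s(1)] lohi by (cases "s \<le> t") (auto simp: min_def max_def)
    have d2: "\<bar>L2_inner \<Omega> (e t) (e s) - L2_inner \<Omega> (e s) (e s)\<bar> = \<bar>integral {lo..hi} (\<lambda>r. F r (e s))\<bar>"
    proof (cases "s \<le> t")
      case True
      then show ?thesis using weak[OF sG tG True e_mem[OF sG]] lohi by simp
    next
      case False
      then have "t \<le> s" by simp
      then show ?thesis using weak[OF tG sG \<open>t \<le> s\<close> e_mem[OF sG]] lohi by (simp add: min_def max_def abs_minus_commute)
    qed
    have i1: "(\<lambda>r. g r * B.norm_at r) integrable_on {lo..hi}" "(\<lambda>r. g r * B.norm_at s) integrable_on {lo..hi}"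
      using I g_integrable by (auto intro!: ci g_norm_at_integrable)
    have "integral {lo..hi} (\<lambda>r. g r * B.norm_at r) + integral {lo..hi} (\<lambda>r. g r * B.norm_at s)
      = integral {lo..hi} (\<lambda>r. g r * B.norm_at r + g r * B.norm_at s)"
      using i1 by (rule Henstock_Kurzweil_Integration.integral_add[symmetric])
    also have "\<dots> \<le> integral {lo..hi} ?h"
    proof (rule integral_le)
      show "(\<lambda>r. g r * B.norm_at r + g r * B.norm_at s) integrable_on {lo..hi}" using i1 by (rule integrable_add)
      show "?h integrable_on {lo..hi}" using I by (intro ci[OF hi]) auto
      show "g r * B.norm_at r + g r * B.norm_at s \<le> ?h r" for r
        using sum_squares_bound[of "g r" "B.norm_at r"] sum_squares_bound[of "g r" "B.norm_at s"] by simp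
    qed
    finally have "\<bar>integral {lo..hi} pairing\<bar> + \<bar>integral {lo..hi} (\<lambda>r. F r (e s))\<bar> \<le> integral {lo..hi} ?h"
      using integral_pairing_bound[of lo hi] integral_F_bound[OF sG, of lo hi] I by linarith
    \<comment> \<open>The distance splits into a term governed by the energy balance and a term
      tested with the fixed function \<open>e s\<close>, to which the weak identity applies.\<close>
    moreover have "(L2_norm \<Omega> (e t - e s))\<^sup>2 = (sq t - sq s) - 2 * (L2_inner \<Omega> (e t) (e s) - L2_inner \<Omega> (e s) (e s))"
      using L2_norm_diff_sq[OF e_L2[OF tG] e_L2[OF sG]] by (simp add: L2_norm_sq)
    moreover have "sq t - sq s \<le> 2 * \<bar>integral {lo..hi} pairing\<bar>" unfolding d1[symmetric] by (rule abs_ge_self)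
    moreover have "- (L2_inner \<Omega> (e t) (e s) - L2_inner \<Omega> (e s) (e s)) \<le> \<bar>integral {lo..hi} (\<lambda>r. F r (e s))\<bar>"
      unfolding d2[symmetric] by (rule abs_ge_minus_self)
    ultimately show ?thesis by argo
  qed
  \<comment> \<open>By the choice of \<open>s\<close>, the last term of \<open>?h\<close> integrates
    to at most half of m + (b - a), which supplies the half missing in the middle term.\<close>
  have hab: "2 * integral {a..b} ?h \<le> 2 * integral {a..b} (\<lambda>r. (g r)\<^sup>2 + (B.norm_at r)\<^sup>2 + 1)"
  proof -
    let ?g2 = "\<lambda>r. (g r)\<^sup>2" and ?s2 = "\<lambda>r. (B.norm_at r)\<^sup>2"
    have g2: "?g2 integrable_on {a..b}" and s2': "?s2 integrable_on {a..b}" and sh: "(\<lambda>r. ?s2 r / 2) integrable_on {a..b}"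
      using ci[OF g2_integrable ab(1,3)] ci[OF norm_at2_integrable ab(1,3)] by (auto intro: integrable_on_divide)
    have k: "(\<lambda>r. k) integrable_on {a..b}" for k :: real by (rule integrable_const_ivl)
    have ik: "integral {a..b} (\<lambda>r. k) = (b - a) * k" for k :: real using ab by simp
    have "integral {a..b} ?h = integral {a..b} ?g2 + integral {a..b} (\<lambda>r. ?s2 r / 2) + integral {a..b} (\<lambda>r. (B.norm_at s)\<^sup>2 / 2)"
      unfolding Henstock_Kurzweil_Integration.integral_add[OF integrable_add[OF g2 sh] k]
        Henstock_Kurzweil_Integration.integral_add[OF g2 sh] ..
    then have e1: "integral {a..b} ?h = integral {a..b} ?g2 + m / 2 + (b - a) * (B.norm_at s)\<^sup>2 / 2"
      unfolding ik m_def by simp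
    have e2: "integral {a..b} (\<lambda>r. ?g2 r + ?s2 r + 1) = integral {a..b} ?g2 + m + (b - a)"
      unfolding Henstock_Kurzweil_Integration.integral_add[OF integrable_add[OF g2 s2'] k]
        Henstock_Kurzweil_Integration.integral_add[OF g2 s2'] ik m_def by simp
    show ?thesis using s(3) ab unfolding e1 e2 by simp
  qed
  show thesis
  proof (rule that[OF s(1)])
    fix t assume t: "t \<in> G'" "t \<in> {a<..<b}"
    have "(L2_norm \<Omega> (e t - e s))\<^sup>2 \<le> 2 * integral {min s t..max s t} ?h" by (rule est[OF t(1)]) auto
    also have "\<dots> \<le> 2 * integral {a..b} ?h"
      using t(2) s(2) ab by (intro mult_left_mono integral_mono_interval hi) auto
    finally show "(L2_norm \<Omega> (e t - e s))\<^sup>2 \<le> 2 * integral {a..b} (\<lambda>r. (g r)\<^sup>2 + (B.norm_at r)\<^sup>2 + 1)"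
      using hab by linarith
  qed
qed

text \<open>The bound in \<open>oscillation_bound\<close> is, up to a factor 2, an increment of one
  uniformly continuous function, the indefinite integral of \<open>?\<mu>\<close>, and so is small
  on short intervals uniformly in their position.\<close>

lemma cont_rep_exists: "\<exists>c. is_cont_rep T \<Omega> e c"
proof -
  let ?M = "lebesgue_on {0<..<T}" and ?\<mu> = "\<lambda>r. (g r)\<^sup>2 + (B.norm_at r)\<^sup>2 + 1"
  obtain c where c: "AE t in ?M. sq t = c + 2 * integral {0..t} pairing" using energy_balance_AE by blast
  define G' where "G' = {t \<in> G. sq t = c + 2 * integral {0..t} pairing}"
  have full: "AE t in ?M. t \<in> G'" using c G_fullM by eventually_elim (simp add: G'_def)
  have G': "\<And>t. t \<in> G' \<Longrightarrow> t \<in> G" "\<And>t. t \<in> G' \<Longrightarrow> sq t = c + 2 * integral {0..t} pairing" by (auto simp: G'_def)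
  have mu: "integrable ?M ?\<mu>"
    by (intro Bochner_Integration.integrable_add g2_integrable norm_at2_integrable finite_measure.integrable_const[OF finite_M])
  have "continuous_on {0..T} (\<lambda>t. integral {0..t} ?\<mu>)"
    using open_interval_integrable_on[OF mu] T_pos by (intro indefinite_integral_continuous_1) auto
  then have uc: "uniformly_continuous_on {0..T} (\<lambda>t. integral {0..t} ?\<mu>)"
    by (rule compact_uniformly_continuous) simp
  show ?thesis
  proof (rule L2_cont_rep_exists[OF lmeasurable_domain T_pos full])
    show "e t \<in> L2 \<Omega>" if "t \<in> G'" for t using that G'(1) by (intro e_L2)
    fix \<epsilon> :: real assume \<epsilon>: "0 < \<epsilon>"
    then obtain d where d: "0 < d" "\<And>x y. x \<in> {0..T} \<Longrightarrow> y \<in> {0..T} \<Longrightarrow> dist y x < d \<Longrightarrow>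
        dist (integral {0..y} ?\<mu>) (integral {0..x} ?\<mu>) < \<epsilon>\<^sup>2 / 16"
      using uc[unfolded uniformly_continuous_on_def, rule_format, of "\<epsilon>\<^sup>2 / 16"] by auto
    show "\<exists>\<delta>>0. \<forall>s\<in>G'. \<forall>t\<in>G'. \<bar>s - t\<bar> < \<delta> \<longrightarrow> L2_norm \<Omega> (e s - e t) < \<epsilon>"
    proof (intro exI[of _ "d / 4"] conjI ballI impI)
      show "0 < d / 4" using d by simp
      fix t1 t2 assume t: "t1 \<in> G'" "t2 \<in> G'" "\<bar>t1 - t2\<bar> < d / 4"
      \<comment> \<open>The interval from \<open>a\<close> to \<open>b\<close> contains both times
        in its interior and is clipped to [0,T]. It is shorter than d: the times are less than d/4
        apart and each side adds at most d/4.\<close>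
      define a where "a = max 0 (min t1 t2 - d / 4)"
      define b where "b = min T (max t1 t2 + d / 4)"
      have tb: "0 < t1" "t1 < T" "0 < t2" "t2 < T" using G_bounds[OF G'(1)[OF t(1)]] G_bounds[OF G'(1)[OF t(2)]] by auto
      have ab: "0 \<le> a" "a < b" "b \<le> T" "t1 \<in> {a<..<b}" "t2 \<in> {a<..<b}" "b - a < d"
        using tb t(3) d(1) unfolding a_def b_def greaterThanLessThan_iff by linarith+
      obtain s where s: "s \<in> G'" "\<And>t. t \<in> G' \<Longrightarrow> t \<in> {a<..<b} \<Longrightarrow> (L2_norm \<Omega> (e t - e s))\<^sup>2 \<le> 2 * integral {a..b} ?\<mu>"
        using oscillation_bound[OF G' full ab(1-3)] by blast
      have "integral {0..a} ?\<mu> + integral {a..b} ?\<mu> = integral {0..b} ?\<mu>"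
        using ab by (intro Henstock_Kurzweil_Integration.integral_combine open_interval_integrable_on[OF mu]) auto
      moreover have "dist (integral {0..b} ?\<mu>) (integral {0..a} ?\<mu>) < \<epsilon>\<^sup>2 / 16"
        using ab by (intro d(2)) (auto simp: dist_real_def)
      ultimately have small: "integral {a..b} ?\<mu> < \<epsilon>\<^sup>2 / 16"
        unfolding dist_real_def by linarith
      \<comment> \<open>Twice \<epsilon> squared over 16 is below the square of \<epsilon>/2, so
        each of the two times contributes less than \<epsilon>/2.\<close>
      have half: "L2_norm \<Omega> (e t - e s) < \<epsilon> / 2" if "t \<in> G'" "t \<in> {a<..<b}" for t
      proof (rule power_less_imp_less_base)
        have "(L2_norm \<Omega> (e t - e s))\<^sup>2 < \<epsilon>\<^sup>2 / 8" using s(2)[OF that] small by linarith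
        also have "\<dots> \<le> (\<epsilon> / 2)\<^sup>2" by (simp add: power_divide)
        finally show "(L2_norm \<Omega> (e t - e s))\<^sup>2 < (\<epsilon> / 2)\<^sup>2" .
      qed (use \<epsilon> in simp)
      have "L2_norm \<Omega> (e t1 - e t2) \<le> L2_norm \<Omega> (e t1 - e s) + L2_norm \<Omega> (e s - e t2)"
        using t s G' by (intro L2.norm_triangle e_L2) auto
      also have "L2_norm \<Omega> (e s - e t2) = L2_norm \<Omega> (e t2 - e s)"
        using t s G' by (intro L2.norm_minus_commute e_L2) auto
      finally show "L2_norm \<Omega> (e t1 - e t2) < \<epsilon>"
        using half[OF t(1) ab(4)] half[OF t(2) ab(5)] by linarith
    qed
  qed
qed

text \<open>Once the representative replaces \<open>e\<close>, the almost-everywhere balance is an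
  identity of continuous functions and holds at the endpoints; its constant cancels in the
  difference.\<close>

lemma energy_identity:
  assumes c: "is_cont_rep T \<Omega> e c"
  shows "(L2_norm \<Omega> (c T))\<^sup>2 - (L2_norm \<Omega> (c 0))\<^sup>2 = 2 * integral {0..T} pairing"
proof -
  let ?M = "lebesgue_on {0<..<T}"
  obtain k where k: "AE t in ?M. sq t = k + 2 * integral {0..t} pairing" using energy_balance_AE by blast
  have cL: "c t \<in> L2 \<Omega>" if "t \<in> {0..T}" for t using c that by (auto simp: is_cont_rep_def)
  have cont: "continuous_on {0..T} (\<lambda>t. (L2_norm \<Omega> (c t))\<^sup>2 - k - 2 * integral {0..t} pairing)"
    using is_cont_rep_L2_norm_continuous[OF c] open_interval_integrable_on[OF pairing_integrable] T_pos
    by (intro continuous_intros indefinite_integral_continuous_1) auto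
  have "AE t in ?M. AE x in lebesgue_on \<Omega>. c t x = e t x" using c by (simp add: is_cont_rep_def)
  with k G_fullM have ae: "AE t in ?M. (L2_norm \<Omega> (c t))\<^sup>2 - k - 2 * integral {0..t} pairing = 0"
  proof eventually_elim
    case (elim t)
    have "c t \<in> L2 \<Omega>" using G_bounds[OF elim(2)] by (intro cL) auto
    then have "L2_norm \<Omega> (c t) = L2_norm \<Omega> (e t)" using elim by (intro L2_norm_cong e_L2)
    then show ?case using elim(1) by simp
  qed
  have "(L2_norm \<Omega> (c t))\<^sup>2 - k - 2 * integral {0..t} pairing = 0" if "t \<in> {0..T}" for t
    using continuous_zero_if_AE_zero[OF T_pos cont ae that] .
  from this[of T] this[of 0] T_pos show ?thesis by simp
qed

lemma integral_pairing: "integral {0..T} pairing = (LINT t|lebesgue_on {0<..<T}. F t (e t))"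
proof -
  have "integral {0..T} pairing = (LINT t|lebesgue_on {0<..<T}. pairing t)"
    using open_interval_LINT[OF pairing_integrable, of 0 T] T_pos by simp
  also have "\<dots> = (LINT t|lebesgue_on {0<..<T}. F t (e t))"
  proof (rule integral_cong_AE)
    show ae: "AE t in lebesgue_on {0<..<T}. pairing t = F t (e t)" using G_fullM by eventually_elim (simp add: pairing_def)
    show "pairing \<in> borel_measurable (lebesgue_on {0<..<T})" using pairing_integrable by auto
    then show "(\<lambda>t. F t (e t)) \<in> borel_measurable (lebesgue_on {0<..<T})"
      by (rule borel_measurable_lebesgue_on_cong_AE[rotated]) (use ae in auto)
  qed
  finally show ?thesis .
qed

lemma forcing_pairing_integrable: "integrable (lebesgue_on {0<..<T}) (\<lambda>t. F t (e t))"
proof (rule integrable_cong_AE_imp[OF pairing_integrable])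
  show ae: "AE t in lebesgue_on {0<..<T}. pairing t = F t (e t)" using G_fullM by eventually_elim (simp add: pairing_def)
  show "(\<lambda>t. F t (e t)) \<in> borel_measurable (lebesgue_on {0<..<T})"
    by (rule borel_measurable_lebesgue_on_cong_AE[OF _ borel_measurable_integrable[OF pairing_integrable] ae]) simp
qed

end

section \<open>Energy identity and differences for general weak derivatives\<close>

context bounded_open_set
begin

text \<open>Existence of some continuous representative is what makes the choice
  \<open>cont_rep\<close> satisfy its specification.\<close>

lemma evolution_cont_rep:
  assumes "0 < T" "e \<in> L2_V T \<Omega> \<Gamma>" "weak_forcing \<Gamma> T F g" "has_time_deriv T \<Omega> \<Gamma> e F"
  shows "is_cont_rep T \<Omega> e (cont_rep T \<Omega> e)"
proof -
  obtain s G where "regular_evolution \<Omega> \<Gamma> T e s G F g" using regular_evolution_exists[OF assms] .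
  then interpret regular_evolution \<Omega> \<Gamma> T e s G F g .
  show ?thesis unfolding cont_rep_def using cont_rep_exists by (rule someI_ex)
qed

lemma evolution_energy_identity:
  assumes "0 < T" "e \<in> L2_V T \<Omega> \<Gamma>" "weak_forcing \<Gamma> T F g" "has_time_deriv T \<Omega> \<Gamma> e F" "is_cont_rep T \<Omega> e c"
  shows "integrable (lebesgue_on {0<..<T}) (\<lambda>t. F t (e t))"
    and "(L2_norm \<Omega> (c T))\<^sup>2 - (L2_norm \<Omega> (c 0))\<^sup>2 = 2 * (LINT t|lebesgue_on {0<..<T}. F t (e t))"
proof -
  obtain s G where "regular_evolution \<Omega> \<Gamma> T e s G F g" using regular_evolution_exists[OF assms(1-4)] .
  then interpret regular_evolution \<Omega> \<Gamma> T e s G F g .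
  show "integrable (lebesgue_on {0<..<T}) (\<lambda>t. F t (e t))" by (rule forcing_pairing_integrable)
  show "(L2_norm \<Omega> (c T))\<^sup>2 - (L2_norm \<Omega> (c 0))\<^sup>2 = 2 * (LINT t|lebesgue_on {0<..<T}. F t (e t))"
    using energy_identity[OF assms(5)] by (simp add: integral_pairing)
qed

text \<open>\<open>L2_inner\<close> is split only at times where both functions are in L2, hence
  almost everywhere; the measurability of the new integrand is transferred along that
  equality.\<close>

lemma has_time_deriv_minus:
  assumes v: "v \<in> L2_V T \<Omega> \<Gamma>" and w: "w \<in> L2_V T \<Omega> \<Gamma>"
    and F: "weak_forcing \<Gamma> T F f" and G: "weak_forcing \<Gamma> T G g"
    and dv: "has_time_deriv T \<Omega> \<Gamma> v F" and dw: "has_time_deriv T \<Omega> \<Gamma> w G"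
  shows "has_time_deriv T \<Omega> \<Gamma> (\<lambda>t. v t - w t) (\<lambda>t x. F t x - G t x)"
  unfolding has_time_deriv_def
proof (intro ballI)
  fix \<phi> x assume \<phi>: "\<phi> \<in> test_functions {0<..<T}" and x: "x \<in> V_space \<Omega> \<Gamma>"
  let ?M = "lebesgue_on {0<..<T}"
  interpret I: bounded_open_set "{0<..<T}" by unfold_locales (use bounded_box[of 0 T, unfolded box_real] in auto)
  have sm: "smooth \<phi>" using \<phi> by (simp add: test_functions_def)
  have \<phi>i: "integrable ?M (\<lambda>t. \<phi> t * h t)" if h: "integrable ?M h" for h
  proof -
    have "continuous_on {0..T} \<phi>" by (rule smooth_continuous[OF sm])
    then have "compact (\<phi> ` {0..T})" by (intro compact_continuous_image) auto
    then obtain B where B: "\<forall>y\<in>\<phi> ` {0..T}. norm y \<le> B" using compact_imp_bounded bounded_iff by metis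
    have "integrable ?M (\<lambda>t. B * h t)" using h by simp
    then show ?thesis
    proof (rule Bochner_Integration.integrable_bound)
      show "(\<lambda>t. \<phi> t * h t) \<in> borel_measurable ?M"
        using L2_measurable[OF I.smooth_imp_L2[OF sm]] h by (intro borel_measurable_times) auto
      show "AE t in ?M. norm (\<phi> t * h t) \<le> norm (B * h t)"
      proof (rule AE_I2)
        fix t assume "t \<in> space ?M"
        then have "t \<in> {0..T}" by simp
        then have "norm (\<phi> t) \<le> B" using B by blast
        then show "norm (\<phi> t * h t) \<le> norm (B * h t)" by (simp add: abs_mult mult_right_mono)
      qed
    qed
  qed
  have iF: "integrable ?M (\<lambda>t. \<phi> t * F t x)" and iG: "integrable ?M (\<lambda>t. \<phi> t * G t x)"
    by (intro \<phi>i integrable_forcing(2)[OF F x], intro \<phi>i integrable_forcing(2)[OF G x])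
  have 1: "has_bochner_integral ?M (\<lambda>t. deriv \<phi> t * L2_inner \<Omega> (v t) x) (- (LINT t|?M. \<phi> t * F t x))"
    and 2: "has_bochner_integral ?M (\<lambda>t. deriv \<phi> t * L2_inner \<Omega> (w t) x) (- (LINT t|?M. \<phi> t * G t x))"
    using dv dw \<phi> x unfolding has_time_deriv_def by blast+
  have 3: "has_bochner_integral ?M (\<lambda>t. deriv \<phi> t * L2_inner \<Omega> (v t) x - deriv \<phi> t * L2_inner \<Omega> (w t) x)
      (- (LINT t|?M. \<phi> t * (F t x - G t x)))"
    using has_bochner_integral_diff[OF 1 2] iF iG by (simp add: right_diff_distrib)
  have ae: "AE t in ?M. deriv \<phi> t * L2_inner \<Omega> (v t) x - deriv \<phi> t * L2_inner \<Omega> (w t) x = deriv \<phi> t * L2_inner \<Omega> (v t - w t) x"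
  proof -
    have "AE t in ?M. v t \<in> V_space \<Omega> \<Gamma>" "AE t in ?M. w t \<in> V_space \<Omega> \<Gamma>" using v w by (auto simp: L2_Bochner_def)
    then show ?thesis
    proof eventually_elim
      case (elim t)
      then show ?case
        using L2_inner_diff_left[OF V_space_imp_L2 V_space_imp_L2 V_space_imp_L2[OF x]] by (simp add: right_diff_distrib)
    qed
  qed
  have m: "(\<lambda>t. deriv \<phi> t * L2_inner \<Omega> (v t - w t) x) \<in> borel_measurable ?M"
    by (rule borel_measurable_lebesgue_on_cong_AE[OF _ borel_measurable_has_bochner_integral[OF 3] ae]) simp
  show "has_bochner_integral ?M (\<lambda>t. deriv \<phi> t * L2_inner \<Omega> (v t - w t) x) (- (LINT t|?M. \<phi> t * (F t x - G t x)))"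
    using 3 has_bochner_integral_cong_AE[OF borel_measurable_has_bochner_integral[OF 3] m ae] by blast
qed

text \<open>The gradient carries \<open>V_norm\<close> to the L2 norm, so the gradients of the
  approximating simple functions approximate the gradient.\<close>

lemma L2_V_grad_L2_Y:
  assumes v: "v \<in> L2_V T \<Omega> \<Gamma>"
  shows "(\<lambda>t. grad \<Omega> (v t)) \<in> L2_Y T \<Omega>"
proof -
  let ?M = "lebesgue_on {0<..<T}"
  obtain s where s: "\<And>n. simple_function ?M (s n)" "\<And>n. s n ` space ?M \<subseteq> V_space \<Omega> \<Gamma>"
    and c: "AE t in ?M. (\<lambda>n. V_norm \<Omega> (s n t - v t)) \<longlonglongrightarrow> 0"
    using v unfolding L2_Bochner_def strongly_measurable_def by blast
  have mem: "AE t in ?M. v t \<in> V_space \<Omega> \<Gamma>" and sq: "integrable ?M (\<lambda>t. (V_norm \<Omega> (v t))\<^sup>2)"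
    using v by (auto simp: L2_Bochner_def)
  have "AE t in ?M. (\<lambda>n. L2_norm \<Omega> (grad \<Omega> (s n t) - grad \<Omega> (v t))) \<longlonglongrightarrow> 0"
    using c mem AE_space
  proof eventually_elim
    case (elim t)
    have "s n t \<in> V_space \<Omega> \<Gamma>" for n using s(2)[of n] elim(3) by blast
    then have "V_norm \<Omega> (s n t - v t) = L2_norm \<Omega> (grad \<Omega> (s n t) - grad \<Omega> (v t))" for n
      using elim(2) by (intro V_norm_minus V_space_imp_W12)
    then show ?case using elim(1) by simp
  qed
  moreover have "simple_function ?M (\<lambda>t. grad \<Omega> (s n t))" for n by (rule simple_function_compose1[OF s(1)])
  moreover have "(\<lambda>t. grad \<Omega> (s n t)) ` space ?M \<subseteq> L2 \<Omega>" for n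
    using s(2)[of n] by (auto intro!: grad_L2 V_space_imp_W12)
  moreover have "AE t in ?M. grad \<Omega> (v t) \<in> L2 \<Omega>"
    using mem by eventually_elim (intro grad_L2 V_space_imp_W12)
  ultimately show ?thesis
    unfolding L2_Bochner_def strongly_measurable_def using sq by (auto simp: V_norm_def intro!: exI[of _ "\<lambda>n t. grad \<Omega> (s n t)"])
qed

lemma W_evol_time_deriv:
  assumes "v \<in> W_evol T \<Omega> \<Gamma>"
  shows "v \<in> L2_V T \<Omega> \<Gamma>" "time_deriv T \<Omega> \<Gamma> v \<in> L2_V_dual T \<Omega> \<Gamma>" "has_time_deriv T \<Omega> \<Gamma> v (time_deriv T \<Omega> \<Gamma> v)"
proof -
  show "v \<in> L2_V T \<Omega> \<Gamma>" using assms by (simp add: W_evol_def)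
  have "\<exists>F. F \<in> L2_V_dual T \<Omega> \<Gamma> \<and> has_time_deriv T \<Omega> \<Gamma> v F" using assms by (auto simp: W_evol_def)
  from someI_ex[OF this]
  show "time_deriv T \<Omega> \<Gamma> v \<in> L2_V_dual T \<Omega> \<Gamma>" "has_time_deriv T \<Omega> \<Gamma> v (time_deriv T \<Omega> \<Gamma> v)"
    by (auto simp: time_deriv_def)
qed

end

section \<open>The error identity for the heat equation\<close>

lemma Q_norm_sq: "(Q_norm T \<Omega> y)\<^sup>2 = (LINT t|lebesgue_on {0<..<T}. (L2_norm \<Omega> (y t))\<^sup>2)"
  by (simp add: Q_norm_def L2_norm_def Bochner_Integration.integral_nonneg)

theorem lemma5p2:
  fixes \<Omega> \<Gamma>\<^sub>D \<Gamma>\<^sub>N :: "'a::euclidean_space set"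
    and T :: real
    and f :: "real \<Rightarrow> ('a \<Rightarrow> real) \<Rightarrow> real"
    and u\<^sub>0 :: "'a \<Rightarrow> real"
    and u lam :: "real \<Rightarrow> 'a \<Rightarrow> real"
    and y z :: "real \<Rightarrow> 'a \<Rightarrow> 'a"
  assumes "bounded \<Omega>" and "lipschitz_domain \<Omega>"
    and "openin (top_of_set (frontier \<Omega>)) \<Gamma>\<^sub>D"
    and "openin (top_of_set (frontier \<Omega>)) \<Gamma>\<^sub>N"
    and "\<Gamma>\<^sub>D \<noteq> {}" and "\<Gamma>\<^sub>D \<inter> \<Gamma>\<^sub>N = {}"
    and "closure \<Gamma>\<^sub>D \<union> closure \<Gamma>\<^sub>N = frontier \<Omega>"
    and "0 < T"
    and "f \<in> L2_V_dual T \<Omega> \<Gamma>\<^sub>D" and "u\<^sub>0 \<in> L2 \<Omega>"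
    and "u \<in> W_evol T \<Omega> \<Gamma>\<^sub>D"
    and "AE t in lebesgue_on {0<..<T}. \<forall>v\<in>V_space \<Omega> \<Gamma>\<^sub>D.
           time_deriv T \<Omega> \<Gamma>\<^sub>D u t v + neg_laplace \<Omega> (u t) v = f t v"
    and "AE x in lebesgue_on \<Omega>. cont_rep T \<Omega> u 0 x = u\<^sub>0 x"
    and "z = (\<lambda>t. grad \<Omega> (u t))"
    and "y \<in> L2_Y T \<Omega>" and "lam \<in> W_evol T \<Omega> \<Gamma>\<^sub>D"
    and "AE t in lebesgue_on {0<..<T}. \<forall>v\<in>V_space \<Omega> \<Gamma>\<^sub>D.
           div_dual \<Omega> (y t) v = time_deriv T \<Omega> \<Gamma>\<^sub>D lam t v - f t v"
  shows "1/2 * (Q_norm T \<Omega> (y - z))\<^sup>2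
       + 1/2 * (Q_norm T \<Omega> (\<lambda>t. grad \<Omega> ((lam - u) t)))\<^sup>2
       + 1/2 * (L2_norm \<Omega> (cont_rep T \<Omega> (lam - u) T))\<^sup>2
       = 1/2 * (Q_norm T \<Omega> (y - (\<lambda>t. grad \<Omega> (lam t))))\<^sup>2
       + 1/2 * (L2_norm \<Omega> (cont_rep T \<Omega> lam 0 - u\<^sub>0))\<^sup>2"
proof -
  interpret bounded_open_set \<Omega>
    using assms(1,2) by unfold_locales (auto simp: lipschitz_domain_def)
  let ?M = "lebesgue_on {0<..<T}" and ?\<Gamma> = "\<Gamma>\<^sub>D"
  define e where "e = (\<lambda>t. lam t - u t)"
  have e: "lam - u = e" by (auto simp: e_def)
  \<comment> \<open>A weak derivative of \<open>e\<close> assembled from the two chosen ones. The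
    energy identity accepts any weak derivative, so no comparison with the choice
    \<open>time_deriv\<close> for \<open>e\<close> is made.\<close>
  define F where "F t v = time_deriv T \<Omega> ?\<Gamma> lam t v - time_deriv T \<Omega> ?\<Gamma> u t v" for t v
  note u = W_evol_time_deriv[OF assms(11)] and l = W_evol_time_deriv[OF assms(16)]
  obtain gu gl where gu: "weak_forcing ?\<Gamma> T (time_deriv T \<Omega> ?\<Gamma> u) gu" and gl: "weak_forcing ?\<Gamma> T (time_deriv T \<Omega> ?\<Gamma> lam) gl"
    using L2_V_dual_weak_forcing[OF u(2)] L2_V_dual_weak_forcing[OF l(2)] by blast
  have cu: "is_cont_rep T \<Omega> u (cont_rep T \<Omega> u)" by (rule evolution_cont_rep[OF assms(8) u(1) gu u(3)])
  have cl: "is_cont_rep T \<Omega> lam (cont_rep T \<Omega> lam)" by (rule evolution_cont_rep[OF assms(8) l(1) gl l(3)])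
  have eV: "e \<in> L2_V T \<Omega> ?\<Gamma>" unfolding e_def by (rule V.L2_Bochner_minus[OF l(1) u(1)])
  have Ff: "weak_forcing ?\<Gamma> T F (\<lambda>t. gl t + gu t)" unfolding F_def by (rule weak_forcing_minus[OF gl gu])
  have eF: "has_time_deriv T \<Omega> ?\<Gamma> e F"
    unfolding e_def F_def by (rule has_time_deriv_minus[OF l(1) u(1) gl gu l(3) u(3)])
  have ce: "is_cont_rep T \<Omega> e (cont_rep T \<Omega> e)" by (rule evolution_cont_rep[OF assms(8) eV Ff eF])
  note en = evolution_energy_identity[OF assms(8) eV Ff eF ce]
  have I: "0 \<in> {0..T}" using assms(8) by simp
  have L2s: "cont_rep T \<Omega> e 0 \<in> L2 \<Omega>" "cont_rep T \<Omega> lam 0 \<in> L2 \<Omega>" using ce cl I by (auto simp: is_cont_rep_def)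
  \<comment> \<open>The representative of \<open>lam - u\<close> is chosen independently of those of
    \<open>lam\<close> and \<open>u\<close>; uniqueness relates them at time 0, where the initial
    condition enters.\<close>
  have e0: "L2_norm \<Omega> (cont_rep T \<Omega> e 0) = L2_norm \<Omega> (cont_rep T \<Omega> lam 0 - u\<^sub>0)"
  proof (rule L2_norm_cong)
    have "is_cont_rep T \<Omega> e (\<lambda>t. cont_rep T \<Omega> lam t - cont_rep T \<Omega> u t)"
      unfolding e_def by (rule is_cont_rep_minus[OF cl cu])
    from is_cont_rep_unique[OF assms(8) ce this I] assms(13)
    show "AE x in lebesgue_on \<Omega>. cont_rep T \<Omega> e 0 x = (cont_rep T \<Omega> lam 0 - u\<^sub>0) x"
      by eventually_elim simp
  qed (use L2s assms(10) in \<open>auto intro: L2_minus\<close>)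
  have zY: "z \<in> L2_Y T \<Omega>" unfolding assms(14) by (rule L2_V_grad_L2_Y[OF u(1)])
  have yz: "(\<lambda>t. y t - z t) \<in> L2_Y T \<Omega>" by (rule L2.L2_Bochner_minus[OF assms(15) zY])
  have i1: "integrable ?M (\<lambda>t. (L2_norm \<Omega> ((y - z) t))\<^sup>2)" using yz by (simp add: L2_Bochner_def)
  have i2: "integrable ?M (\<lambda>t. (L2_norm \<Omega> (grad \<Omega> (e t)))\<^sup>2)" using eV by (simp add: L2_Bochner_def V_norm_def)
  \<comment> \<open>At almost every time \<open>y - grad lam\<close> is (y - z) - grad e, and the
    cross term of its square equals 2 F t (e t).\<close>
  have ae: "AE t in ?M. (L2_norm \<Omega> ((y - z) t))\<^sup>2 + (L2_norm \<Omega> (grad \<Omega> (e t)))\<^sup>2 + 2 * F t (e t) =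
      (L2_norm \<Omega> ((y - (\<lambda>t. grad \<Omega> (lam t))) t))\<^sup>2"
  proof -
    have "AE t in ?M. lam t \<in> V_space \<Omega> ?\<Gamma>" "AE t in ?M. u t \<in> V_space \<Omega> ?\<Gamma>" "AE t in ?M. y t \<in> L2 \<Omega>"
      using l(1) u(1) assms(15) by (auto simp: L2_Bochner_def)
    then show ?thesis using assms(12,17)
    proof eventually_elim
      case (elim t)
      have eVt: "e t \<in> V_space \<Omega> ?\<Gamma>" unfolding e_def by (rule V_space_minus[OF elim(1,2)])
      have W: "lam t \<in> W12 \<Omega>" "u t \<in> W12 \<Omega>" "e t \<in> W12 \<Omega>" using elim(1,2) eVt by (auto intro: V_space_imp_W12)
      have g: "grad \<Omega> (lam t) \<in> L2 \<Omega>" "z t \<in> L2 \<Omega>" "grad \<Omega> (e t) \<in> L2 \<Omega>"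
        using W by (auto intro: grad_L2 simp: assms(14))
      have yzt: "y t - z t \<in> L2 \<Omega>" by (rule L2_minus[OF elim(3) g(2)])
      \<comment> \<open>Outside one null set of times both equations hold for all test functions at
        once, so the time-dependent \<open>e t\<close> may be inserted; \<open>f\<close>
        cancels.\<close>
      have Fe: "F t (e t) = - L2_inner \<Omega> (y t - z t) (grad \<Omega> (e t))"
      proof -
        have "div_dual \<Omega> (y t) (e t) = time_deriv T \<Omega> ?\<Gamma> lam t (e t) - f t (e t)"
          "time_deriv T \<Omega> ?\<Gamma> u t (e t) + neg_laplace \<Omega> (u t) (e t) = f t (e t)" using elim(4,5) eVt by blast+
        moreover have "L2_inner \<Omega> (y t - z t) (grad \<Omega> (e t)) = L2_inner \<Omega> (y t) (grad \<Omega> (e t)) - L2_inner \<Omega> (z t) (grad \<Omega> (e t))"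
          by (rule L2_inner_diff_left[OF elim(3) g(2,3)])
        ultimately show ?thesis
          unfolding F_def div_dual_def neg_laplace_def L_adj_def assms(14) by linarith
      qed
      have "L2_norm \<Omega> (y t - grad \<Omega> (lam t)) = L2_norm \<Omega> ((y t - z t) - grad \<Omega> (e t))"
      proof (rule L2_norm_cong)
        show "AE x in lebesgue_on \<Omega>. (y t - grad \<Omega> (lam t)) x = ((y t - z t) - grad \<Omega> (e t)) x"
          using grad_minus[OF W(1,2)] by eventually_elim (simp add: e_def assms(14))
      qed (intro L2_minus elim g)+
      then have "(L2_norm \<Omega> (y t - grad \<Omega> (lam t)))\<^sup>2 =
          (L2_norm \<Omega> (y t - z t))\<^sup>2 - 2 * L2_inner \<Omega> (y t - z t) (grad \<Omega> (e t)) + (L2_norm \<Omega> (grad \<Omega> (e t)))\<^sup>2"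
        by (simp add: L2_norm_diff_sq[OF yzt g(3)])
      then show ?case using Fe by simp
    qed
  qed
  have i3: "integrable ?M (\<lambda>t. (L2_norm \<Omega> ((y - z) t))\<^sup>2 + (L2_norm \<Omega> (grad \<Omega> (e t)))\<^sup>2 + 2 * F t (e t))"
    using i1 i2 en(1) by simp
  have "(LINT t|?M. (L2_norm \<Omega> ((y - (\<lambda>t. grad \<Omega> (lam t))) t))\<^sup>2) =
      (LINT t|?M. (L2_norm \<Omega> ((y - z) t))\<^sup>2 + (L2_norm \<Omega> (grad \<Omega> (e t)))\<^sup>2 + 2 * F t (e t))"
  proof (rule integral_cong_AE)
    show "(\<lambda>t. (L2_norm \<Omega> ((y - (\<lambda>t. grad \<Omega> (lam t))) t))\<^sup>2) \<in> borel_measurable ?M"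
      by (rule borel_measurable_lebesgue_on_cong_AE[OF _ borel_measurable_integrable[OF i3] ae]) simp
    show "AE t in ?M. (L2_norm \<Omega> ((y - (\<lambda>t. grad \<Omega> (lam t))) t))\<^sup>2 =
        (L2_norm \<Omega> ((y - z) t))\<^sup>2 + (L2_norm \<Omega> (grad \<Omega> (e t)))\<^sup>2 + 2 * F t (e t)"
      using ae by eventually_elim (rule sym)
  qed (rule borel_measurable_integrable[OF i3])
  also have "\<dots> = (LINT t|?M. (L2_norm \<Omega> ((y - z) t))\<^sup>2) + (LINT t|?M. (L2_norm \<Omega> (grad \<Omega> (e t)))\<^sup>2) + 2 * (LINT t|?M. F t (e t))"
    using i1 i2 en(1) by simp
  \<comment> \<open>By \<open>en\<close>, the integral of the cross term is the squared norm of
    \<open>e\<close> at \<open>T\<close> minus that at 0, and \<open>e0\<close> identifies the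
    latter.\<close>
  finally show ?thesis
    using en(2) unfolding Q_norm_sq e e0 by argo
qed

end
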